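(* Let $\Omega\subset\mathbb{R}^n$ be an open bounded Lipschitz domain with piecewise smooth boundary satisfying the cone condition, let $T>0$, $\varepsilon,\sigma>0$, $0<\mu<\varepsilon$, $\xi>0$, $\delta>0$, and let $\Omega_{\mathcal{I}}$, $\Gamma_\nu$, $V_c:=V_c(\Omega\cup\Omega_{\mathcal{I}})$, ${\bf a}$ and $\mathcal{P}$ be as in the context, where $p$, $\phi$, $A_0$ satisfy the stated assumptions. Then for every $c\in L^2(0,T;V_c')$ and every $k_0\in V_c(\Omega)$ there exists a unique $k^*\in C(0,T;V_c)\cap H^1(0,T;V_c)$ with $k^*(\cdot,0)=k_0$ in $\Omega$ and $k^*=0$ on $\Omega_{\mathcal{I}}\times(0,T)$ such that \[\int_0^T\int_\Omega k^*_t\,\varphi\,dx\,dt+\int_0^T{\bf a}(k^*(\cdot,t),\varphi(\cdot,t))\,dt=\int_0^T\int_\Omega(\mathcal{P}(k^* )-c)\,\varphi\,dx\,dt\] for all test functions $\varphi\in C(0,T;V_c)$.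
   Context: $\Omega_{\mathcal{I}}:=\{y\in\mathbb{R}^n\setminus\Omega:\|y-x\|_2<\varepsilon\text{ for some }x\in\Omega\}$. For $\nu>0$, with $B_\nu(x)$ the closed Euclidean ball of radius $\nu$ about $x$, $\Gamma_\nu(x,y):=(2\pi\sigma^2)^{-n/2}\exp(-\|x-y\|_2^2/(2\sigma^2))\mathds{1}_{B_\nu(x)}(y)$. Let $\alpha_\varepsilon(x,y):=\operatorname{sign}(\|x\|_2-\|y\|_2)\Gamma_\varepsilon(x,y)^{1/2}$ and $\mathcal{D}^*(u)(x,y):=-(u(y)-u(x))\alpha_\varepsilon(x,y)$; $|||u|||:=(\frac12\int_{\Omega\cup\Omega_{\mathcal{I}}}\int_{\Omega\cup\Omega_{\mathcal{I}}}\mathcal{D}^*(u)^2\,dy\,dx)^{1/2}$; $V_c(\Omega\cup\Omega_{\mathcal{I}}):=\{u\in L^2(\Omega\cup\Omega_{\mathcal{I}}):|||u|||<\infty,\ u=0\text{ a.e. on }\Omega_{\mathcal{I}}\}$ with norm $|||\cdot|||$; $V_c'$ is its dual with respect to the $L^2(\Omega\cup\Omega_{\mathcal{I}})$ pairing. $V_c(\Omega)$ denotes functions on $\Omega$ whose extension by zero to $\Omega_{\mathcal{I}}$ lies in $V_c(\Omega\cup\Omega_{\mathcal{I}})$. $L^2(0,T;V_c)$, $L^2(0,T;V_c')$ are the usual Bochner spaces, $H^1(0,T;V_c):=\{u\in L^2(0,T;V_c):\partial_t u\in L^2(0,T;V_c')\}$, and $C(0,T;V_c)$ the continuous $V_c$-valued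 functions on $[0,T]$; integrals involving $k_t$ or $c$ against test functions are understood as duality pairings. ${\bf a}(u,v):=\frac12\int_{\Omega\cup\Omega_{\mathcal{I}}}\int_{\Omega\cup\Omega_{\mathcal{I}}}\mathcal{D}^*(u)\mathcal{D}^*(v)\,dy\,dx+\delta\int_\Omega uv\,dx$. With $\Phi_\nu(k)(x,t):=\int_{\Omega\cup\Omega_{\mathcal{I}}}\phi(k(y,t))\Gamma_\nu(x,y)\,dy$, the productivity-production operator is \[\mathcal{P}(k)(x,t):=A_0(x)\exp\left(\frac{\Phi_\mu(k)(x,t)}{\Phi_\varepsilon(k)(x,t)+\xi}\,t\right)p(k(x,t)).\] Assumptions: $p:\mathbb{R}\to\mathbb{R}_+$ is bounded above by a constant $M_p>0$, satisfies $p(0)=0$, and is Lipschitz continuous; $\phi:\mathbb{R}\to\mathbb{R}_+$ is Lipschitz continuous; $A_0:\mathbb{R}^n\to\mathbb{R}_+$ with $A_0\in L^\infty(\Omega)$. *)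

theory Defs
  imports "HOL-Analysis.Analysis"
begin

text \<open>Lipschitz domain: near every boundary point, after choosing a unit direction e,
  the set is the strict subgraph (in direction e) of a Lipschitz function defined on the
  hyperplane orthogonal to e (here extended to the whole space, which is no restriction).\<close>
definition lipschitz_domain :: "'a::euclidean_space set \<Rightarrow> bool" where
  "lipschitz_domain Om \<longleftrightarrow> open Om \<and>
     (\<forall>x\<in>frontier Om. \<exists>r>0. \<exists>e g L. norm e = 1 \<and> L-lipschitz_on UNIV g \<and>
        ball x r \<inter> Om = ball x r \<inter> {y. e \<bullet> y < g (y - (e \<bullet> y) *\<^sub>R e)})"

fun iter_dd :: "'a::euclidean_space list \<Rightarrow> ('a \<Rightarrow> real) \<Rightarrow> 'a \<Rightarrow> real" where
  "iter_dd [] f = f"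
| "iter_dd (v # vs) f = (\<lambda>x. frechet_derivative (iter_dd vs f) (at x) v)"

definition smooth_fun :: "('a::euclidean_space \<Rightarrow> real) \<Rightarrow> bool" where
  "smooth_fun g \<longleftrightarrow> (\<forall>vs x. iter_dd vs g differentiable (at x))"

definition piecewise_smooth_boundary :: "'a::euclidean_space set \<Rightarrow> bool" where
  "piecewise_smooth_boundary Om \<longleftrightarrow>
     (\<exists>F. finite F \<and> frontier Om = \<Union>F \<and>
        (\<forall>S\<in>F. closed S \<and> (\<forall>x\<in>S. \<exists>r>0. \<exists>e g. norm e = 1 \<and> smooth_fun g \<and>
            S \<inter> ball x r \<subseteq> {y. e \<bullet> y = g (y - (e \<bullet> y) *\<^sub>R e)})))"

definition cone_condition :: "'a::euclidean_space set \<Rightarrow> bool" where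
  "cone_condition Om \<longleftrightarrow>
     (\<exists>r \<kappa>. r > 0 \<and> -1 < \<kappa> \<and> \<kappa> < 1 \<and>
        (\<forall>x\<in>Om. \<exists>e. norm e = 1 \<and>
            {x + y | y. norm y < r \<and> \<kappa> * norm y < e \<bullet> y} \<subseteq> Om))"

definition OmegaI :: "'a::euclidean_space set \<Rightarrow> real \<Rightarrow> 'a set" where
  "OmegaI Om eps = {y. y \<notin> Om \<and> (\<exists>x\<in>Om. norm (y - x) < eps)}"

definition Gam :: "real \<Rightarrow> real \<Rightarrow> 'a::euclidean_space \<Rightarrow> 'a \<Rightarrow> real" where
  "Gam sg nu x y = (2 * pi * sg\<^sup>2) powr (- real DIM('a) / 2)
      * exp (- (norm (x - y))\<^sup>2 / (2 * sg\<^sup>2)) * indicator (cball x nu) y"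

definition alpha :: "real \<Rightarrow> real \<Rightarrow> 'a::euclidean_space \<Rightarrow> 'a \<Rightarrow> real" where
  "alpha sg eps x y = sgn (norm x - norm y) * sqrt (Gam sg eps x y)"

definition Dstar :: "real \<Rightarrow> real \<Rightarrow> ('a::euclidean_space \<Rightarrow> real) \<Rightarrow> 'a \<Rightarrow> 'a \<Rightarrow> real" where
  "Dstar sg eps u x y = - (u y - u x) * alpha sg eps x y"

definition Dsq :: "'a::euclidean_space set \<Rightarrow> real \<Rightarrow> real \<Rightarrow> ('a \<Rightarrow> real) \<Rightarrow> ennreal" where
  "Dsq Om eps sg u =
     (\<integral>\<^sup>+ x\<in>Om \<union> OmegaI Om eps. (\<integral>\<^sup>+ y\<in>Om \<union> OmegaI Om eps.
         ennreal ((Dstar sg eps u x y)\<^sup>2) \<partial>lebesgue) \<partial>lebesgue)"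

definition tnorm :: "'a::euclidean_space set \<Rightarrow> real \<Rightarrow> real \<Rightarrow> ('a \<Rightarrow> real) \<Rightarrow> real" where
  "tnorm Om eps sg u = sqrt (1/2 * enn2real (Dsq Om eps sg u))"

definition Vc :: "'a::euclidean_space set \<Rightarrow> real \<Rightarrow> real \<Rightarrow> ('a \<Rightarrow> real) set" where
  "Vc Om eps sg = {u.
      u \<in> borel_measurable (lebesgue_on (Om \<union> OmegaI Om eps)) \<and>
      integrable (lebesgue_on (Om \<union> OmegaI Om eps)) (\<lambda>x. (u x)\<^sup>2) \<and>
      Dsq Om eps sg u < \<infinity> \<and>
      (AE x in lebesgue_on (OmegaI Om eps). u x = 0)}"

definition vc_inner :: "'a::euclidean_space set \<Rightarrow> real \<Rightarrow> real \<Rightarrow> ('a \<Rightarrow> real) \<Rightarrow> ('a \<Rightarrow> real) \<Rightarrow> real" where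
  "vc_inner Om eps sg u v = 1/2 *
     (LINT x:Om \<union> OmegaI Om eps|lebesgue. (LINT y:Om \<union> OmegaI Om eps|lebesgue.
         Dstar sg eps u x y * Dstar sg eps v x y))"

definition abil :: "'a::euclidean_space set \<Rightarrow> real \<Rightarrow> real \<Rightarrow> real \<Rightarrow> ('a \<Rightarrow> real) \<Rightarrow> ('a \<Rightarrow> real) \<Rightarrow> real" where
  "abil Om eps sg delta u v = vc_inner Om eps sg u v + delta * (LINT x:Om|lebesgue. u x * v x)"

definition Vc_dual :: "'a::euclidean_space set \<Rightarrow> real \<Rightarrow> real \<Rightarrow> (('a \<Rightarrow> real) \<Rightarrow> real) \<Rightarrow> bool" where
  "Vc_dual Om eps sg l \<longleftrightarrow>
     (\<forall>u\<in>Vc Om eps sg. \<forall>v\<in>Vc Om eps sg. \<forall>a b::real.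
         l (\<lambda>x. a * u x + b * v x) = a * l u + b * l v) \<and>
     (\<exists>C. \<forall>v\<in>Vc Om eps sg. \<bar>l v\<bar> \<le> C * tnorm Om eps sg v)"

definition dual_norm :: "'a::euclidean_space set \<Rightarrow> real \<Rightarrow> real \<Rightarrow> (('a \<Rightarrow> real) \<Rightarrow> real) \<Rightarrow> real" where
  "dual_norm Om eps sg l = Sup {\<bar>l v\<bar> | v. v \<in> Vc Om eps sg \<and> tnorm Om eps sg v \<le> 1}"

text \<open>L^2(0,T;V_c') (weak measurability suffices by Pettis, V_c' being separable).\<close>
definition L2_dual :: "'a::euclidean_space set \<Rightarrow> real \<Rightarrow> real \<Rightarrow> real \<Rightarrow> (real \<Rightarrow> ('a \<Rightarrow> real) \<Rightarrow> real) \<Rightarrow> bool" where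
  "L2_dual Om eps sg T c \<longleftrightarrow>
     (AE t in lebesgue_on {0..T}. Vc_dual Om eps sg (c t)) \<and>
     (\<forall>v\<in>Vc Om eps sg. (\<lambda>t. c t v) \<in> borel_measurable (lebesgue_on {0..T})) \<and>
     integrable (lebesgue_on {0..T}) (\<lambda>t. (dual_norm Om eps sg (c t))\<^sup>2)"

definition L2_Vc :: "'a::euclidean_space set \<Rightarrow> real \<Rightarrow> real \<Rightarrow> real \<Rightarrow> ('a \<Rightarrow> real \<Rightarrow> real) \<Rightarrow> bool" where
  "L2_Vc Om eps sg T k \<longleftrightarrow>
     (AE t in lebesgue_on {0..T}. (\<lambda>x. k x t) \<in> Vc Om eps sg) \<and>
     (\<forall>v\<in>Vc Om eps sg. (\<lambda>t. vc_inner Om eps sg (\<lambda>x. k x t) v) \<in> borel_measurable (lebesgue_on {0..T})) \<and>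
     integrable (lebesgue_on {0..T}) (\<lambda>t. (tnorm Om eps sg (\<lambda>x. k x t))\<^sup>2)"

definition C_Vc :: "'a::euclidean_space set \<Rightarrow> real \<Rightarrow> real \<Rightarrow> real \<Rightarrow> ('a \<Rightarrow> real \<Rightarrow> real) \<Rightarrow> bool" where
  "C_Vc Om eps sg T k \<longleftrightarrow>
     (\<forall>t\<in>{0..T}. (\<lambda>x. k x t) \<in> Vc Om eps sg) \<and>
     (\<forall>t\<in>{0..T}. \<forall>e>0. \<exists>d>0. \<forall>s\<in>{0..T}. \<bar>s - t\<bar> < d \<longrightarrow>
         tnorm Om eps sg (\<lambda>x. k x s - k x t) < e)"

definition test_fun :: "real \<Rightarrow> (real \<Rightarrow> real) \<Rightarrow> bool" where
  "test_fun T psi \<longleftrightarrow> (\<forall>m x. ((deriv ^^ m) psi) differentiable (at x)) \<and>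
     (\<exists>a b. 0 < a \<and> a \<le> b \<and> b < T \<and> (\<forall>t. t \<notin> {a..b} \<longrightarrow> psi t = 0))"

text \<open>w is the weak time derivative of k in L^2(0,T;V_c') (Gelfand triple
  V_c in L^2(Omega u Omega_I) in V_c').\<close>
definition weak_time_deriv :: "'a::euclidean_space set \<Rightarrow> real \<Rightarrow> real \<Rightarrow> real \<Rightarrow>
    ('a \<Rightarrow> real \<Rightarrow> real) \<Rightarrow> (real \<Rightarrow> ('a \<Rightarrow> real) \<Rightarrow> real) \<Rightarrow> bool" where
  "weak_time_deriv Om eps sg T k w \<longleftrightarrow> L2_dual Om eps sg T w \<and>
     (\<forall>v\<in>Vc Om eps sg. \<forall>psi. test_fun T psi \<longrightarrow>
        (LINT t:{0..T}|lebesgue. (LINT x:Om \<union> OmegaI Om eps|lebesgue. k x t * v x) * deriv psi t)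
        = - (LINT t:{0..T}|lebesgue. w t v * psi t))"

definition H1_Vc :: "'a::euclidean_space set \<Rightarrow> real \<Rightarrow> real \<Rightarrow> real \<Rightarrow> ('a \<Rightarrow> real \<Rightarrow> real) \<Rightarrow> bool" where
  "H1_Vc Om eps sg T k \<longleftrightarrow> L2_Vc Om eps sg T k \<and> (\<exists>w. weak_time_deriv Om eps sg T k w)"

definition Phi :: "'a::euclidean_space set \<Rightarrow> real \<Rightarrow> real \<Rightarrow> (real \<Rightarrow> real) \<Rightarrow> real \<Rightarrow>
    ('a \<Rightarrow> real \<Rightarrow> real) \<Rightarrow> 'a \<Rightarrow> real \<Rightarrow> real" where
  "Phi Om eps sg phi nu k x t =
     (LINT y:Om \<union> OmegaI Om eps|lebesgue. phi (k y t) * Gam sg nu x y)"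

definition Pop :: "'a::euclidean_space set \<Rightarrow> real \<Rightarrow> real \<Rightarrow> real \<Rightarrow> real \<Rightarrow> ('a \<Rightarrow> real) \<Rightarrow>
    (real \<Rightarrow> real) \<Rightarrow> (real \<Rightarrow> real) \<Rightarrow> ('a \<Rightarrow> real \<Rightarrow> real) \<Rightarrow> 'a \<Rightarrow> real \<Rightarrow> real" where
  "Pop Om eps sg mu xi A0 p phi k x t =
     A0 x * exp (Phi Om eps sg phi mu k x t / (Phi Om eps sg phi eps k x t + xi) * t)
       * p (k x t)"

definition weak_solution :: "'a::euclidean_space set \<Rightarrow> real \<Rightarrow> real \<Rightarrow> real \<Rightarrow> real \<Rightarrow> real \<Rightarrow> real \<Rightarrow>
    ('a \<Rightarrow> real) \<Rightarrow> (real \<Rightarrow> real) \<Rightarrow> (real \<Rightarrow> real) \<Rightarrow> (real \<Rightarrow> ('a \<Rightarrow> real) \<Rightarrow> real) \<Rightarrow>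
    ('a \<Rightarrow> real) \<Rightarrow> ('a \<Rightarrow> real \<Rightarrow> real) \<Rightarrow> bool" where
  "weak_solution Om eps sg mu xi delta T A0 p phi c k0 k \<longleftrightarrow>
     C_Vc Om eps sg T k \<and> H1_Vc Om eps sg T k \<and>
     (AE x in lebesgue_on Om. k x 0 = k0 x) \<and>
     (\<forall>t\<in>{0<..<T}. AE x in lebesgue_on (OmegaI Om eps). k x t = 0) \<and>
     (\<exists>w. weak_time_deriv Om eps sg T k w \<and>
        (\<forall>vphi. C_Vc Om eps sg T vphi \<longrightarrow>
           (LINT t:{0..T}|lebesgue. w t (\<lambda>x. vphi x t))
           + (LINT t:{0..T}|lebesgue. abil Om eps sg delta (\<lambda>x. k x t) (\<lambda>x. vphi x t))
           = (LINT t:{0..T}|lebesgue.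
                (LINT x:Om|lebesgue. Pop Om eps sg mu xi A0 p phi k x t * vphi x t)
                - c t (\<lambda>x. vphi x t))))"

end

theory Submission
  imports Defs "HOL-Computational_Algebra.Polynomial"
begin

text \<open>The interaction kernel is bounded and has range \<open>eps\<close>, so the energy norm is equivalent to the
  \<open>L\<^sup>2\<close> norm on functions vanishing outside the domain: the upper bound is immediate, and the
  Poincare inequality follows because shifting such a function \<open>N\<close> times by a vector \<open>h\<close> with
  \<open>eps/2 < |h| < eps\<close> moves its support off itself, each shift costing the same by translation
  invariance; averaging over \<open>h\<close> gives the energy. The problem is thus an ordinary differential
  equation in \<open>L\<^sup>2(\<Omega>)\<close> with a bounded linear part, a globally Lipschitz nonlinearity (the exponent is
  bounded since \<open>\<Phi>\<^sub>\<mu> \<le> \<Phi>\<^sub>\<epsilon>\<close>) and a square integrable source. The source is integrated in the weak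
  sense through the Riesz theorem, the integral equation is solved by Banach's fixed point theorem in
  an exponentially weighted norm, and uniqueness follows from the lemma of du Bois-Reymond and Gronwall's
  inequality. Measurability of the dual norm of the time derivative needs no separability: its square
  expands into an inner product whose only new term pairs the source with a continuous function.\<close>

section \<open>The Hilbert space of square integrable functions\<close>

definition sqint :: "'b measure \<Rightarrow> ('b \<Rightarrow> real) \<Rightarrow> bool" where
  "sqint M f \<longleftrightarrow> f \<in> borel_measurable M \<and> integrable M (\<lambda>x. (f x)\<^sup>2)"

lemma sqint_integrable_mult:
  assumes "sqint M f" "sqint M g"
  shows "integrable M (\<lambda>x. f x * g x)"
proof (rule Bochner_Integration.integrable_bound)
  show "integrable M (\<lambda>x. (f x)\<^sup>2 + (g x)\<^sup>2)"
    using assms by (auto simp: sqint_def)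
  show "(\<lambda>x. f x * g x) \<in> borel_measurable M"
    using assms by (auto simp: sqint_def)
  have "\<bar>a * b\<bar> \<le> a\<^sup>2 + b\<^sup>2" for a b :: real
    using sum_squares_bound[of "\<bar>a\<bar>" "\<bar>b\<bar>"] mult_nonneg_nonneg[of "\<bar>a\<bar>" "\<bar>b\<bar>"]
    unfolding abs_mult power2_abs by linarith
  then show "AE x in M. norm (f x * g x) \<le> norm ((f x)\<^sup>2 + (g x)\<^sup>2)"
    by (intro AE_I2) simp
qed

lemma sqint_lincomb:
  assumes f: "sqint M f" and g: "sqint M g"
  shows "sqint M (\<lambda>x. a * f x + b * g x)"
proof -
  have "integrable M (\<lambda>x. a\<^sup>2 * (f x)\<^sup>2 + 2 * a * b * (f x * g x) + b\<^sup>2 * (g x)\<^sup>2)"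
    using sqint_integrable_mult[OF f g] f g by (auto simp: sqint_def)
  also have "(\<lambda>x. a\<^sup>2 * (f x)\<^sup>2 + 2 * a * b * (f x * g x) + b\<^sup>2 * (g x)\<^sup>2)
      = (\<lambda>x. (a * f x + b * g x)\<^sup>2)"
    by (auto simp: power2_eq_square algebra_simps)
  finally show ?thesis
    using f g by (auto simp: sqint_def)
qed

lemma sqint_add: "sqint M f \<Longrightarrow> sqint M g \<Longrightarrow> sqint M (\<lambda>x. f x + g x)"
  using sqint_lincomb[of M f g 1 1] by simp

lemma sqint_diff: "sqint M f \<Longrightarrow> sqint M g \<Longrightarrow> sqint M (\<lambda>x. f x - g x)"
  using sqint_lincomb[of M f g 1 "-1"] by simp

lemma sqint_scale: "sqint M f \<Longrightarrow> sqint M (\<lambda>x. a * f x)"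
  using sqint_lincomb[of M f f a 0] by simp

lemma sqint_zero: "sqint M (\<lambda>x. 0)"
  by (simp add: sqint_def)

lemma sqint_uminus: "sqint M f \<Longrightarrow> sqint M (\<lambda>x. - f x)"
  using sqint_scale[of M f "-1"] by simp

lemma sqint_bound:
  assumes "sqint M f" "g \<in> borel_measurable M" "AE x in M. \<bar>g x\<bar> \<le> \<bar>f x\<bar>"
  shows "sqint M g"
  unfolding sqint_def
proof
  show "integrable M (\<lambda>x. (g x)\<^sup>2)"
  proof (rule Bochner_Integration.integrable_bound)
    show "integrable M (\<lambda>x. (f x)\<^sup>2)" using assms by (auto simp: sqint_def)
    show "AE x in M. norm ((g x)\<^sup>2) \<le> norm ((f x)\<^sup>2)"
      using assms(3) by eventually_elim (simp add: abs_le_square_iff)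
  qed (use assms in measurable)
qed (use assms in auto)

lemma sqint_indicator:
  assumes "sqint M f" "A \<in> sets M"
  shows "sqint M (\<lambda>x. indicator A x * f x)"
  by (rule sqint_bound[OF assms(1)]) (use assms in \<open>auto simp: indicator_def sqint_def\<close>)

lemma nn_integral_sq_diff_le_Fatou:
  assumes [measurable]: "\<And>n. f n \<in> borel_measurable M" "g \<in> borel_measurable M" "h \<in> borel_measurable M"
    and lim: "AE x in M. (\<lambda>n. f n x) \<longlonglongrightarrow> g x"
    and bd: "\<forall>\<^sub>F n in sequentially. (\<integral>\<^sup>+ x. ennreal ((f n x - h x)\<^sup>2) \<partial>M) \<le> e"
  shows "(\<integral>\<^sup>+ x. ennreal ((g x - h x)\<^sup>2) \<partial>M) \<le> e"
proof -
  have "(\<integral>\<^sup>+ x. ennreal ((g x - h x)\<^sup>2) \<partial>M) = (\<integral>\<^sup>+ x. liminf (\<lambda>n. ennreal ((f n x - h x)\<^sup>2)) \<partial>M)"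
  proof (intro nn_integral_cong_AE)
    show "AE x in M. ennreal ((g x - h x)\<^sup>2) = liminf (\<lambda>n. ennreal ((f n x - h x)\<^sup>2))"
      using lim
    proof eventually_elim
      case (elim x)
      then have "(\<lambda>n. ennreal ((f n x - h x)\<^sup>2)) \<longlonglongrightarrow> ennreal ((g x - h x)\<^sup>2)"
        by (intro tendsto_intros) auto
      then show ?case by (metis lim_imp_Liminf sequentially_bot)
    qed
  qed
  also have "\<dots> \<le> liminf (\<lambda>n. \<integral>\<^sup>+ x. ennreal ((f n x - h x)\<^sup>2) \<partial>M)"
    by (intro nn_integral_liminf) measurable
  also have "\<dots> \<le> e"
    using bd Liminf_mono[of _ "\<lambda>_. e" sequentially] by (simp add: Liminf_const)
  finally show ?thesis .
qed

text \<open>Since $d \le (2^{-n} + 2^n d^2)/2$, a bound on the sum of $2^n \int |f_{n+1}-f_n|^2$ makes the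
  increments absolutely summable almost everywhere.\<close>

lemma AE_convergent_of_fast_Cauchy:
  assumes [measurable]: "\<And>n. f n \<in> borel_measurable M"
    and bd: "\<And>n. (\<integral>\<^sup>+ x. ennreal ((f (Suc n) x - f n x)\<^sup>2) \<partial>M) \<le> ennreal ((1/4)^n)"
  shows "AE x in M. convergent (\<lambda>n. f n x :: real)"
proof -
  let ?S = "\<lambda>x. \<Sum>n. ennreal (2^n * (f (Suc n) x - f n x)\<^sup>2)"
  have "(\<integral>\<^sup>+ x. ?S x \<partial>M) = (\<Sum>n. \<integral>\<^sup>+ x. ennreal (2^n * (f (Suc n) x - f n x)\<^sup>2) \<partial>M)"
    by (intro nn_integral_suminf) measurable
  also have "\<dots> \<le> (\<Sum>n. ennreal ((1/2)^n))"
  proof (intro suminf_le)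
    fix n
    have "(\<integral>\<^sup>+ x. ennreal (2^n * (f (Suc n) x - f n x)\<^sup>2) \<partial>M)
        = ennreal (2^n) * (\<integral>\<^sup>+ x. ennreal ((f (Suc n) x - f n x)\<^sup>2) \<partial>M)"
      by (subst nn_integral_cmult[symmetric]) (auto simp: ennreal_mult)
    also have "\<dots> \<le> ennreal (2^n) * ennreal ((1/4)^n)"
      by (intro mult_left_mono bd) auto
    also have "\<dots> = ennreal ((1/2)^n)"
      by (simp add: ennreal_mult[symmetric] power_mult_distrib[symmetric])
    finally show "(\<integral>\<^sup>+ x. ennreal (2^n * (f (Suc n) x - f n x)\<^sup>2) \<partial>M) \<le> ennreal ((1/2)^n)" .
  qed auto
  also have "\<dots> = ennreal (\<Sum>n. (1/2)^n)"
    by (intro suminf_ennreal2) (auto intro!: summable_geometric)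
  also have "\<dots> < \<infinity>" by simp
  finally have "AE x in M. ?S x \<noteq> \<infinity>"
    by (intro nn_integral_noteq_infinite) auto
  then show ?thesis
  proof eventually_elim
    case (elim x)
    have s: "summable (\<lambda>n. 2^n * (f (Suc n) x - f n x)\<^sup>2)"
      by (rule summable_suminf_not_top) (use elim in auto)
    have "summable (\<lambda>n. f (Suc n) x - f n x)"
    proof (rule summable_comparison_test_ev)
      show "summable (\<lambda>n. (1/2)^n + 2^n * (f (Suc n) x - f n x)\<^sup>2)"
        by (intro summable_add s summable_geometric) auto
      have "\<bar>d\<bar> \<le> (1/2)^n + 2^n * d\<^sup>2" for d :: real and n :: nat
      proof -
        have "2 * \<bar>d\<bar> * 1 \<le> 1 * (1/2)^n + 2^n * d\<^sup>2"
          using sum_squares_bound[of "sqrt (2^n) * \<bar>d\<bar>" "sqrt ((1/2)^n)"]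
          by (simp add: power_mult_distrib real_sqrt_mult[symmetric] power_one_over
              real_sqrt_divide divide_simps)
        moreover have "0 \<le> (1/2::real)^n + 2^n * d\<^sup>2" by simp
        ultimately show ?thesis by linarith
      qed
      then show "\<forall>\<^sub>F n in sequentially. norm (f (Suc n) x - f n x) \<le> (1/2)^n + 2^n * (f (Suc n) x - f n x)\<^sup>2"
        by simp
    qed
    then have "convergent (\<lambda>n. \<Sum>i<n. f (Suc i) x - f i x)"
      by (simp add: summable_iff_convergent)
    then have "convergent (\<lambda>n. f n x - f 0 x)"
      by (simp add: sum_lessThan_telescope[of "\<lambda>i. f i x"])
    from convergent_add[OF this convergent_const[of "f 0 x"]] show ?case by simp
  qed
qed

quotient_type (overloaded) 'a l2 = "'a::euclidean_space \<Rightarrow> real" /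
  partial: "\<lambda>f g. sqint lebesgue f \<and> sqint lebesgue g \<and> (AE x in lebesgue. f x = g x)"
  morphisms fn l2_of
proof (rule part_equivpI)
  show "\<exists>f :: 'a \<Rightarrow> real. sqint lebesgue f \<and> sqint lebesgue f \<and> (AE x in lebesgue. f x = f x)"
    by (intro exI[of _ "\<lambda>x. 0"]) (simp add: sqint_zero)
qed (auto intro!: sympI transpI elim: eventually_elim2)


lift_definition inner_l2' :: "'a::euclidean_space l2 \<Rightarrow> 'a l2 \<Rightarrow> real" is
  "\<lambda>f g. \<integral>x. f x * g x \<partial>lebesgue"
proof -
  fix f1 f2 g1 g2 :: "'a \<Rightarrow> real"
  assume f: "sqint lebesgue f1 \<and> sqint lebesgue f2 \<and> (AE x in lebesgue. f1 x = f2 x)"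
    and g: "sqint lebesgue g1 \<and> sqint lebesgue g2 \<and> (AE x in lebesgue. g1 x = g2 x)"
  have "AE x in lebesgue. f1 x * g1 x = f2 x * g2 x"
    using f g by (auto elim: eventually_elim2)
  moreover have "f1 \<in> borel_measurable lebesgue" "f2 \<in> borel_measurable lebesgue"
    "g1 \<in> borel_measurable lebesgue" "g2 \<in> borel_measurable lebesgue"
    using f g by (auto simp: sqint_def)
  ultimately show "(\<integral>x. f1 x * g1 x \<partial>lebesgue) = (\<integral>x. f2 x * g2 x \<partial>lebesgue)"
    by (intro integral_cong_AE) auto
qed

instantiation l2 :: (euclidean_space) real_vector
begin

lift_definition zero_l2 :: "'a l2" is "\<lambda>x. 0"
  by (simp add: sqint_zero)

lift_definition plus_l2 :: "'a l2 \<Rightarrow> 'a l2 \<Rightarrow> 'a l2" is "\<lambda>f g x. f x + g x"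
  by (auto intro: sqint_add elim: eventually_elim2)

lift_definition minus_l2 :: "'a l2 \<Rightarrow> 'a l2 \<Rightarrow> 'a l2" is "\<lambda>f g x. f x - g x"
  by (auto intro: sqint_diff elim: eventually_elim2)

lift_definition uminus_l2 :: "'a l2 \<Rightarrow> 'a l2" is "\<lambda>f x. - f x"
  by (auto intro: sqint_uminus elim: eventually_mono)

lift_definition scaleR_l2 :: "real \<Rightarrow> 'a l2 \<Rightarrow> 'a l2" is "\<lambda>a f x. a * f x"
  by (auto intro: sqint_scale elim: eventually_mono)

instance
proof
  fix f g h :: "'a l2" and a b :: real
  show "f + g + h = f + (g + h)"
    by transfer (auto intro!: sqint_add simp: add.assoc)
  show "f + g = g + f"
    by transfer (auto intro!: sqint_add simp: add.commute)
  show "0 + f = f"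
    by transfer auto
  show "- f + f = 0"
    by transfer (auto simp: sqint_zero)
  show "f - g = f + - g"
    by transfer (auto intro!: sqint_diff sqint_add sqint_uminus)
  show "a *\<^sub>R (f + g) = a *\<^sub>R f + a *\<^sub>R g"
    by transfer (auto intro!: sqint_add sqint_scale simp: algebra_simps)
  show "(a + b) *\<^sub>R f = a *\<^sub>R f + b *\<^sub>R f"
    by transfer (auto intro!: sqint_add sqint_scale simp: algebra_simps)
  show "a *\<^sub>R b *\<^sub>R f = (a * b) *\<^sub>R f"
    by transfer (auto intro!: sqint_scale simp: algebra_simps)
  show "1 *\<^sub>R f = f"
    by transfer auto
qed

end

instantiation l2 :: (euclidean_space) real_inner
begin

definition inner_l2 :: "'a l2 \<Rightarrow> 'a l2 \<Rightarrow> real" where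
  "inner_l2 = inner_l2'"

definition norm_l2 :: "'a l2 \<Rightarrow> real" where
  "norm_l2 f = sqrt (inner f f)"

definition dist_l2 :: "'a l2 \<Rightarrow> 'a l2 \<Rightarrow> real" where
  "dist_l2 f g = norm (f - g)"

definition sgn_l2 :: "'a l2 \<Rightarrow> 'a l2" where
  "sgn_l2 f = inverse (norm f) *\<^sub>R f"

definition uniformity_l2 :: "('a l2 \<times> 'a l2) filter" where
  "uniformity_l2 = (INF e\<in>{0 <..}. principal {(x, y). dist x y < e})"

definition open_l2 :: "'a l2 set \<Rightarrow> bool" where
  "open_l2 U \<longleftrightarrow> (\<forall>x\<in>U. eventually (\<lambda>(x', y). x' = x \<longrightarrow> y \<in> U) uniformity)"

instance
proof
  fix f g h :: "'a l2" and a :: real and U :: "'a l2 set"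
  show "sgn f = f /\<^sub>R norm f"
    by (simp add: sgn_l2_def)
  show "dist f g = norm (f - g)"
    by (simp add: dist_l2_def)
  show "uniformity = (INF e\<in>{0 <..}. principal {(x, y :: 'a l2). dist x y < e})"
    by (simp add: uniformity_l2_def)
  show "open U \<longleftrightarrow> (\<forall>x\<in>U. eventually (\<lambda>(x', y). x' = x \<longrightarrow> y \<in> U) uniformity)"
    by (simp add: open_l2_def)
  show "f \<bullet> g = g \<bullet> f"
    unfolding inner_l2_def by transfer (simp add: mult.commute)
  show "(f + g) \<bullet> h = f \<bullet> h + g \<bullet> h"
    unfolding inner_l2_def by transfer (simp add: sqint_integrable_mult distrib_right)
  show "(a *\<^sub>R f) \<bullet> g = a * (f \<bullet> g)"
    unfolding inner_l2_def by transfer (simp add: mult.assoc)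
  show "0 \<le> f \<bullet> f"
    unfolding inner_l2_def by transfer simp
  show "(f \<bullet> f = 0) = (f = 0)"
    unfolding inner_l2_def
  proof transfer
    fix f :: "'a \<Rightarrow> real"
    assume f: "sqint lebesgue f \<and> sqint lebesgue f \<and> (AE x in lebesgue. f x = f x)"
    have "integrable lebesgue (\<lambda>x. f x * f x)"
      using f by (simp add: sqint_integrable_mult)
    then show "((\<integral>x. f x * f x \<partial>lebesgue) = 0) =
        (sqint lebesgue f \<and> sqint lebesgue (\<lambda>x::'a. 0) \<and> (AE x in lebesgue. f x = 0))"
      using f by (subst integral_nonneg_eq_0_iff_AE) (auto simp: sqint_zero)
  qed
  show "norm f = sqrt (f \<bullet> f)"
    by (simp add: norm_l2_def)
qed

end


lemma sqint_fn: "sqint lebesgue (fn f)"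
  using Quotient3_rep_reflp[OF Quotient3_l2, of f] by simp

lemma l2_of_fn [simp]: "l2_of (fn f) = f"
  using Quotient3_abs_rep[OF Quotient3_l2] by fast

lemma l2_of_eq_iff:
  assumes "sqint lebesgue f" "sqint lebesgue g"
  shows "l2_of f = l2_of g \<longleftrightarrow> (AE x in lebesgue. f x = g x)"
  using Quotient3_rel[OF Quotient3_l2, of f g] assms by auto

lemma fn_l2_of:
  assumes "sqint lebesgue f"
  shows "AE x in lebesgue. fn (l2_of f) x = f x"
  using l2_of_eq_iff[OF sqint_fn assms, of "l2_of f"] by simp

lemma l2_of_lincomb:
  assumes "sqint lebesgue f" "sqint lebesgue g"
  shows "l2_of (\<lambda>x. a * f x + b * g x) = a *\<^sub>R l2_of f + b *\<^sub>R l2_of g"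
  using assms
  by (simp add: plus_l2.abs_eq scaleR_l2.abs_eq sqint_scale)

lemma l2_of_diff:
  assumes "sqint lebesgue f" "sqint lebesgue g"
  shows "l2_of (\<lambda>x. f x - g x) = l2_of f - l2_of g"
  using l2_of_lincomb[OF assms, of 1 "-1"] by simp

lemma l2_of_zero: "l2_of (\<lambda>x. 0) = 0"
  by (simp add: zero_l2.abs_eq)

lemma inner_l2_of:
  assumes "sqint lebesgue f" "sqint lebesgue g"
  shows "l2_of f \<bullet> l2_of g = (\<integral>x. f x * g x \<partial>lebesgue)"
  using assms unfolding inner_l2_def by (simp add: inner_l2'.abs_eq)

lemma norm_l2_of_sq:
  assumes "sqint lebesgue f"
  shows "(norm (l2_of f))\<^sup>2 = (\<integral>x. (f x)\<^sup>2 \<partial>lebesgue)"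
  using inner_l2_of[OF assms assms] unfolding power2_norm_eq_inner by (simp add: power2_eq_square)

lemma nn_integral_sq_l2_of:
  assumes "sqint lebesgue f"
  shows "(\<integral>\<^sup>+x. ennreal ((f x)\<^sup>2) \<partial>lebesgue) = ennreal ((norm (l2_of f))\<^sup>2)"
  using assms unfolding norm_l2_of_sq[OF assms]
  by (intro nn_integral_eq_integral) (auto simp: sqint_def)

lemma fast_Cauchy_subsequence:
  fixes X :: "nat \<Rightarrow> 'b::metric_space"
  assumes "Cauchy X"
  obtains r where "strict_mono (r :: nat \<Rightarrow> nat)" "\<And>n m. r n \<le> m \<Longrightarrow> dist (X m) (X (r n)) < (1/2)^n"
proof -
  have "\<forall>n. \<exists>N. \<forall>i\<ge>N. \<forall>j\<ge>N. dist (X i) (X j) < (1/2)^n"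
    using assms by (simp add: Cauchy_def)
  then obtain N where N: "\<And>n i j. N n \<le> i \<Longrightarrow> N n \<le> j \<Longrightarrow> dist (X i) (X j) < (1/2)^n"
    by metis
  define r where "r n = (\<Sum>i\<le>n. N i) + n" for n
  have le: "N n \<le> r n" for n
    unfolding r_def using member_le_sum[of n "{..n}" N] by simp
  have "strict_mono r"
    unfolding strict_mono_Suc_iff r_def by simp
  moreover have "dist (X m) (X (r n)) < (1/2)^n" if "r n \<le> m" for n m
    using N[of n m "r n"] le[of n] that by simp
  ultimately show thesis using that by blast
qed

instance l2 :: (euclidean_space) complete_space
proof
  fix X :: "nat \<Rightarrow> 'a l2"
  assume "Cauchy X"
  then obtain r where r: "strict_mono r"
      and rX: "\<And>n m. r n \<le> m \<Longrightarrow> dist (X m) (X (r n)) < (1/2)^n"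
    using fast_Cauchy_subsequence by blast
  define f where "f n = fn (X (r n))" for n
  have sq: "sqint lebesgue (f n)" for n
    unfolding f_def by (rule sqint_fn)
  have [measurable]: "f n \<in> borel_measurable lebesgue" for n
    using sq by (simp add: sqint_def)
  have bd: "(\<integral>\<^sup>+ x. ennreal ((f m x - f n x)\<^sup>2) \<partial>lebesgue) \<le> ennreal ((1/4)^n)" if "n \<le> m" for m n
  proof -
    have "dist (X (r m)) (X (r n)) < (1/2)^n"
      using rX[of n "r m"] strict_mono_less_eq[OF r] that by simp
    then have "(norm (X (r m) - X (r n)))\<^sup>2 \<le> ((1/2)^n)\<^sup>2"
      by (intro power_mono) (auto simp: dist_norm)
    also have "((1/2)^n)\<^sup>2 = ((1/4)^n :: real)"
      by (simp add: power2_eq_square power_mult_distrib[symmetric])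
    finally have "(norm (X (r m) - X (r n)))\<^sup>2 \<le> (1/4)^n" .
    moreover have "l2_of (\<lambda>x. f m x - f n x) = X (r m) - X (r n)"
      by (subst l2_of_diff[OF sq sq]) (simp add: f_def)
    ultimately show ?thesis
      by (subst nn_integral_sq_l2_of[OF sqint_diff[OF sq sq]]) (simp add: ennreal_leI)
  qed
  have conv: "AE x in lebesgue. convergent (\<lambda>n. f n x)"
    by (rule AE_convergent_of_fast_Cauchy) (use bd in auto)
  define g where "g x = lim (\<lambda>n. f n x)" for x
  have [measurable]: "g \<in> borel_measurable lebesgue"
    unfolding g_def by (rule borel_measurable_lim_metric) simp
  have lim: "AE x in lebesgue. (\<lambda>n. f n x) \<longlonglongrightarrow> g x"
    using conv by eventually_elim (simp add: g_def convergent_LIMSEQ_iff)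
  have gb: "(\<integral>\<^sup>+ x. ennreal ((g x - f n x)\<^sup>2) \<partial>lebesgue) \<le> ennreal ((1/4)^n)" for n
    by (rule nn_integral_sq_diff_le_Fatou[OF _ _ _ lim])
      (auto intro!: eventually_sequentiallyI[of n] bd)
  have sqd: "sqint lebesgue (\<lambda>x. g x - f n x)" for n
    unfolding sqint_def
    by (auto intro!: integrableI_bounded le_less_trans[OF gb[of n]])
  have sqg: "sqint lebesgue g"
    using sqint_add[OF sqd[of 0] sq[of 0]] by simp
  have n1: "norm (l2_of g - X (r n)) \<le> (1/2)^n" for n
  proof -
    have "l2_of (\<lambda>x. g x - f n x) = l2_of g - X (r n)"
      by (subst l2_of_diff[OF sqg sq]) (simp add: f_def)
    then have "ennreal ((norm (l2_of g - X (r n)))\<^sup>2) \<le> ennreal ((1/4)^n)"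
      using gb[of n] nn_integral_sq_l2_of[OF sqd[of n]] by simp
    then have "(norm (l2_of g - X (r n)))\<^sup>2 \<le> ((1/2)^n)\<^sup>2"
      by (simp add: power2_eq_square power_mult_distrib[symmetric])
    then show ?thesis
      using abs_le_square_iff[of "norm (l2_of g - X (r n))" "(1/2)^n"] by simp
  qed
  have "(\<lambda>n. X (r n) - l2_of g) \<longlonglongrightarrow> 0"
  proof (rule Lim_null_comparison)
    show "\<forall>\<^sub>F n in sequentially. norm (X (r n) - l2_of g) \<le> (1/2)^n"
      using n1 by (simp add: norm_minus_commute)
    show "(\<lambda>n. (1/2::real)^n) \<longlonglongrightarrow> 0"
      by (rule LIMSEQ_realpow_zero) auto
  qed
  then have "(X \<circ> r) \<longlonglongrightarrow> l2_of g"
    by (simp add: LIM_zero_iff o_def)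
  then show "convergent X"
    using Cauchy_converges_subseq[OF \<open>Cauchy X\<close> r] by (auto simp: convergent_def)
qed

instance l2 :: (euclidean_space) banach ..

text \<open>The solution is the minimiser of $b(v,v) - 2 l(v)$; the parallelogram identity makes
  minimising sequences Cauchy.\<close>

lemma symmetric_Lax_Milgram:
  fixes b :: "'h::banach \<Rightarrow> 'h \<Rightarrow> real"
  assumes bb: "bounded_bilinear b" and sym: "\<And>u v. b u v = b v u"
    and \<alpha>: "\<alpha> > 0" and coer: "\<And>v. \<alpha> * (norm v)\<^sup>2 \<le> b v v" and bl: "bounded_linear l"
  shows "\<exists>u. \<forall>v. b u v = l v"
proof -
  interpret b: bounded_bilinear b by fact
  interpret l: bounded_linear l by fact
  obtain K where K: "\<And>v. \<bar>l v\<bar> \<le> norm v * K" "K > 0"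
    using l.pos_bounded by auto
  define F where "F v = b v v - 2 * l v" for v
  have low: "- (K\<^sup>2 / \<alpha>) \<le> F v" for v
  proof -
    have "0 \<le> (\<alpha> * norm v - K)\<^sup>2 / \<alpha>" using \<alpha> by simp
    also have "\<dots> = \<alpha> * (norm v)\<^sup>2 - 2 * (norm v * K) + K\<^sup>2 / \<alpha>"
      using \<alpha> by (simp add: power2_eq_square field_simps)
    also have "\<dots> \<le> b v v - 2 * l v + K\<^sup>2 / \<alpha>"
      using coer[of v] K(1)[of v] by linarith
    finally show ?thesis unfolding F_def by linarith
  qed
  define m where "m = Inf (range F)"
  have bdd: "bdd_below (range F)"
    using low by (intro bdd_belowI2)
  have mle: "m \<le> F v" for v
    unfolding m_def by (intro cInf_lower bdd) auto
  have "\<exists>v. F v < m + 1 / real (Suc n)" for n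
  proof -
    have "Inf (range F) < m + 1 / real (Suc n)" unfolding m_def by simp
    then show ?thesis
      using cInf_lessD[of "range F"] by blast
  qed
  then obtain X where X: "\<And>n. F (X n) < m + 1 / real (Suc n)" by metis
  have par: "\<alpha> * (norm (u - v))\<^sup>2 \<le> 2 * (F u - m) + 2 * (F v - m)" for u v
  proof -
    define w where "w = (1/2) *\<^sub>R (u + v)"
    have e: "b (u - v) (u - v) = 2 * F u + 2 * F v - 4 * F w"
      unfolding F_def w_def
      by (simp add: b.diff_left b.diff_right b.add_left b.add_right b.scaleR_left b.scaleR_right
          l.add l.scaleR algebra_simps sym[of v u])
    show ?thesis
      using coer[of "u - v"] mle[of w] unfolding e by argo
  qed
  have "Cauchy X"
  proof (rule metric_CauchyI)
    fix e :: real assume e: "e > 0"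
    obtain N where N: "1 / real (Suc N) < \<alpha> * e\<^sup>2 / 4"
      using reals_Archimedean[of "\<alpha> * e\<^sup>2 / 4"] e \<alpha> by (auto simp: inverse_eq_divide)
    show "\<exists>M. \<forall>i\<ge>M. \<forall>j\<ge>M. dist (X i) (X j) < e"
    proof (intro exI allI impI)
      fix i j assume ij: "N \<le> i" "N \<le> j"
      have "1 / real (Suc i) \<le> 1 / real (Suc N)" "1 / real (Suc j) \<le> 1 / real (Suc N)"
        using ij by (auto simp: frac_le)
      then have "F (X i) - m < \<alpha> * e\<^sup>2 / 4" "F (X j) - m < \<alpha> * e\<^sup>2 / 4"
        using X[of i] X[of j] N by linarith+
      then have "\<alpha> * (norm (X i - X j))\<^sup>2 < \<alpha> * e\<^sup>2"
        using par[of "X i" "X j"] by argo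
      then have "(norm (X i - X j))\<^sup>2 < e\<^sup>2" using \<alpha> by simp
      then show "dist (X i) (X j) < e"
        using e by (simp add: dist_norm power_less_imp_less_base)
    qed
  qed
  then obtain u where u: "X \<longlonglongrightarrow> u" by (auto simp: Cauchy_convergent_iff convergent_def)
  have "(\<lambda>n. F (X n)) \<longlonglongrightarrow> F u"
    unfolding F_def by (intro tendsto_intros b.tendsto l.tendsto u)
  moreover have "(\<lambda>n. m + 1 / real (Suc n)) \<longlonglongrightarrow> m + 0"
    by (intro tendsto_intros LIMSEQ_Suc[OF lim_1_over_n])
  ultimately have "F u \<le> m + 0"
    by (rule LIMSEQ_le) (use X less_imp_le in blast)
  then have min: "F u \<le> F v" for v using mle[of v] by simp
  have "b u v = l v" for v
  proof -
    define A where "A = b u v - l v"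
    define B where "B = b v v"
    have B: "B \<ge> 0" using coer[of v] \<alpha> unfolding B_def
      by (meson mult_nonneg_nonneg less_imp_le order_trans zero_le_power2)
    have q: "0 \<le> 2 * t * A + t\<^sup>2 * B" for t
      using min[of "u + t *\<^sub>R v"] unfolding F_def A_def B_def
      by (simp add: b.add_left b.add_right b.scaleR_left b.scaleR_right l.add l.scaleR
          sym[of v u] power2_eq_square algebra_simps)
    define s where "s = A / (B + 1)"
    have A: "A = s * (B + 1)" using B by (simp add: s_def)
    have "0 \<le> - (s\<^sup>2 * (B + 2))"
      using q[of "- s"] by (simp add: A power2_eq_square algebra_simps)
    then have "s = 0"
      using B by (auto simp: zero_le_mult_iff mult_le_0_iff power2_eq_square)
    then have "A = 0" by (simp add: A)
    then show ?thesis by (simp add: A_def)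
  qed
  then show ?thesis by blast
qed

lemma Riesz_representation:
  fixes l :: "'a::euclidean_space l2 \<Rightarrow> real"
  assumes "bounded_linear l"
  shows "\<exists>u. \<forall>v. u \<bullet> v = l v"
proof (rule symmetric_Lax_Milgram[OF bounded_bilinear_inner _ zero_less_one _ assms])
  show "u \<bullet> v = v \<bullet> u" for u v :: "'a l2"
    by (rule inner_commute)
  show "1 * (norm v)\<^sup>2 \<le> v \<bullet> v" for v :: "'a l2"
    unfolding power2_norm_eq_inner by simp
qed

section \<open>Smooth test functions in time and weak derivatives\<close>

definition flat_exp :: "real poly \<Rightarrow> real \<Rightarrow> real" where
  "flat_exp P x = (if x > 0 then poly P (1 / x) * exp (- (1 / x)) else 0)"

lemma poly_times_exp_minus_tendsto_0:
  fixes P :: "real poly"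
  shows "((\<lambda>y. poly P y * exp (- y)) \<longlongrightarrow> 0) at_top"
proof -
  have "((\<lambda>y. \<Sum>i\<le>degree P. coeff P i * (y ^ i / exp y)) \<longlongrightarrow> (\<Sum>i\<le>degree P. coeff P i * 0)) at_top"
    by (intro tendsto_intros tendsto_power_div_exp_0)
  then show ?thesis
    by (simp add: poly_altdef sum_distrib_right exp_minus divide_inverse mult.assoc)
qed

lemma flat_exp_has_derivative:
  "(flat_exp P has_real_derivative flat_exp ((P - pderiv P) * [:0, 0, 1:]) x) (at x)"
proof -
  consider "x > 0" | "x < 0" | "x = 0" by linarith
  then show ?thesis
  proof cases
    case 1
    have "((\<lambda>x. poly P (1 / x) * exp (- (1 / x))) has_real_derivative
        (poly ((P - pderiv P) * [:0, 0, 1:]) (1 / x) * exp (- (1 / x)))) (at x)"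
      using 1 by (auto intro!: derivative_eq_intros simp: field_simps power2_eq_square)
    then have "(flat_exp P has_real_derivative
        (poly ((P - pderiv P) * [:0, 0, 1:]) (1 / x) * exp (- (1 / x)))) (at x)"
      by (rule has_field_derivative_transform_within_open[where S = "{0<..}"])
        (use 1 in \<open>auto simp: flat_exp_def\<close>)
    then show ?thesis using 1 by (simp add: flat_exp_def)
  next
    case 2
    have "((\<lambda>x. 0) has_real_derivative 0) (at x)" by simp
    then have "(flat_exp P has_real_derivative 0) (at x)"
      by (rule has_field_derivative_transform_within_open[where S = "{..<0}"])
        (use 2 in \<open>auto simp: flat_exp_def\<close>)
    then show ?thesis using 2 by (simp add: flat_exp_def)
  next
    case 3
    have "((\<lambda>h. flat_exp P h / h) \<longlongrightarrow> 0) (at 0)"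
      unfolding filterlim_at_split
    proof
      show "((\<lambda>h. flat_exp P h / h) \<longlongrightarrow> 0) (at_left 0)"
        by (rule tendsto_eventually) (auto simp: eventually_at_left_field flat_exp_def intro: exI[of _ "-1"])
      have "((\<lambda>h. poly (pCons 0 P) (inverse h) * exp (- inverse h)) \<longlongrightarrow> 0) (at_right 0)"
        by (rule filterlim_compose[OF poly_times_exp_minus_tendsto_0 filterlim_inverse_at_top_right])
      then show "((\<lambda>h. flat_exp P h / h) \<longlongrightarrow> 0) (at_right 0)"
        by (rule Lim_transform_eventually)
          (auto simp: eventually_at_right_field flat_exp_def divide_simps intro!: exI[of _ 1])
    qed
    then show ?thesis using 3
      by (simp add: flat_exp_def DERIV_def)
  qed
qed

inductive_set bumps :: "(real \<Rightarrow> real) set" where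
  bump: "(\<lambda>x. a * (flat_exp P ((x - s) / d) * flat_exp Q (1 - (x - s) / d))) \<in> bumps"
| bump_add: "f \<in> bumps \<Longrightarrow> g \<in> bumps \<Longrightarrow> (\<lambda>x. f x + g x) \<in> bumps"

lemma bumps_has_derivative:
  "f \<in> bumps \<Longrightarrow> \<exists>f'\<in>bumps. \<forall>x. (f has_real_derivative f' x) (at x)"
proof (induction rule: bumps.induct)
  case (bump a P s d Q)
  let ?D = "\<lambda>P::real poly. (P - pderiv P) * [:0, 0, 1:]"
  let ?g = "\<lambda>x. a / d * (flat_exp (?D P) ((x - s) / d) * flat_exp Q (1 - (x - s) / d))
     + (- a / d) * (flat_exp P ((x - s) / d) * flat_exp (?D Q) (1 - (x - s) / d))"
  have "?g \<in> bumps" by (intro bumps.intros)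
  moreover have "((\<lambda>x. a * (flat_exp P ((x - s) / d) * flat_exp Q (1 - (x - s) / d)))
      has_real_derivative ?g x) (at x)" for x
  proof -
    have 1: "((\<lambda>x. (x - s) / d) has_real_derivative 1 / d) (at x)"
      by (cases "d = 0") (auto intro!: derivative_eq_intros)
    have 2: "((\<lambda>x. 1 - (x - s) / d) has_real_derivative - (1 / d)) (at x)"
      by (cases "d = 0") (auto intro!: derivative_eq_intros)
    show ?thesis
      using DERIV_cmult[OF DERIV_mult[OF
            DERIV_chain2[OF flat_exp_has_derivative[of P] 1]
            DERIV_chain2[OF flat_exp_has_derivative[of Q] 2]], of a]
      by (rule DERIV_cong) (simp add: algebra_simps)
  qed
  ultimately show ?case by (intro bexI[of _ ?g]) auto
next
  case (bump_add f g)
  then obtain f' g' where "f' \<in> bumps" "\<forall>x. (f has_real_derivative f' x) (at x)"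
    "g' \<in> bumps" "\<forall>x. (g has_real_derivative g' x) (at x)" by blast
  then show ?case
    by (intro bexI[of _ "\<lambda>x. f' x + g' x"]) (auto intro: bumps.intros DERIV_add)
qed

lemma higher_deriv_bumps: "f \<in> bumps \<Longrightarrow> (deriv ^^ m) f \<in> bumps"
proof (induction m)
  case (Suc m)
  then obtain f' where f': "f' \<in> bumps" "\<forall>x. (((deriv ^^ m) f) has_real_derivative f' x) (at x)"
    using bumps_has_derivative by blast
  then have "deriv ((deriv ^^ m) f) = f'"
    by (auto simp: DERIV_imp_deriv)
  then show ?case using f' by simp
qed simp

lemma higher_deriv_bumps_differentiable: "f \<in> bumps \<Longrightarrow> (deriv ^^ m) f differentiable (at x)"
  using bumps_has_derivative[OF higher_deriv_bumps] real_differentiable_def by blast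

lemma continuous_on_bumps: "f \<in> bumps \<Longrightarrow> continuous_on S f"
  using bumps_has_derivative DERIV_isCont continuous_at_imp_continuous_on by metis

definition bump_fun :: "real \<Rightarrow> real \<Rightarrow> real \<Rightarrow> real" where
  "bump_fun s d x = flat_exp 1 ((x - s) / d) * flat_exp 1 (1 - (x - s) / d)"

lemma scaled_bump_fun_in_bumps: "(\<lambda>x. a * bump_fun s d x) \<in> bumps"
  unfolding bump_fun_def by (rule bumps.bump)

lemma continuous_on_bump_fun: "continuous_on S (bump_fun s d)"
  using continuous_on_bumps[OF scaled_bump_fun_in_bumps[of 1 s d]] by simp

lemma bump_fun_nonneg: "0 \<le> bump_fun s d x"
  by (simp add: bump_fun_def flat_exp_def)

lemma bump_fun_pos: "d > 0 \<Longrightarrow> s < x \<Longrightarrow> x < s + d \<Longrightarrow> 0 < bump_fun s d x"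
  by (simp add: bump_fun_def flat_exp_def field_simps)

lemma bump_fun_eq_0: "d > 0 \<Longrightarrow> x \<le> s \<or> s + d \<le> x \<Longrightarrow> bump_fun s d x = 0"
  by (auto simp: bump_fun_def flat_exp_def field_simps)

lemma integral_bump_fun_pos:
  assumes "d > 0"
  shows "0 < integral {s..s+d} (bump_fun s d)"
proof -
  have "integral {s..s+d} (bump_fun s d) \<ge> 0"
    by (intro integral_nonneg integrable_continuous_real continuous_on_bump_fun bump_fun_nonneg)
  moreover have "integral {s..s+d} (bump_fun s d) \<noteq> 0"
  proof
    assume "integral {s..s+d} (bump_fun s d) = 0"
    then have "(bump_fun s d has_integral 0) (cbox s (s+d))"
      using integrable_integral[OF integrable_continuous_real[OF continuous_on_bump_fun[of "{s..s+d}" s d]]]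
      by simp
    then have "bump_fun s d (s + d/2) = 0"
      by (rule has_integral_0_cbox_imp_0[rotated 2])
        (use assms in \<open>auto simp: bump_fun_nonneg continuous_on_bump_fun\<close>)
    then show False using bump_fun_pos[of d s "s + d/2"] assms by simp
  qed
  ultimately show ?thesis by linarith
qed

lemma integral_bump_fun_beyond:
  assumes "d > 0" "a \<le> s" "s + d \<le> x"
  shows "integral {a..x} (bump_fun s d) = integral {s..s+d} (bump_fun s d)"
proof (rule integral_unique, rule has_integral_on_superset)
  show "(bump_fun s d has_integral integral {s..s+d} (bump_fun s d)) {s..s+d}"
    by (intro integrable_integral integrable_continuous_real continuous_on_bump_fun)
qed (use assms in \<open>auto simp: bump_fun_eq_0\<close>)

lemma test_fun_bump_difference:
  assumes s: "0 < s" "s + d < T" and t: "0 < t" "t + d < T" and d: "d > 0"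
  obtains psi where "test_fun T psi"
    "\<And>x. deriv psi x = bump_fun t d x / integral {t..t+d} (bump_fun t d)
                        - bump_fun s d x / integral {s..s+d} (bump_fun s d)"
proof -
  define I where "I r = integral {r..r+d} (bump_fun r d)" for r
  have I: "I r > 0" for r unfolding I_def by (rule integral_bump_fun_pos[OF d])
  define g where "g x = (1 / I t) * bump_fun t d x + (- 1 / I s) * bump_fun s d x" for x
  have g: "g \<in> bumps" unfolding g_def by (intro bump_add scaled_bump_fun_in_bumps)
  have cg: "continuous_on S g" for S by (rule continuous_on_bumps[OF g])
  have g0: "g x = 0" if "x \<le> 0" for x
    using that s t d by (simp add: g_def bump_fun_eq_0)
  define psi where "psi x = integral {-1..x} g" for x
  have psi0: "psi x = 0" if "x \<le> min s t" for x
    unfolding psi_def using that s t d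
    by (intro integral_unique has_integral_is_0) (auto simp: g_def bump_fun_eq_0)
  have psi1: "psi x = 0" if "x \<ge> max s t + d" for x
  proof -
    have "psi x = (1 / I t) * integral {-1..x} (bump_fun t d) + (- 1 / I s) * integral {-1..x} (bump_fun s d)"
      unfolding psi_def g_def
      by (subst integral_add)
        (use I[of s] I[of t] in \<open>auto intro!: integrable_continuous_real continuous_intros continuous_on_bump_fun
          simp del: mult_minus_left\<close>)
    also have "\<dots> = 0"
      using that s t d I[of s] I[of t] integral_bump_fun_beyond[of d "-1" s x]
        integral_bump_fun_beyond[of d "-1" t x]
      by (simp add: I_def[symmetric])
    finally show ?thesis .
  qed
  have D: "(psi has_real_derivative g x) (at x)" for x
  proof (cases "x > -1")
    case True
    have "((\<lambda>u. integral {-1..u} g) has_real_derivative g x) (at x within {-1..x+1})"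
      by (rule integral_has_real_derivative) (use True cg in auto)
    moreover have "at x within {-1..x+1} = at x"
      by (rule at_within_interior) (use True in auto)
    ultimately show ?thesis unfolding psi_def by simp
  next
    case False
    have "((\<lambda>x. 0) has_real_derivative 0) (at x)" by simp
    then have "(psi has_real_derivative 0) (at x)"
      by (rule has_field_derivative_transform_within_open[where S = "{..<0}"])
        (use False psi0 s t in auto)
    then show ?thesis using g0[of x] False by simp
  qed
  have dpsi: "deriv psi = g" using D by (auto simp: DERIV_imp_deriv)
  have "(deriv ^^ m) psi differentiable (at x)" for m x
  proof (cases m)
    case 0
    then show ?thesis using D real_differentiable_def by auto
  next
    case (Suc k)
    then show ?thesis
      using higher_deriv_bumps_differentiable[OF g, of k x] by (simp add: funpow_swap1 dpsi)
  qed
  moreover have "psi x = 0" if "x \<notin> {min s t..max s t + d}" for x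
    using that psi0[of x] psi1[of x] by fastforce
  ultimately have "test_fun T psi"
    unfolding test_fun_def using s t d
    by (intro conjI allI exI[of _ "min s t"] exI[of _ "max s t + d"]) auto
  then show thesis
    by (rule that) (simp add: dpsi g_def I_def divide_inverse)
qed

lemma set_lebesgue_integral_continuous:
  fixes f :: "real \<Rightarrow> real"
  assumes "continuous_on {a..b} f"
  shows "set_integrable lebesgue {a..b} f" "(LINT x:{a..b}|lebesgue. f x) = integral {a..b} f"
proof -
  show 1: "set_integrable lebesgue {a..b} f"
    using absolutely_integrable_continuous_real[OF assms] .
  show "(LINT x:{a..b}|lebesgue. f x) = integral {a..b} f"
    by (rule set_lebesgue_integral_eq_integral(2)[OF 1])
qed

lemma du_Bois_Reymond_aux:
  fixes F :: "real \<Rightarrow> real"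
  assumes F: "continuous_on {0..T} F"
    and weak: "\<And>psi. test_fun T psi \<Longrightarrow> (LINT t:{0..T}|lebesgue. F t * deriv psi t) = 0"
    and s: "0 < s" "s < T" and t: "0 < t" "t < T"
  shows "F t \<le> F s"
proof (rule ccontr)
  assume "\<not> F t \<le> F s"
  define e where "e = (F t - F s) / 4"
  have e: "e > 0" using \<open>\<not> F t \<le> F s\<close> by (simp add: e_def)
  have near: "\<exists>d>0. \<forall>x\<in>{0..T}. dist x r < d \<longrightarrow> dist (F x) (F r) < e" if "0 < r" "r < T" for r
    using F e that unfolding continuous_on_iff by auto
  obtain d1 where d1: "d1 > 0" "\<And>x. x \<in> {0..T} \<Longrightarrow> dist x s < d1 \<Longrightarrow> dist (F x) (F s) < e"
    using near[OF s] by blast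
  obtain d2 where d2: "d2 > 0" "\<And>x. x \<in> {0..T} \<Longrightarrow> dist x t < d2 \<Longrightarrow> dist (F x) (F t) < e"
    using near[OF t] by blast
  define d where "d = min (min d1 d2) (min (T - s) (T - t)) / 2"
  have d: "d > 0" "d < d1" "d < d2" "s + d < T" "t + d < T"
    using d1(1) d2(1) s t by (auto simp: d_def min_def field_simps)
  define It where "It = integral {t..t+d} (bump_fun t d)"
  define Is where "Is = integral {s..s+d} (bump_fun s d)"
  have pos: "It > 0" "Is > 0" unfolding It_def Is_def by (intro integral_bump_fun_pos d)+
  obtain psi where psi: "test_fun T psi" "\<And>x. deriv psi x = bump_fun t d x / It - bump_fun s d x / Is"
    using test_fun_bump_difference[OF s(1) d(4) t(1) d(5) d(1)] unfolding It_def Is_def by blast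
  have cont: "continuous_on {0..T} (\<lambda>x. F x * bump_fun r d x)" for r
    by (intro continuous_intros F continuous_on_bump_fun)
  have int: "(\<lambda>x. F x * bump_fun r d x) integrable_on {0..T}" for r
    by (intro integrable_continuous_real cont)
  have intc: "(\<lambda>x. c * bump_fun r d x) integrable_on {0..T}" for r c
    by (intro integrable_continuous_real continuous_intros continuous_on_bump_fun)
  have "0 = (LINT x:{0..T}|lebesgue. F x * deriv psi x)"
    using weak[OF psi(1)] by simp
  also have "\<dots> = integral {0..T} (\<lambda>x. (1/It) * (F x * bump_fun t d x) - (1/Is) * (F x * bump_fun s d x))"
    by (subst set_lebesgue_integral_continuous(2)[symmetric])
      (use pos in \<open>auto intro!: continuous_intros F continuous_on_bump_fun simp: psi(2) algebra_simps\<close>)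
  also have "\<dots> = (1/It) * integral {0..T} (\<lambda>x. F x * bump_fun t d x)
      - (1/Is) * integral {0..T} (\<lambda>x. F x * bump_fun s d x)"
    by (subst integral_diff) (auto intro!: int integrable_on_mult_right simp del: times_divide_eq_left)
  finally have eq: "(1/It) * integral {0..T} (\<lambda>x. F x * bump_fun t d x)
      = (1/Is) * integral {0..T} (\<lambda>x. F x * bump_fun s d x)" by simp
  have "(F t - e) * It = integral {0..T} (\<lambda>x. (F t - e) * bump_fun t d x)"
    using t d integral_bump_fun_beyond[of d 0 t T] by (simp add: It_def)
  also have "\<dots> \<le> integral {0..T} (\<lambda>x. F x * bump_fun t d x)"
  proof (intro integral_le int intc)
    fix x assume x: "x \<in> {0..T}"
    show "(F t - e) * bump_fun t d x \<le> F x * bump_fun t d x"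
    proof (cases "x \<le> t \<or> t + d \<le> x")
      case True then show ?thesis using bump_fun_eq_0[OF d(1)] by simp
    next
      case False
      then have "dist (F x) (F t) < e" using d x by (intro d2) (auto simp: dist_real_def)
      then show ?thesis
        by (intro mult_right_mono bump_fun_nonneg) (auto simp: dist_real_def)
    qed
  qed
  finally have 1: "F t - e \<le> (1/It) * integral {0..T} (\<lambda>x. F x * bump_fun t d x)"
    using pos by (simp add: field_simps)
  have "integral {0..T} (\<lambda>x. F x * bump_fun s d x) \<le> integral {0..T} (\<lambda>x. (F s + e) * bump_fun s d x)"
  proof (intro integral_le int intc)
    fix x assume x: "x \<in> {0..T}"
    show "F x * bump_fun s d x \<le> (F s + e) * bump_fun s d x"
    proof (cases "x \<le> s \<or> s + d \<le> x")
      case True then show ?thesis using bump_fun_eq_0[OF d(1)] by simp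
    next
      case False
      then have "dist (F x) (F s) < e" using d x by (intro d1) (auto simp: dist_real_def)
      then show ?thesis
        by (intro mult_right_mono bump_fun_nonneg) (auto simp: dist_real_def)
    qed
  qed
  also have "\<dots> = (F s + e) * Is"
    using s d integral_bump_fun_beyond[of d 0 s T] by (simp add: Is_def)
  finally have 2: "(1/Is) * integral {0..T} (\<lambda>x. F x * bump_fun s d x) \<le> F s + e"
    using pos by (simp add: field_simps)
  have "F t - e \<le> F s + e" using 1 2 eq by linarith
  then show False using e unfolding e_def by argo
qed

lemma du_Bois_Reymond:
  fixes F :: "real \<Rightarrow> real"
  assumes T: "T > 0" and F: "continuous_on {0..T} F"
    and weak: "\<And>psi. test_fun T psi \<Longrightarrow> (LINT t:{0..T}|lebesgue. F t * deriv psi t) = 0"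
    and t: "t \<in> {0..T}"
  shows "F t = F 0"
proof -
  have "\<exists>C. \<forall>x\<in>{0<..<T}. F x = C"
    using du_Bois_Reymond_aux[OF F weak] by (intro exI[of _ "F (T/2)"]) (use T in \<open>auto intro!: antisym\<close>)
  then obtain C where C: "\<And>x. x \<in> {0<..<T} \<Longrightarrow> F x = C" by blast
  have "F x = C" if "x \<in> {0..T}" for x
    by (rule continuous_constant_on_closure[of "{0<..<T}"]) (use F C that T in auto)
  then show ?thesis using t T by auto
qed

lemma sigma_finite_lebesgue: "sigma_finite_measure (lebesgue :: 'a::euclidean_space measure)"
proof
  obtain A :: "'a set set" where A: "countable A" "A \<subseteq> sets lborel" "\<Union>A = space lborel" "\<forall>a\<in>A. emeasure lborel a \<noteq> \<infinity>"
    using lborel.sigma_finite_countable by blast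
  then show "\<exists>A::'a set set. countable A \<and> A \<subseteq> sets lebesgue \<and> \<Union> A = space lebesgue \<and> (\<forall>a\<in>A. emeasure lebesgue a \<noteq> \<infinity>)"
    by (intro exI[of _ A]) auto
qed

lemma pair_sigma_finite_lebesgue:
  "pair_sigma_finite (lebesgue :: 'a::euclidean_space measure) (lebesgue :: 'b::euclidean_space measure)"
  by (simp add: pair_sigma_finite_def sigma_finite_lebesgue)

lemma fst_snd_measurable_lebesgue_pair:
  "fst \<in> borel_measurable (lebesgue \<Otimes>\<^sub>M (lebesgue :: 'b::euclidean_space measure) :: ('a::euclidean_space \<times> 'b) measure)"
  "snd \<in> borel_measurable (lebesgue \<Otimes>\<^sub>M lebesgue :: ('a::euclidean_space \<times> 'b::euclidean_space) measure)"
proof -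
  have id: "(\<lambda>x. x) \<in> borel_measurable (lebesgue :: 'c::euclidean_space measure)"
    by (rule measurable_completion) simp
  show "fst \<in> borel_measurable (lebesgue \<Otimes>\<^sub>M (lebesgue :: 'b measure) :: ('a \<times> 'b) measure)"
    using measurable_compose[OF measurable_fst id] .
  show "snd \<in> borel_measurable (lebesgue \<Otimes>\<^sub>M (lebesgue :: 'b measure) :: ('a \<times> 'b) measure)"
    using measurable_compose[OF measurable_snd id] .
qed

lemma Gronwall_zero:
  fixes e :: "real \<Rightarrow> real"
  assumes e: "continuous_on {0..T} e" and nn: "\<And>t. t \<in> {0..T} \<Longrightarrow> 0 \<le> e t" and C: "C \<ge> 0"
    and le: "\<And>t. t \<in> {0..T} \<Longrightarrow> e t \<le> C * integral {0..t} e"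
    and t: "t \<in> {0..T}"
  shows "e t = 0"
proof -
  define L where "L = 2 * C + 1"
  have L: "L > 0" using C by (simp add: L_def)
  have "continuous_on {0..T} (\<lambda>t. e t * exp (- L * t))" by (intro continuous_intros e)
  then obtain t0 where t0: "t0 \<in> {0..T}" "\<And>s. s \<in> {0..T} \<Longrightarrow> e s * exp (- L * s) \<le> e t0 * exp (- L * t0)"
    using continuous_attains_sup[of "{0..T}" "\<lambda>t. e t * exp (- L * t)"] t by auto
  define m where "m = e t0 * exp (- L * t0)"
  have m: "m \<ge> 0" using nn[OF t0(1)] by (simp add: m_def)
  have es: "e s \<le> m * exp (L * s)" if "s \<in> {0..T}" for s
  proof -
    have "e s = e s * exp (- L * s) * exp (L * s)" by (simp add: exp_minus)
    also have "\<dots> \<le> m * exp (L * s)" unfolding m_def by (intro mult_right_mono t0 that) simp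
    finally show ?thesis .
  qed
  have I: "((\<lambda>s. m * exp (L * s)) has_integral (m * exp (L * t0) / L - m * exp (L * 0) / L)) {0..t0}"
    by (rule fundamental_theorem_of_calculus)
      (use t0 L in \<open>auto intro!: derivative_eq_intros simp flip: has_real_derivative_iff_has_vector_derivative\<close>)
  have "integral {0..t0} e \<le> m * exp (L * t0) / L - m * exp (L * 0) / L"
  proof (rule has_integral_le[OF _ I])
    show "(e has_integral integral {0..t0} e) {0..t0}"
      by (intro integrable_integral integrable_continuous_real continuous_on_subset[OF e]) (use t0 in auto)
  qed (use es t0 in auto)
  also have "\<dots> \<le> m * exp (L * t0) / L" using m L by simp
  finally have "C * integral {0..t0} e \<le> C * (m * exp (L * t0) / L)"
    using C by (rule mult_left_mono)
  also have "\<dots> = (C / L) * (m * exp (L * t0))" by simp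
  also have "\<dots> \<le> (1/2) * (m * exp (L * t0))"
    using C m by (intro mult_right_mono) (auto simp: L_def field_simps)
  finally have "e t0 \<le> (1/2) * m * exp (L * t0)"
    using le[OF t0(1)] by simp
  then have "e t0 * exp (- L * t0) \<le> (1/2) * m * exp (L * t0) * exp (- L * t0)"
    by (rule mult_right_mono) simp
  then have "m \<le> m / 2" unfolding m_def[symmetric] by (simp add: mult.assoc flip: exp_add)
  then have "m = 0" using m by simp
  then show ?thesis using es[OF t] nn[OF t] by simp
qed


lemma measurable_inner_continuous:
  fixes q :: "real \<Rightarrow> 'h::real_inner" and y :: "real \<Rightarrow> 'h"
  assumes T: "T \<ge> 0" and q: "\<And>f. (\<lambda>t. q t \<bullet> f) \<in> borel_measurable (lebesgue_on {0..T})"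
    and y: "continuous_on {0..T} y"
  shows "(\<lambda>t. q t \<bullet> y t) \<in> borel_measurable (lebesgue_on {0..T})"
proof -
  let ?M = "lebesgue_on {0..T}"
  define z where "z n i = y (max 0 (min T (real_of_int i / real (Suc n))))" for n i
  have 1: "(\<lambda>t. q t \<bullet> z n \<lfloor>real (Suc n) * t\<rfloor>) \<in> borel_measurable ?M" for n
  proof (rule measurable_compose_countable[where f = "\<lambda>i t. q t \<bullet> z n i" and g = "\<lambda>t. \<lfloor>real (Suc n) * t\<rfloor>"])
    show "(\<lambda>t. q t \<bullet> z n i) \<in> borel_measurable ?M" for i by (rule q)
    have "(\<lambda>t. \<lfloor>real (Suc n) * t\<rfloor>) \<in> measurable borel (count_space UNIV)" by measurable
    then have "(\<lambda>t. \<lfloor>real (Suc n) * t\<rfloor>) \<in> measurable lborel (count_space UNIV)" by simp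
    then show "(\<lambda>t. \<lfloor>real (Suc n) * t\<rfloor>) \<in> measurable ?M (count_space UNIV)"
      by (intro measurable_restrict_space1 measurable_completion)
  qed
  have 2: "(\<lambda>n. q t \<bullet> z n \<lfloor>real (Suc n) * t\<rfloor>) \<longlonglongrightarrow> q t \<bullet> y t" if t: "t \<in> {0..T}" for t
  proof -
    let ?r = "\<lambda>n. real_of_int \<lfloor>real (Suc n) * t\<rfloor> / real (Suc n)"
    have "(\<lambda>n. ?r n - t) \<longlonglongrightarrow> 0"
    proof (rule Lim_null_comparison[OF _ LIMSEQ_Suc[OF lim_1_over_n]])
      have "\<bar>?r n - t\<bar> \<le> 1 / real (Suc n)" for n
      proof -
        have "\<bar>real_of_int \<lfloor>real (Suc n) * t\<rfloor> - real (Suc n) * t\<bar> \<le> 1" by linarith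
        moreover have "?r n - t = (real_of_int \<lfloor>real (Suc n) * t\<rfloor> - real (Suc n) * t) / real (Suc n)"
          by (simp add: field_simps)
        ultimately show ?thesis by (simp add: divide_right_mono del: of_nat_Suc)
      qed
      then show "\<forall>\<^sub>F n in sequentially. norm (?r n - t) \<le> 1 / real (Suc n)" by simp
    qed
    then have "?r \<longlonglongrightarrow> t" by (simp add: LIM_zero_iff)
    then have "(\<lambda>n. max 0 (min T (?r n))) \<longlonglongrightarrow> max 0 (min T t)" by (intro tendsto_intros)
    then have "(\<lambda>n. max 0 (min T (?r n))) \<longlonglongrightarrow> t" using t by simp
    then have "(\<lambda>n. y (max 0 (min T (?r n)))) \<longlonglongrightarrow> y t"
      by (rule continuous_on_tendsto_compose[OF y]) (use t T in auto)
    then show ?thesis unfolding z_def by (intro tendsto_intros)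
  qed
  show ?thesis
    by (rule borel_measurable_LIMSEQ_metric[where f = "\<lambda>n t. q t \<bullet> z n \<lfloor>real (Suc n) * t\<rfloor>", OF 1])
      (use 2 in auto)
qed

lemma test_fun_deriv:
  assumes "test_fun T psi"
  shows "(psi has_real_derivative deriv psi t) (at t)" "continuous_on S (deriv psi)" "psi T = 0" "psi 0 = 0"
proof -
  have d: "(deriv ^^ m) psi differentiable (at x)" for m x using assms by (simp add: test_fun_def)
  show "(psi has_real_derivative deriv psi t) (at t)"
    using d[of 0 t] by (simp add: DERIV_deriv_iff_real_differentiable)
  have "isCont (deriv psi) x" for x
    using d[of 1 x] by (simp add: differentiable_imp_continuous_within)
  then show "continuous_on S (deriv psi)" by (simp add: continuous_at_imp_continuous_on)
  show "psi T = 0" "psi 0 = 0" using assms by (fastforce simp: test_fun_def)+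
qed

lemma integral_test_fun_deriv:
  assumes psi: "test_fun T psi" and s: "0 \<le> s" "s \<le> T"
  shows "(LINT t:{s..T}|lebesgue. deriv psi t) = - psi s"
proof -
  have "(deriv psi has_integral (psi T - psi s)) {s..T}"
    by (rule fundamental_theorem_of_calculus)
      (use s test_fun_deriv(1)[OF psi] in
        \<open>auto simp flip: has_real_derivative_iff_has_vector_derivative intro: DERIV_subset\<close>)
  then show ?thesis
    using test_fun_deriv[OF psi]
    by (simp add: set_lebesgue_integral_continuous(2) integral_unique)
qed

lemma weak_derivative_of_indefinite_integral:
  fixes g :: "real \<Rightarrow> real"
  assumes g: "set_integrable lebesgue {0..T} g" and psi: "test_fun T psi"
    and f: "\<And>t. t \<in> {0..T} \<Longrightarrow> f t = f0 + (LINT s:{0..t}|lebesgue. g s)" and T: "T > 0"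
  shows "(LINT t:{0..T}|lebesgue. f t * deriv psi t) = - (LINT t:{0..T}|lebesgue. g t * psi t)"
proof -
  interpret pair_sigma_finite "lebesgue :: real measure" "lebesgue :: real measure"
    by (rule pair_sigma_finite_lebesgue)
  define G where "G s = indicator {0..T} s * g s" for s
  define P where "P t = indicator {0..T} t * deriv psi t" for t
  have G: "integrable lebesgue G" using g by (simp add: G_def[abs_def] set_integrable_def)
  have P: "integrable lebesgue P"
    using set_lebesgue_integral_continuous(1)[OF test_fun_deriv(2)[OF psi]] by (simp add: P_def[abs_def] set_integrable_def)
  define H where "H s t = G s * P t * (if s \<le> t then 1 else 0)" for s t
  have [measurable]: "G \<in> borel_measurable lebesgue" "P \<in> borel_measurable lebesgue"
    using G P by auto
  have Hm: "case_prod H \<in> borel_measurable (lebesgue \<Otimes>\<^sub>M lebesgue)"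
    unfolding H_def case_prod_beta using fst_snd_measurable_lebesgue_pair[where 'a = real and 'b = real] by measurable
  have PH: "integrable lebesgue (\<lambda>t. H s t)" for s
    by (rule Bochner_Integration.integrable_bound[OF integrable_mult_right[OF P, of "G s"]])
       (use measurable_Pair2[OF Hm, of s] in \<open>auto simp: H_def\<close>)
  have Hi: "integrable (lebesgue \<Otimes>\<^sub>M lebesgue) (case_prod H)"
  proof (rule Fubini_integrable[OF Hm])
    show "AE x in lebesgue. integrable lebesgue (\<lambda>y. case (x, y) of (x, y) \<Rightarrow> H x y)"
      using PH by simp
    show "integrable lebesgue (\<lambda>x. \<integral> y. norm (case (x, y) of (x, y) \<Rightarrow> H x y) \<partial>lebesgue)"
    proof (rule Bochner_Integration.integrable_bound)
      show "integrable lebesgue (\<lambda>s. \<bar>G s\<bar> * (\<integral>t. \<bar>P t\<bar> \<partial>lebesgue))"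
        using G by (intro integrable_mult_left) auto
      show "(\<lambda>x. \<integral> y. norm (case (x, y) of (x, y) \<Rightarrow> H x y) \<partial>lebesgue) \<in> borel_measurable lebesgue"
        using Hm by (intro sigma_finite_measure.borel_measurable_lebesgue_integral[OF sigma_finite_lebesgue]) (simp add: case_prod_beta)
      have "(\<integral> t. \<bar>H s t\<bar> \<partial>lebesgue) \<le> (\<integral>t. \<bar>G s\<bar> * \<bar>P t\<bar> \<partial>lebesgue)" for s
        using integrable_abs[OF PH[of s]] P
        by (intro integral_mono) (auto simp: H_def abs_mult mult_left_le)
      then show "AE s in lebesgue. norm (\<integral> y. norm (case (s, y) of (x, y) \<Rightarrow> H x y) \<partial>lebesgue)
          \<le> norm (\<bar>G s\<bar> * (\<integral>t. \<bar>P t\<bar> \<partial>lebesgue))"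
        by (intro AE_I2) simp
    qed
  qed
  have 1: "(\<integral>s. H s t \<partial>lebesgue) = P t * (f t - f0)" for t
  proof (cases "t \<in> {0..T}")
    case True
    have "(\<integral>s. H s t \<partial>lebesgue) = (\<integral>s. P t * (indicator {0..t} s * g s) \<partial>lebesgue)"
      using True by (intro Bochner_Integration.integral_cong) (auto simp: H_def G_def indicator_def)
    then show ?thesis using f[OF True] by (simp add: set_lebesgue_integral_def)
  qed (simp add: H_def P_def)
  have 2: "(\<integral>t. H s t \<partial>lebesgue) = - (G s * psi s)" for s
  proof (cases "s \<in> {0..T}")
    case True
    have "(\<integral>t. H s t \<partial>lebesgue) = (\<integral>t. G s * (indicator {s..T} t * deriv psi t) \<partial>lebesgue)"
      using True by (intro Bochner_Integration.integral_cong) (auto simp: H_def P_def indicator_def)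
    also have "\<dots> = G s * (LINT t:{s..T}|lebesgue. deriv psi t)"
      by (simp add: set_lebesgue_integral_def)
    finally show ?thesis using integral_test_fun_deriv[OF psi, of s] True by simp
  qed (simp add: H_def G_def)
  have PI: "(\<integral>t. P t \<partial>lebesgue) = 0"
    using integral_test_fun_deriv[OF psi, of 0] T test_fun_deriv(4)[OF psi]
    by (simp add: P_def set_lebesgue_integral_def)
  have "integrable lebesgue (\<lambda>t. \<integral>s. H s t \<partial>lebesgue)"
    using integrable_snd[OF Hi] by simp
  then have i1: "integrable lebesgue (\<lambda>t. P t * (f t - f0))" unfolding 1 .
  have "(LINT t:{0..T}|lebesgue. f t * deriv psi t) = (\<integral>t. P t * (f t - f0) + f0 * P t \<partial>lebesgue)"
    unfolding set_lebesgue_integral_def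
    by (intro Bochner_Integration.integral_cong) (auto simp: P_def algebra_simps)
  also have "\<dots> = (\<integral>t. \<integral>s. H s t \<partial>lebesgue \<partial>lebesgue)"
    using i1 P by (simp add: 1 PI)
  also have "\<dots> = (\<integral>s. \<integral>t. H s t \<partial>lebesgue \<partial>lebesgue)"
    by (rule Fubini_integral[OF Hi])
  also have "\<dots> = - (LINT t:{0..T}|lebesgue. g t * psi t)"
    unfolding 2 by (simp add: set_lebesgue_integral_def G_def mult.assoc)
  finally show ?thesis .
qed

section \<open>The nonlocal kernel and the Poincare inequality\<close>

lemma sqint_Cauchy_Schwarz:
  assumes f: "sqint M f" and g: "sqint M g"
  shows "(\<integral>x. f x * g x \<partial>M)\<^sup>2 \<le> (\<integral>x. (f x)\<^sup>2 \<partial>M) * (\<integral>x. (g x)\<^sup>2 \<partial>M)"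
proof -
  define A where "A = (\<integral>x. (f x)\<^sup>2 \<partial>M)"
  define B where "B = (\<integral>x. f x * g x \<partial>M)"
  define C where "C = (\<integral>x. (g x)\<^sup>2 \<partial>M)"
  note int = sqint_integrable_mult[OF f g]
  have q: "0 \<le> A + 2 * t * B + t\<^sup>2 * C" for t
  proof -
    have "0 \<le> (\<integral>x. (f x + t * g x)\<^sup>2 \<partial>M)" by simp
    also have "\<dots> = (\<integral>x. (f x)\<^sup>2 + 2 * t * (f x * g x) + t\<^sup>2 * (g x)\<^sup>2 \<partial>M)"
      by (intro Bochner_Integration.integral_cong) (auto simp: power2_eq_square algebra_simps)
    also have "\<dots> = A + 2 * t * B + t\<^sup>2 * C"
      using f g int by (simp add: A_def B_def C_def sqint_def)
    finally show ?thesis .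
  qed
  have C: "C \<ge> 0" by (simp add: C_def)
  have "B\<^sup>2 \<le> A * C"
  proof (cases "C = 0")
    case True
    have "B = 0"
    proof (rule ccontr)
      assume "B \<noteq> 0"
      then show False using q[of "- (A + 1) / (2 * B)"] True by (simp add: field_simps)
    qed
    then show ?thesis using True by simp
  next
    case False
    then have "C > 0" using C by simp
    then have "0 \<le> (A - B\<^sup>2 / C) * C"
      using q[of "- B / C"] by (intro mult_nonneg_nonneg) (auto simp: power2_eq_square field_simps)
    then show ?thesis using \<open>C > 0\<close> by (simp add: field_simps)
  qed
  then show ?thesis by (simp add: A_def B_def C_def)
qed

lemma Gam_nonneg: "0 \<le> Gam sg nu x y"
  by (simp add: Gam_def)

lemma Gam_le: "Gam sg nu x (y :: 'a::euclidean_space) \<le> (2 * pi * sg\<^sup>2) powr (- real DIM('a) / 2)"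
proof -
  have "exp (- (norm (x - y))\<^sup>2 / (2 * sg\<^sup>2)) * indicator (cball x nu) y \<le> 1 * 1"
    by (intro mult_mono) (auto simp: indicator_def)
  then have "(2 * pi * sg\<^sup>2) powr (- real DIM('a) / 2) * (exp (- (norm (x - y))\<^sup>2 / (2 * sg\<^sup>2)) * indicator (cball x nu) y)
    \<le> (2 * pi * sg\<^sup>2) powr (- real DIM('a) / 2) * 1"
    by (intro mult_left_mono) auto
  then show ?thesis by (simp add: Gam_def mult.assoc)
qed

lemma Gam_mono_radius: "mu \<le> nu \<Longrightarrow> Gam sg mu x y \<le> Gam sg nu x y"
  unfolding Gam_def by (intro mult_left_mono) (auto simp: indicator_def)

lemma Gam_ge:
  fixes x y :: "'a::euclidean_space"
  assumes "norm (x - y) \<le> nu" "sg > 0"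
  shows "(2 * pi * sg\<^sup>2) powr (- real DIM('a) / 2) * exp (- nu\<^sup>2 / (2 * sg\<^sup>2)) \<le> Gam sg nu x y"
proof -
  have "(norm (x - y))\<^sup>2 \<le> nu\<^sup>2" using assms by (intro power_mono) auto
  then show ?thesis
    unfolding Gam_def using assms
    by (auto intro!: mult_left_mono simp: indicator_def dist_norm divide_right_mono)
qed

lemma Gam_measurable:
  assumes [measurable]: "f \<in> borel_measurable M" "g \<in> borel_measurable M"
  shows "(\<lambda>z. Gam sg nu (f z) (g z :: 'a::euclidean_space)) \<in> borel_measurable M"
proof -
  have "(\<lambda>z. Gam sg nu (f z) (g z)) = (\<lambda>z. (2 * pi * sg\<^sup>2) powr (- real DIM('a) / 2)
      * exp (- (norm (f z - g z))\<^sup>2 / (2 * sg\<^sup>2)) * (if dist (f z) (g z) \<le> nu then 1 else 0))"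
    by (auto simp: Gam_def indicator_def)
  then show ?thesis by simp
qed

lemma alpha_measurable:
  assumes [measurable]: "f \<in> borel_measurable M" "g \<in> borel_measurable M"
  shows "(\<lambda>z. alpha sg nu (f z) (g z :: 'a::euclidean_space)) \<in> borel_measurable M"
  unfolding alpha_def using Gam_measurable[OF assms, of sg nu] by measurable

lemma alpha_sq: "(alpha sg nu x y)\<^sup>2 = (if norm x = norm y then 0 else Gam sg nu x y)"
  by (auto simp: alpha_def power_mult_distrib Gam_nonneg sgn_if)

lemma Dstar_lincomb:
  "Dstar sg eps (\<lambda>x. a * u x + b * v x) x y = a * Dstar sg eps u x y + b * Dstar sg eps v x y"
  by (simp add: Dstar_def algebra_simps)

lemma nn_integral_lborel_translate:
  fixes f :: "'b::euclidean_space \<Rightarrow> ennreal"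
  assumes "f \<in> borel_measurable borel"
  shows "(\<integral>\<^sup>+x. f (c + x) \<partial>lborel) = (\<integral>\<^sup>+x. f x \<partial>lborel)"
  by (subst (2) lborel_distr_plus[of c, symmetric]) (use assms in \<open>simp add: nn_integral_distr\<close>)

text \<open>Shifting $N$ times by $h$ moves the support of $v$ off itself, and each shift costs the same.\<close>

lemma nn_integral_sq_le_shift:
  fixes v :: "'b::euclidean_space \<Rightarrow> real" and N :: nat
  assumes [measurable]: "v \<in> borel_measurable borel"
    and disj: "\<And>x. v x \<noteq> 0 \<Longrightarrow> v (x + real N *\<^sub>R h) = 0"
  shows "(\<integral>\<^sup>+x. ennreal ((v x)\<^sup>2) \<partial>lborel)
      \<le> ennreal ((real N)\<^sup>2) * (\<integral>\<^sup>+x. ennreal ((v (x + h) - v x)\<^sup>2) \<partial>lborel)"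
proof -
  let ?d = "\<lambda>j x. v (x + real (Suc j) *\<^sub>R h) - v (x + real j *\<^sub>R h)"
  have pt: "ennreal ((v x)\<^sup>2) \<le> (\<Sum>j<N. ennreal (real N) * ennreal ((?d j x)\<^sup>2))" for x
  proof -
    have "(v x)\<^sup>2 \<le> (v (x + real N *\<^sub>R h) - v x)\<^sup>2"
      using disj[of x] by (cases "v x = 0") auto
    also have "v (x + real N *\<^sub>R h) - v x = (\<Sum>j<N. ?d j x)"
      using sum_lessThan_telescope[of "\<lambda>j. v (x + real j *\<^sub>R h)" N] by simp
    also have "(\<Sum>j<N. ?d j x)\<^sup>2 \<le> (\<Sum>j<N. (?d j x)\<^sup>2) * real (card {..<N})"
      by (rule sum_squared_le_sum_of_squares)
    also have "\<dots> = (\<Sum>j<N. real N * (?d j x)\<^sup>2)"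
      by (simp add: sum_distrib_left mult.commute)
    finally have "ennreal ((v x)\<^sup>2) \<le> ennreal (\<Sum>j<N. real N * (?d j x)\<^sup>2)" by (rule ennreal_leI)
    also have "\<dots> = (\<Sum>j<N. ennreal (real N) * ennreal ((?d j x)\<^sup>2))"
      by (simp add: sum_ennreal[symmetric] ennreal_mult)
    finally show ?thesis .
  qed
  have tr: "(\<integral>\<^sup>+x. ennreal ((?d j x)\<^sup>2) \<partial>lborel) = (\<integral>\<^sup>+x. ennreal ((v (x + h) - v x)\<^sup>2) \<partial>lborel)" for j
  proof -
    have "(\<lambda>x. ennreal ((?d j x)\<^sup>2)) = (\<lambda>x. (\<lambda>x. ennreal ((v (x + h) - v x)\<^sup>2)) (real j *\<^sub>R h + x))"
      by (auto simp: algebra_simps)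
    then show ?thesis
      using nn_integral_lborel_translate[of "\<lambda>x. ennreal ((v (x + h) - v x)\<^sup>2)" "real j *\<^sub>R h"] by simp
  qed
  have "(\<integral>\<^sup>+x. ennreal ((v x)\<^sup>2) \<partial>lborel) \<le> (\<integral>\<^sup>+x. (\<Sum>j<N. ennreal (real N) * ennreal ((?d j x)\<^sup>2)) \<partial>lborel)"
    by (intro nn_integral_mono pt)
  also have "\<dots> = (\<Sum>j<N. ennreal (real N) * (\<integral>\<^sup>+x. ennreal ((?d j x)\<^sup>2) \<partial>lborel))"
    by (subst nn_integral_sum) (auto simp: nn_integral_cmult)
  also have "\<dots> = ennreal ((real N)\<^sup>2) * (\<integral>\<^sup>+x. ennreal ((v (x + h) - v x)\<^sup>2) \<partial>lborel)"
    unfolding tr by (simp add: power2_eq_square ennreal_mult ennreal_of_nat_eq_real_of_nat[symmetric] mult.assoc)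
  finally show ?thesis .
qed

lemma AE_norm_neq: "AE y in lborel. norm (y :: 'b::euclidean_space) \<noteq> r"
proof -
  have "sphere (0::'b) r \<in> null_sets lebesgue"
    using negligible_sphere[of "0::'b" r] by (simp add: negligible_iff_null_sets)
  then have "AE y in lebesgue. y \<notin> sphere (0::'b) r" by (rule AE_not_in)
  then show ?thesis by (simp add: AE_completion_iff)
qed

locale nonlocal_domain =
  fixes Om :: "'a::euclidean_space set" and eps sg :: real
  assumes open_Om: "open Om" and bounded_Om: "bounded Om" and eps_pos: "eps > 0" and sg_pos: "sg > 0"
begin

abbreviation (input) "\<D> \<equiv> Om \<union> OmegaI Om eps"

lemma domain_eq: "\<D> = (\<Union>x\<in>Om. ball x eps)"
  using eps_pos by (auto simp: OmegaI_def dist_norm norm_minus_commute intro: bexI)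

lemma open_domain: "open \<D>"
  unfolding domain_eq by auto

lemma bounded_domain: "bounded \<D>"
proof -
  obtain R where R: "\<And>x. x \<in> Om \<Longrightarrow> norm x \<le> R" using bounded_Om by (auto simp: bounded_iff)
  have "norm y \<le> R + eps" if "y \<in> \<D>" for y
  proof -
    have "\<exists>x\<in>Om. norm (y - x) < eps"
      using that eps_pos by (auto simp: OmegaI_def intro: bexI[of _ y])
    then obtain x where "x \<in> Om" "norm (y - x) < eps" by blast
    then show ?thesis using R[of x] norm_triangle_sub[of y x] by linarith
  qed
  then show ?thesis unfolding bounded_iff by blast
qed

lemma sets_domain [measurable, simp]: "\<D> \<in> sets lebesgue" "Om \<in> sets lebesgue" "OmegaI Om eps \<in> sets lebesgue"
proof -
  show 1: "\<D> \<in> sets lebesgue" "Om \<in> sets lebesgue"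
    using open_domain open_Om by (simp_all add: borel_open)
  have "OmegaI Om eps = \<D> - Om" by (auto simp: OmegaI_def)
  then show "OmegaI Om eps \<in> sets lebesgue" using 1 by (metis sets.Diff)
qed

lemma lmeasurable_domain: "\<D> \<in> lmeasurable" "Om \<in> lmeasurable"
  using bounded_domain open_domain open_Om bounded_Om lmeasurable_open by blast+

definition D_mass :: real where "D_mass = measure lebesgue \<D>"

lemma emeasure_domain: "emeasure lebesgue \<D> = ennreal D_mass"
  unfolding D_mass_def using lmeasurable_domain(1) by (simp add: emeasure_eq_measure2)

lemma D_mass_nonneg: "0 \<le> D_mass" by (simp add: D_mass_def)

definition K_max :: real where "K_max = (2 * pi * sg\<^sup>2) powr (- real DIM('a) / 2)"

lemma K_max_pos: "K_max > 0" using sg_pos by (simp add: K_max_def)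

definition cut :: "('a \<Rightarrow> real) \<Rightarrow> 'a \<Rightarrow> real" where
  "cut u x = indicator \<D> x * u x"

abbreviation "L2D u \<equiv> sqint lebesgue (cut u)"

definition DU :: "('a \<Rightarrow> real) \<Rightarrow> 'a \<times> 'a \<Rightarrow> real" where
  "DU u z = indicator \<D> (fst z) * (indicator \<D> (snd z) * Dstar sg eps u (fst z) (snd z))"

lemma DU_cut: "DU u z = indicator \<D> (fst z) * (indicator \<D> (snd z) *
    (- (cut u (snd z) - cut u (fst z)) * alpha sg eps (fst z) (snd z)))"
  by (auto simp: DU_def Dstar_def cut_def indicator_def)

lemma DU_measurable:
  assumes "L2D u"
  shows "DU u \<in> borel_measurable (lebesgue \<Otimes>\<^sub>M lebesgue)"
proof -
  have [measurable]: "cut u \<in> borel_measurable lebesgue" using assms by (simp add: sqint_def)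
  have [measurable]: "(\<lambda>z. alpha sg eps (fst z) (snd z)) \<in> borel_measurable (lebesgue \<Otimes>\<^sub>M (lebesgue :: 'a measure))"
    by (intro alpha_measurable fst_snd_measurable_lebesgue_pair)
  have [measurable]: "(\<lambda>x. indicator \<D> x :: real) \<in> borel_measurable lebesgue"
    by (rule borel_measurable_indicator) simp
  show ?thesis unfolding DU_cut[abs_def] by measurable
qed

lemma nn_integral_DU: "(\<integral>\<^sup>+ y. ennreal ((DU u (x, y))\<^sup>2) \<partial>lebesgue)
    = (\<integral>\<^sup>+ y\<in>\<D>. ennreal ((Dstar sg eps u x y)\<^sup>2) \<partial>lebesgue) * indicator \<D> x"
proof (cases "x \<in> \<D>")
  case True
  then show ?thesis
    by (simp, intro nn_integral_cong) (auto simp: DU_def indicator_def)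
qed (simp add: DU_def)

lemma Dsq_eq:
  assumes "L2D u"
  shows "Dsq Om eps sg u = (\<integral>\<^sup>+ z. ennreal ((DU u z)\<^sup>2) \<partial>(lebesgue \<Otimes>\<^sub>M lebesgue))"
proof -
  have [measurable]: "DU u \<in> borel_measurable (lebesgue \<Otimes>\<^sub>M lebesgue)" by (rule DU_measurable[OF assms])
  have "(\<integral>\<^sup>+ z. ennreal ((DU u z)\<^sup>2) \<partial>(lebesgue \<Otimes>\<^sub>M lebesgue))
      = (\<integral>\<^sup>+ x. \<integral>\<^sup>+ y. ennreal ((DU u (x, y))\<^sup>2) \<partial>lebesgue \<partial>lebesgue)"
    by (subst sigma_finite_measure.nn_integral_fst[OF sigma_finite_lebesgue, symmetric]) simp_all
  also have "\<dots> = Dsq Om eps sg u"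
    by (simp add: Dsq_def nn_integral_DU)
  finally show ?thesis by simp
qed

lemma Dsq_le:
  assumes u: "L2D u"
  shows "Dsq Om eps sg u \<le> ennreal (4 * K_max * D_mass * (\<integral>x. (cut u x)\<^sup>2 \<partial>lebesgue))"
proof -
  define N where "N = (\<integral>x. (cut u x)\<^sup>2 \<partial>lebesgue)"
  have N0: "N \<ge> 0" by (simp add: N_def)
  have [measurable]: "cut u \<in> borel_measurable lebesgue" using u by (simp add: sqint_def)
  have N: "(\<integral>\<^sup>+x. ennreal ((cut u x)\<^sup>2) \<partial>lebesgue) = ennreal N"
    unfolding N_def using u by (intro nn_integral_eq_integral) (auto simp: sqint_def)
  have [measurable]: "(\<lambda>x. indicator \<D> x :: ennreal) \<in> borel_measurable lebesgue"
    by (rule borel_measurable_indicator) simp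
  have pt: "ennreal ((Dstar sg eps u x y)\<^sup>2) * indicator \<D> y
      \<le> ennreal (2 * K_max) * (ennreal ((cut u x)\<^sup>2) * indicator \<D> y + ennreal ((cut u y)\<^sup>2))"
    if "x \<in> \<D>" for x y
  proof (cases "y \<in> \<D>")
    case True
    have "(Dstar sg eps u x y)\<^sup>2 = (u y - u x)\<^sup>2 * (alpha sg eps x y)\<^sup>2"
      by (simp add: Dstar_def power_mult_distrib power2_commute)
    also have "\<dots> \<le> (u y - u x)\<^sup>2 * K_max"
      using Gam_le[of sg eps x y] K_max_pos by (intro mult_left_mono) (auto simp: alpha_sq K_max_def)
    also have "(u y - u x)\<^sup>2 \<le> 2 * ((u x)\<^sup>2 + (u y)\<^sup>2)"
      using zero_le_power2[of "u x + u y"] by (simp add: power2_eq_square algebra_simps)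
    finally have "(Dstar sg eps u x y)\<^sup>2 \<le> 2 * K_max * ((cut u x)\<^sup>2 + (cut u y)\<^sup>2)"
      using K_max_pos True that by (simp add: mult_right_mono cut_def algebra_simps)
    then show ?thesis
      using True K_max_pos by (simp add: ennreal_mult[symmetric] ennreal_plus[symmetric] ennreal_leI del: ennreal_plus)
  qed auto
  have "Dsq Om eps sg u \<le> (\<integral>\<^sup>+ x. ennreal (2 * K_max) *
      (ennreal ((cut u x)\<^sup>2) * ennreal D_mass + ennreal N * indicator \<D> x) \<partial>lebesgue)"
    unfolding Dsq_def
  proof (intro nn_integral_mono)
    fix x
    show "(\<integral>\<^sup>+ y\<in>\<D>. ennreal ((Dstar sg eps u x y)\<^sup>2) \<partial>lebesgue) * indicator \<D> x
      \<le> ennreal (2 * K_max) * (ennreal ((cut u x)\<^sup>2) * ennreal D_mass + ennreal N * indicator \<D> x)"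
    proof (cases "x \<in> \<D>")
      case True
      have "(\<integral>\<^sup>+ y\<in>\<D>. ennreal ((Dstar sg eps u x y)\<^sup>2) \<partial>lebesgue)
        \<le> (\<integral>\<^sup>+ y. ennreal (2 * K_max) * (ennreal ((cut u x)\<^sup>2) * indicator \<D> y + ennreal ((cut u y)\<^sup>2)) \<partial>lebesgue)"
        by (intro nn_integral_mono pt True)
      also have "\<dots> = ennreal (2 * K_max) * (ennreal ((cut u x)\<^sup>2) * ennreal D_mass + ennreal N)"
        by (simp add: nn_integral_cmult nn_integral_add N emeasure_domain[symmetric])
      finally show ?thesis using True by simp
    qed auto
  qed
  also have "\<dots> = ennreal (2 * K_max) * (ennreal N * ennreal D_mass + ennreal N * ennreal D_mass)"
    by (simp add: nn_integral_cmult nn_integral_multc nn_integral_add N emeasure_domain[symmetric])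
  also have "\<dots> = ennreal (4 * K_max * D_mass * N)"
    using K_max_pos N0 D_mass_nonneg
    by (simp add: ennreal_mult[symmetric] ennreal_plus[symmetric] algebra_simps del: ennreal_plus)
  finally show ?thesis unfolding N_def .
qed

lemma Dsq_finite: "L2D u \<Longrightarrow> Dsq Om eps sg u < \<infinity>"
  using Dsq_le[of u] by (simp add: le_less_trans)

lemma DU_sqint:
  assumes "L2D u"
  shows "sqint (lebesgue \<Otimes>\<^sub>M lebesgue) (DU u)"
  unfolding sqint_def
  using DU_measurable[OF assms] Dsq_finite[OF assms] unfolding Dsq_eq[OF assms]
  by (auto intro!: integrableI_bounded)

lemma vc_inner_eq:
  assumes u: "L2D u" and v: "L2D v"
  shows "vc_inner Om eps sg u v = 1/2 * (\<integral>z. DU u z * DU v z \<partial>(lebesgue \<Otimes>\<^sub>M lebesgue))"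
proof -
  interpret pair_sigma_finite "lebesgue :: 'a measure" "lebesgue :: 'a measure"
    by (rule pair_sigma_finite_lebesgue)
  have int: "integrable (lebesgue \<Otimes>\<^sub>M lebesgue) (\<lambda>z. DU u z * DU v z)"
    by (intro sqint_integrable_mult DU_sqint u v)
  have "(\<integral>z. DU u z * DU v z \<partial>(lebesgue \<Otimes>\<^sub>M lebesgue))
      = (\<integral>x. \<integral>y. DU u (x, y) * DU v (x, y) \<partial>lebesgue \<partial>lebesgue)"
    by (rule integral_fst'[OF int, symmetric])
  also have "\<dots> = (LINT x:\<D>|lebesgue. (LINT y:\<D>|lebesgue. Dstar sg eps u x y * Dstar sg eps v x y))"
    unfolding set_lebesgue_integral_def
  proof (intro Bochner_Integration.integral_cong refl)
    fix x
    have "(\<integral>y. DU u (x, y) * DU v (x, y) \<partial>lebesgue)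
        = (\<integral>y. indicator \<D> x * (indicator \<D> y *\<^sub>R (Dstar sg eps u x y * Dstar sg eps v x y)) \<partial>lebesgue)"
      by (intro Bochner_Integration.integral_cong refl) (simp add: DU_def indicator_def)
    then show "(\<integral>y. DU u (x, y) * DU v (x, y) \<partial>lebesgue)
        = indicator \<D> x *\<^sub>R (\<integral>y. indicator \<D> y *\<^sub>R (Dstar sg eps u x y * Dstar sg eps v x y) \<partial>lebesgue)"
      by simp
  qed
  finally show ?thesis by (simp add: vc_inner_def)
qed

lemma vc_inner_commute: "vc_inner Om eps sg u v = vc_inner Om eps sg v u"
  by (simp add: vc_inner_def mult.commute)

lemma L2D_lincomb: "L2D u \<Longrightarrow> L2D v \<Longrightarrow> L2D (\<lambda>x. a * u x + b * v x)"
  using sqint_lincomb[of lebesgue "cut u" "cut v" a b]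
  by (simp add: cut_def[abs_def] algebra_simps)

lemma vc_inner_lincomb:
  assumes "L2D u" "L2D v" "L2D w"
  shows "vc_inner Om eps sg (\<lambda>x. a * u x + b * v x) w = a * vc_inner Om eps sg u w + b * vc_inner Om eps sg v w"
proof -
  have "DU (\<lambda>x. a * u x + b * v x) z * DU w z = a * (DU u z * DU w z) + b * (DU v z * DU w z)" for z
    unfolding DU_def Dstar_lincomb by (simp add: algebra_simps)
  then show ?thesis
    using sqint_integrable_mult[OF DU_sqint[OF assms(1)] DU_sqint[OF assms(3)]]
      sqint_integrable_mult[OF DU_sqint[OF assms(2)] DU_sqint[OF assms(3)]]
    by (simp add: vc_inner_eq assms L2D_lincomb)
qed

lemma tnorm_nonneg: "0 \<le> tnorm Om eps sg u"
  by (simp add: tnorm_def)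

lemma tnorm_sq:
  assumes "L2D u"
  shows "(tnorm Om eps sg u)\<^sup>2 = vc_inner Om eps sg u u"
proof -
  have "Dsq Om eps sg u = ennreal (\<integral>z. (DU u z)\<^sup>2 \<partial>(lebesgue \<Otimes>\<^sub>M lebesgue))"
    unfolding Dsq_eq[OF assms] using DU_sqint[OF assms]
    by (intro nn_integral_eq_integral) (auto simp: sqint_def)
  then show ?thesis
    by (simp add: tnorm_def vc_inner_eq[OF assms assms] power2_eq_square)
qed

lemma abs_vc_inner_le:
  assumes "L2D u" "L2D v"
  shows "\<bar>vc_inner Om eps sg u v\<bar> \<le> tnorm Om eps sg u * tnorm Om eps sg v"
proof -
  have "(vc_inner Om eps sg u v)\<^sup>2 \<le> (tnorm Om eps sg u * tnorm Om eps sg v)\<^sup>2"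
    using sqint_Cauchy_Schwarz[OF DU_sqint[OF assms(1)] DU_sqint[OF assms(2)]]
    unfolding power_mult_distrib tnorm_sq[OF assms(1)] tnorm_sq[OF assms(2)]
    by (simp add: assms vc_inner_eq power2_eq_square)
  then show ?thesis
    by (simp add: abs_le_square_iff[symmetric] tnorm_nonneg abs_mult)
qed

lemma tnorm_sq_le:
  assumes "L2D u"
  shows "(tnorm Om eps sg u)\<^sup>2 \<le> 2 * K_max * D_mass * (\<integral>x. (cut u x)\<^sup>2 \<partial>lebesgue)"
proof -
  have "enn2real (Dsq Om eps sg u) \<le> 4 * K_max * D_mass * (\<integral>x. (cut u x)\<^sup>2 \<partial>lebesgue)"
    using Dsq_le[OF assms] K_max_pos D_mass_nonneg
    by (intro enn2real_leI) auto
  then show ?thesis by (simp add: tnorm_def)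
qed

lemma Vc_iff: "u \<in> Vc Om eps sg \<longleftrightarrow> L2D u \<and> (AE x in lebesgue. x \<in> OmegaI Om eps \<longrightarrow> u x = 0)"
proof -
  have 1: "u \<in> borel_measurable (lebesgue_on \<D>) \<longleftrightarrow> cut u \<in> borel_measurable lebesgue"
    by (subst borel_measurable_restrict_space_iff) (auto simp: cut_def[abs_def])
  have 2: "integrable (lebesgue_on \<D>) (\<lambda>x. (u x)\<^sup>2) \<longleftrightarrow> integrable lebesgue (\<lambda>x. (cut u x)\<^sup>2)"
    by (subst integrable_restrict_space)
       (auto simp: cut_def power_mult_distrib power2_eq_square[of "indicator _ _"] simp flip: indicator_inter_arith)
  have 3: "(AE x in lebesgue_on (OmegaI Om eps). u x = 0) \<longleftrightarrow> (AE x in lebesgue. x \<in> OmegaI Om eps \<longrightarrow> u x = 0)"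
    by (subst AE_restrict_space_iff) auto
  show ?thesis
    unfolding Vc_def mem_Collect_eq 1 2 3 using Dsq_finite[of u] by (auto simp: sqint_def)
qed


lemma Poincare_integral:
  "\<exists>C>0. \<forall>u\<in>Vc Om eps sg. (\<integral>x. (cut u x)\<^sup>2 \<partial>lebesgue) \<le> C * (tnorm Om eps sg u)\<^sup>2"
proof -
  obtain R where R: "R > 0" "\<And>x. x \<in> Om \<Longrightarrow> norm x \<le> R"
    using bounded_Om by (auto simp: bounded_pos)
  obtain N :: nat where N: "4 * R / eps < real N" using reals_Archimedean2 by blast
  have N0: "N > 0"
    using N R(1) eps_pos by (cases N) (auto simp: divide_simps)
  define S :: "'a set" where "S = ball 0 eps - cball 0 (eps/2)"
  have openS: "open S" unfolding S_def by (intro open_Diff) auto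
  then have [measurable]: "S \<in> sets borel" by simp
  obtain e :: 'a where e: "norm e = 1" using vector_choose_size[of 1] by auto
  have "(3 * eps / 4) *\<^sub>R e \<in> S" using e eps_pos by (simp add: S_def)
  then have "S \<noteq> {}" by blast
  then have Spos: "emeasure lborel S \<noteq> 0"
    using open_not_negligible[OF openS] by (simp add: negligible_iff_emeasure0 openS)
  have "S \<subseteq> cball 0 eps" by (auto simp: S_def)
  then have Sfin: "emeasure lborel S < \<infinity>"
    by (meson bounded_cball bounded_subset emeasure_bounded_finite)
  define m where "m = measure lborel S"
  have m: "emeasure lborel S = ennreal m" unfolding m_def using Sfin by (simp add: emeasure_eq_ennreal_measure)
  then have mpos: "m > 0" using Spos by (metis ennreal_eq_0_iff not_le)
  define \<gamma> where "\<gamma> = K_max * exp (- eps\<^sup>2 / (2 * sg\<^sup>2))"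
  have \<gamma>: "\<gamma> > 0" using K_max_pos by (simp add: \<gamma>_def)
  have main: "(\<integral>x. (cut u x)\<^sup>2 \<partial>lebesgue) \<le> 2 * (real N)\<^sup>2 / (\<gamma> * m) * (tnorm Om eps sg u)\<^sup>2"
    if u: "u \<in> Vc Om eps sg" for u
  proof -
    have uL: "L2D u" and u0: "AE x in lebesgue. x \<in> OmegaI Om eps \<longrightarrow> u x = 0"
      using u by (auto simp: Vc_iff)
    have cm: "cut u \<in> borel_measurable (completion lborel)" using uL by (simp add: sqint_def)
    obtain g where g: "g \<in> borel_measurable lborel" "AE x in lborel. cut u x = g x"
      using completion_ex_borel_measurable_real[OF cm] by blast
    define v where "v x = indicator Om x * g x" for x
    have [measurable]: "v \<in> borel_measurable borel"
      unfolding v_def using g(1) open_Om by (auto intro!: borel_measurable_times)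
    have vout: "v x = 0" if "x \<notin> Om" for x using that by (simp add: v_def)
    have cv: "AE x in lborel. cut u x = v x"
      using g(2) u0 unfolding AE_completion_iff
    proof eventually_elim
      case (elim x)
      then show ?case
        by (cases "x \<in> Om"; cases "x \<in> OmegaI Om eps") (simp_all add: v_def cut_def)
    qed
    define I where "I = (\<integral>\<^sup>+x. ennreal ((v x)\<^sup>2) \<partial>lborel)"
    have I_eq: "I = ennreal (\<integral>x. (cut u x)\<^sup>2 \<partial>lebesgue)"
    proof -
      have "I = (\<integral>\<^sup>+x. ennreal ((cut u x)\<^sup>2) \<partial>lborel)"
        unfolding I_def using cv by (intro nn_integral_cong_AE) auto
      also have "\<dots> = (\<integral>\<^sup>+x. ennreal ((cut u x)\<^sup>2) \<partial>lebesgue)" by (simp add: nn_integral_completion)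
      also have "\<dots> = ennreal (\<integral>x. (cut u x)\<^sup>2 \<partial>lebesgue)"
        using uL by (intro nn_integral_eq_integral) (auto simp: sqint_def)
      finally show ?thesis .
    qed
    have shift: "I * indicator S h \<le> ennreal ((real N)\<^sup>2) *
        (\<integral>\<^sup>+x. indicator S h * ennreal ((v (x + h) - v x)\<^sup>2) \<partial>lborel)" for h
    proof (cases "h \<in> S")
      case True
      have "v (x + real N *\<^sub>R h) = 0" if "v x \<noteq> 0" for x
      proof -
        have x: "x \<in> Om" using that vout by blast
        have "2 * R < real N * (eps / 2)" using N eps_pos by (simp add: field_simps)
        also have "\<dots> \<le> real N * norm h" using True by (intro mult_left_mono) (auto simp: S_def)
        also have "\<dots> = norm (real N *\<^sub>R h)" by simp
        also have "\<dots> \<le> norm (x + real N *\<^sub>R h) + norm x"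
          using norm_triangle_ineq4[of "x + real N *\<^sub>R h" x] by simp
        finally have "norm (x + real N *\<^sub>R h) > R" using R(2)[OF x] by linarith
        then show ?thesis using R(2) vout by force
      qed
      then show ?thesis
        unfolding I_def using True nn_integral_sq_le_shift[of v N h] by simp
    qed simp
    have "I * ennreal m = (\<integral>\<^sup>+h. I * indicator S h \<partial>lborel)"
      by (subst nn_integral_cmult_indicator) (simp_all add: m)
    also have "\<dots> \<le> (\<integral>\<^sup>+h. ennreal ((real N)\<^sup>2) *
        (\<integral>\<^sup>+x. indicator S h * ennreal ((v (x + h) - v x)\<^sup>2) \<partial>lborel) \<partial>lborel)"
      by (intro nn_integral_mono shift)
    also have "\<dots> = ennreal ((real N)\<^sup>2) *
        (\<integral>\<^sup>+h. \<integral>\<^sup>+x. indicator S h * ennreal ((v (x + h) - v x)\<^sup>2) \<partial>lborel \<partial>lborel)"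
      by (rule nn_integral_cmult) measurable
    also have "(\<integral>\<^sup>+h. \<integral>\<^sup>+x. indicator S h * ennreal ((v (x + h) - v x)\<^sup>2) \<partial>lborel \<partial>lborel)
        = (\<integral>\<^sup>+x. \<integral>\<^sup>+h. indicator S h * ennreal ((v (x + h) - v x)\<^sup>2) \<partial>lborel \<partial>lborel)"
      by (rule lborel_pair.Fubini') measurable
    also have "\<dots> = (\<integral>\<^sup>+x. \<integral>\<^sup>+y. indicator S (y - x) * ennreal ((v y - v x)\<^sup>2) \<partial>lborel \<partial>lborel)"
    proof (rule nn_integral_cong)
      fix x
      have "(\<integral>\<^sup>+h. indicator S h * ennreal ((v (x + h) - v x)\<^sup>2) \<partial>lborel)
          = (\<integral>\<^sup>+h. (\<lambda>y. indicator S (y - x) * ennreal ((v y - v x)\<^sup>2)) (x + h) \<partial>lborel)" by simp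
      also have "\<dots> = (\<integral>\<^sup>+y. indicator S (y - x) * ennreal ((v y - v x)\<^sup>2) \<partial>lborel)"
        by (rule nn_integral_lborel_translate) measurable
      finally show "(\<integral>\<^sup>+h. indicator S h * ennreal ((v (x + h) - v x)\<^sup>2) \<partial>lborel)
          = (\<integral>\<^sup>+y. indicator S (y - x) * ennreal ((v y - v x)\<^sup>2) \<partial>lborel)" .
    qed
    also have "\<dots> \<le> (\<integral>\<^sup>+x. (\<integral>\<^sup>+y\<in>\<D>. ennreal ((Dstar sg eps u x y)\<^sup>2) \<partial>lborel) * indicator \<D> x * ennreal (1/\<gamma>) \<partial>lborel)"
    proof (intro nn_integral_mono_AE)
      show "AE x in lborel. (\<integral>\<^sup>+y. indicator S (y - x) * ennreal ((v y - v x)\<^sup>2) \<partial>lborel)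
        \<le> (\<integral>\<^sup>+y\<in>\<D>. ennreal ((Dstar sg eps u x y)\<^sup>2) \<partial>lborel) * indicator \<D> x * ennreal (1/\<gamma>)"
        using cv
      proof eventually_elim
        case (elim x)
        have Dm: "(\<lambda>y. ennreal ((Dstar sg eps u x y)\<^sup>2) * indicator \<D> y * indicator \<D> x) \<in> borel_measurable lebesgue"
        proof -
          have [measurable]: "cut u \<in> borel_measurable lebesgue" using uL by (simp add: sqint_def)
          have [measurable]: "(\<lambda>y. alpha sg eps x y) \<in> borel_measurable lebesgue"
            by (intro alpha_measurable measurable_completion) auto
          have [measurable]: "(\<lambda>x. indicator \<D> x :: ennreal) \<in> borel_measurable lebesgue"
            by (rule borel_measurable_indicator) simp
          have "(\<lambda>y. ennreal ((Dstar sg eps u x y)\<^sup>2) * indicator \<D> y * indicator \<D> x)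
            = (\<lambda>y. ennreal ((- (cut u y - cut u x) * alpha sg eps x y)\<^sup>2) * indicator \<D> y * indicator \<D> x)"
            by (auto simp: Dstar_def cut_def indicator_def)
          then show ?thesis by simp
        qed
        have "(\<integral>\<^sup>+y. indicator S (y - x) * ennreal ((v y - v x)\<^sup>2) \<partial>lborel)
          \<le> (\<integral>\<^sup>+y. ennreal ((Dstar sg eps u x y)\<^sup>2) * indicator \<D> y * indicator \<D> x * ennreal (1/\<gamma>) \<partial>lborel)"
        proof (intro nn_integral_mono_AE)
          show "AE y in lborel. indicator S (y - x) * ennreal ((v y - v x)\<^sup>2)
            \<le> ennreal ((Dstar sg eps u x y)\<^sup>2) * indicator \<D> y * indicator \<D> x * ennreal (1/\<gamma>)"
            using cv AE_norm_neq[of "norm x"]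
          proof eventually_elim
            case (elim y)
            show ?case
            proof (cases "y - x \<in> S \<and> (x \<in> Om \<or> y \<in> Om)")
              case True
              then have d: "norm (y - x) < eps" by (simp add: S_def)
              have xy: "x \<in> \<D>" "y \<in> \<D>"
                using True d by (auto simp: OmegaI_def norm_minus_commute)
              have ux: "u x = v x" "u y = v y"
                using \<open>cut u x = v x\<close> \<open>cut u y = v y\<close> xy by (simp_all add: cut_def)
              have "\<gamma> * (v y - v x)\<^sup>2 \<le> Gam sg eps x y * (v y - v x)\<^sup>2"
                using Gam_ge[of x y eps sg] d sg_pos
                by (intro mult_right_mono) (auto simp: \<gamma>_def K_max_def norm_minus_commute)
              also have "\<dots> = (Dstar sg eps u x y)\<^sup>2"
                using elim(2) by (simp add: Dstar_def power_mult_distrib alpha_sq ux power2_commute)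
              finally have "(v y - v x)\<^sup>2 \<le> (Dstar sg eps u x y)\<^sup>2 * (1/\<gamma>)"
                using \<gamma> by (simp add: field_simps)
              then show ?thesis
                using True xy \<gamma> by (simp add: ennreal_mult[symmetric] ennreal_leI)
            next
              case False
              then show ?thesis using vout by (auto simp: indicator_def)
            qed
          qed
        qed
        also have "\<dots> = (\<integral>\<^sup>+y. ennreal ((Dstar sg eps u x y)\<^sup>2) * indicator \<D> y * indicator \<D> x \<partial>lebesgue) * ennreal (1/\<gamma>)"
          unfolding nn_integral_completion[symmetric, of lborel] by (rule nn_integral_multc[OF Dm])
        also have "\<dots> = (\<integral>\<^sup>+y\<in>\<D>. ennreal ((Dstar sg eps u x y)\<^sup>2) \<partial>lborel) * indicator \<D> x * ennreal (1/\<gamma>)"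
          by (cases "x \<in> \<D>") (simp_all add: nn_integral_completion)
        finally show ?case .
      qed
    qed
    also have "\<dots> = Dsq Om eps sg u * ennreal (1/\<gamma>)"
    proof -
      have "(\<lambda>x. \<integral>\<^sup>+y. ennreal ((DU u (x, y))\<^sup>2) \<partial>lebesgue) \<in> borel_measurable lebesgue"
        by (rule sigma_finite_measure.borel_measurable_nn_integral_fst[OF sigma_finite_lebesgue])
          (use DU_measurable[OF uL] in measurable)
      then show ?thesis
        unfolding Dsq_def nn_integral_DU by (subst nn_integral_multc[symmetric]) (simp_all add: nn_integral_completion)
    qed
    finally have le: "I * ennreal m \<le> ennreal ((real N)\<^sup>2) * (Dsq Om eps sg u * ennreal (1/\<gamma>))"
      by (simp add: mult_left_mono)
    define n2 where "n2 = (\<integral>x. (cut u x)\<^sup>2 \<partial>lebesgue)"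
    have n2: "n2 \<ge> 0" by (simp add: n2_def)
    define E where "E = enn2real (Dsq Om eps sg u)"
    have E: "Dsq Om eps sg u = ennreal E" "E \<ge> 0"
      using Dsq_finite[OF uL] by (auto simp: E_def)
    have "ennreal (n2 * m) \<le> ennreal ((real N)\<^sup>2 * (E * (1/\<gamma>)))"
      using le mpos \<gamma> n2 E(2) unfolding I_eq E(1) n2_def[symmetric]
      by (simp add: ennreal_mult[symmetric])
    then have "n2 * m \<le> (real N)\<^sup>2 * (E * (1/\<gamma>))"
      using \<gamma> E(2) by (simp add: ennreal_le_iff)
    moreover have tn: "(tnorm Om eps sg u)\<^sup>2 = E / 2" using E(2) by (simp add: tnorm_def E_def)
    ultimately show ?thesis
      unfolding n2_def[symmetric] tn using mpos \<gamma> by (simp add: field_simps)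
  qed
  show ?thesis
    using main mpos \<gamma> N0 by (intro exI[of _ "2 * (real N)\<^sup>2 / (\<gamma> * m)"]) auto
qed

end

section \<open>The energy space and its dual\<close>

lemma bounded_bilinear_plus:
  assumes "bounded_bilinear f" "bounded_bilinear g"
  shows "bounded_bilinear (\<lambda>x y. f x y + g x y)"
proof -
  interpret f: bounded_bilinear f by fact
  interpret g: bounded_bilinear g by fact
  obtain K L where K: "\<And>x y. norm (f x y) \<le> norm x * norm y * K"
    and L: "\<And>x y. norm (g x y) \<le> norm x * norm y * L"
    using f.bounded g.bounded by blast
  have "norm (f x y + g x y) \<le> norm x * norm y * (K + L)" for x y
    using norm_triangle_ineq[of "f x y" "g x y"] K[of x y] L[of x y] by (simp add: distrib_left)
  then show ?thesis
    by unfold_locales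
      (auto simp: f.add_left g.add_left f.add_right g.add_right f.scaleR_left g.scaleR_left
        f.scaleR_right g.scaleR_right scaleR_right_distrib)
qed

context nonlocal_domain
begin

abbreviation (input) "V \<equiv> Vc Om eps sg"

definition J :: "('a \<Rightarrow> real) \<Rightarrow> 'a l2" where
  "J u = l2_of (\<lambda>x. indicator Om x * u x)"

definition R :: "'a l2 \<Rightarrow> 'a \<Rightarrow> real" where
  "R f x = indicator Om x * fn f x"

abbreviation "L2Om u \<equiv> sqint lebesgue (\<lambda>x. indicator Om x * u x)"

lemma Vc_L2D: "u \<in> V \<Longrightarrow> L2D u" by (simp add: Vc_iff)

lemma Vc_L2Om: "u \<in> V \<Longrightarrow> L2Om u"
proof -
  assume "u \<in> V"
  then have "sqint lebesgue (\<lambda>x. indicator Om x * cut u x)"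
    by (intro sqint_indicator Vc_L2D) auto
  moreover have "(\<lambda>x. indicator Om x * cut u x) = (\<lambda>x. indicator Om x * u x)"
    by (auto simp: cut_def indicator_def)
  ultimately show ?thesis by simp
qed

lemma AE_cut_eq: "u \<in> V \<Longrightarrow> AE x in lebesgue. cut u x = indicator Om x * u x"
proof -
  assume "u \<in> V"
  then have "AE x in lebesgue. x \<in> OmegaI Om eps \<longrightarrow> u x = 0" by (simp add: Vc_iff)
  then show ?thesis by eventually_elim (auto simp: cut_def indicator_def)
qed

lemma cut_R: "cut (R f) = R f"
  by (auto simp: cut_def R_def indicator_def)

lemma sqint_R: "sqint lebesgue (R f)"
  unfolding R_def[abs_def] by (intro sqint_indicator sqint_fn) auto

lemma R_Vc: "R f \<in> V"
  unfolding Vc_iff cut_R using sqint_R by (auto simp: R_def OmegaI_def)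

lemma Vc_lincomb: "u \<in> V \<Longrightarrow> v \<in> V \<Longrightarrow> (\<lambda>x. a * u x + b * v x) \<in> V"
  unfolding Vc_iff by (auto intro: L2D_lincomb elim: eventually_elim2)

lemma Vc_diff: "u \<in> V \<Longrightarrow> v \<in> V \<Longrightarrow> (\<lambda>x. u x - v x) \<in> V"
  using Vc_lincomb[of u v 1 "-1"] by simp

lemma Vc_scale: "u \<in> V \<Longrightarrow> (\<lambda>x. a * u x) \<in> V"
  using Vc_lincomb[of u u a 0] by simp

lemma Vc_zero: "(\<lambda>x. 0) \<in> V"
  unfolding Vc_iff by (simp add: cut_def[abs_def] sqint_zero)

lemma J_lincomb_L2Om: "L2Om u \<Longrightarrow> L2Om v \<Longrightarrow> J (\<lambda>x. a * u x + b * v x) = a *\<^sub>R J u + b *\<^sub>R J v"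
  unfolding J_def by (subst l2_of_lincomb[symmetric]) (auto simp: algebra_simps)

lemma J_diff_L2Om: "L2Om u \<Longrightarrow> L2Om v \<Longrightarrow> J (\<lambda>x. u x - v x) = J u - J v"
  using J_lincomb_L2Om[of u v 1 "-1"] by simp

lemma J_lincomb: "u \<in> V \<Longrightarrow> v \<in> V \<Longrightarrow> J (\<lambda>x. a * u x + b * v x) = a *\<^sub>R J u + b *\<^sub>R J v"
  by (intro J_lincomb_L2Om Vc_L2Om)

lemma J_diff: "u \<in> V \<Longrightarrow> v \<in> V \<Longrightarrow> J (\<lambda>x. u x - v x) = J u - J v"
  by (intro J_diff_L2Om Vc_L2Om)

lemma J_scale: "u \<in> V \<Longrightarrow> J (\<lambda>x. a * u x) = a *\<^sub>R J u"
  using J_lincomb[of u u a 0] by simp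

lemma norm_J_sq_L2Om: "L2Om u \<Longrightarrow> (norm (J u))\<^sup>2 = (\<integral>x. indicator Om x * (u x)\<^sup>2 \<partial>lebesgue)"
  unfolding J_def
  by (subst norm_l2_of_sq) (auto intro!: Bochner_Integration.integral_cong simp: indicator_def)

lemma norm_J_sq: "u \<in> V \<Longrightarrow> (norm (J u))\<^sup>2 = (\<integral>x. (cut u x)\<^sup>2 \<partial>lebesgue)"
proof -
  assume u: "u \<in> V"
  have "(norm (J u))\<^sup>2 = (\<integral>x. (indicator Om x * u x)\<^sup>2 \<partial>lebesgue)"
    unfolding J_def by (rule norm_l2_of_sq[OF Vc_L2Om[OF u]])
  also have "\<dots> = (\<integral>x. (cut u x)\<^sup>2 \<partial>lebesgue)"
    using AE_cut_eq[OF u] Vc_L2Om[OF u] Vc_L2D[OF u]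
    by (intro integral_cong_AE) (auto simp: sqint_def)
  finally show ?thesis .
qed

lemma J_cong: "L2Om u \<Longrightarrow> L2Om v \<Longrightarrow> J u = J v \<longleftrightarrow> (AE x in lebesgue. x \<in> Om \<longrightarrow> u x = v x)"
  unfolding J_def by (subst l2_of_eq_iff) (auto simp: indicator_def)

lemma AE_R_J:
  assumes "L2Om u"
  shows "AE x in lebesgue. R (J u) x = indicator Om x * u x"
  using fn_l2_of[OF assms] unfolding J_def R_def by eventually_elim (auto simp: indicator_def)

lemma L2Om_R: "L2Om (R f)" by (rule Vc_L2Om[OF R_Vc])

lemma J_R_J: "L2Om u \<Longrightarrow> J (R (J u)) = J u"
  by (subst J_cong) (auto simp: L2Om_R intro: eventually_mono[OF AE_R_J])

definition proj :: "'a l2 \<Rightarrow> 'a l2" where "proj f = J (R f)"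

lemma proj_J: "L2Om u \<Longrightarrow> proj (J u) = J u" by (simp add: proj_def J_R_J)

lemma proj_proj: "proj (proj f) = proj f" by (simp add: proj_def J_R_J L2Om_R)

lemma inner_J: "L2Om u \<Longrightarrow> L2Om v \<Longrightarrow> J u \<bullet> J v = (LINT x:Om|lebesgue. u x * v x)"
  unfolding J_def set_lebesgue_integral_def
  by (subst inner_l2_of) (auto intro!: Bochner_Integration.integral_cong simp: indicator_def)

lemma inner_J_domain: "u \<in> V \<Longrightarrow> v \<in> V \<Longrightarrow> (LINT x:\<D>|lebesgue. u x * v x) = J u \<bullet> J v"
proof -
  assume u: "u \<in> V" and v: "v \<in> V"
  have [measurable]: "cut u \<in> borel_measurable lebesgue" "cut v \<in> borel_measurable lebesgue"
    "(\<lambda>x. indicator Om x * u x) \<in> borel_measurable lebesgue"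
    "(\<lambda>x. indicator Om x * v x) \<in> borel_measurable lebesgue"
    using Vc_L2D[OF u] Vc_L2D[OF v] Vc_L2Om[OF u] Vc_L2Om[OF v] by (auto simp: sqint_def)
  have "(LINT x:\<D>|lebesgue. u x * v x) = (\<integral>x. cut u x * cut v x \<partial>lebesgue)"
    unfolding set_lebesgue_integral_def
    by (intro Bochner_Integration.integral_cong) (auto simp: cut_def indicator_def)
  also have "\<dots> = (\<integral>x. (indicator Om x * u x) * (indicator Om x * v x) \<partial>lebesgue)"
  proof (intro integral_cong_AE)
    show "AE x in lebesgue. cut u x * cut v x = (indicator Om x * u x) * (indicator Om x * v x)"
      using AE_cut_eq[OF u] AE_cut_eq[OF v] by eventually_elim simp
  qed measurable
  also have "\<dots> = J u \<bullet> J v"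
    unfolding J_def using Vc_L2Om[OF u] Vc_L2Om[OF v] by (simp add: inner_l2_of)
  finally show ?thesis .
qed

lemma inner_proj: "proj f \<bullet> g = (\<integral>x. R f x * fn g x \<partial>lebesgue)"
proof -
  have "proj f \<bullet> g = l2_of (\<lambda>x. indicator Om x * R f x) \<bullet> l2_of (fn g)"
    by (simp add: proj_def J_def)
  also have "\<dots> = (\<integral>x. (indicator Om x * R f x) * fn g x \<partial>lebesgue)"
    by (rule inner_l2_of[OF L2Om_R sqint_fn])
  also have "\<dots> = (\<integral>x. R f x * fn g x \<partial>lebesgue)"
    by (intro Bochner_Integration.integral_cong) (auto simp: R_def indicator_def)
  finally show ?thesis .
qed

lemma proj_selfadjoint: "proj f \<bullet> g = f \<bullet> proj g"
proof -
  have "f \<bullet> proj g = (\<integral>x. R g x * fn f x \<partial>lebesgue)"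
    using inner_proj[of g f] by (simp add: inner_commute)
  also have "\<dots> = (\<integral>x. R f x * fn g x \<partial>lebesgue)"
    by (intro Bochner_Integration.integral_cong) (auto simp: R_def)
  finally show ?thesis using inner_proj[of f g] by simp
qed

lemma proj_lincomb: "proj (a *\<^sub>R f + b *\<^sub>R g) = a *\<^sub>R proj f + b *\<^sub>R proj g"
proof -
  have *: "h \<bullet> proj (a *\<^sub>R f + b *\<^sub>R g) = h \<bullet> (a *\<^sub>R proj f + b *\<^sub>R proj g)" for h
    unfolding inner_add_right inner_scaleR_right proj_selfadjoint[symmetric] by simp
  then show ?thesis using vector_eq_ldot by blast
qed

lemma norm_proj_le: "norm (proj f) \<le> norm f"
proof -
  have "(norm (proj f))\<^sup>2 = proj f \<bullet> f"
    unfolding power2_norm_eq_inner using proj_selfadjoint[of "proj f" f] by (simp add: proj_proj)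
  also have "\<dots> \<le> norm (proj f) * norm f" by (rule norm_cauchy_schwarz)
  finally show ?thesis by (cases "norm (proj f) = 0") (auto simp: power2_eq_square)
qed

lemma bounded_linear_proj: "bounded_linear proj"
  by (rule bounded_linear_intro[where K = 1])
    (use proj_lincomb[of 1 _ 1] proj_lincomb[of _ _ 0] norm_proj_le in auto)

definition Cb :: real where "Cb = sqrt (2 * K_max * D_mass)"

lemma Cb_nonneg: "Cb \<ge> 0" using K_max_pos D_mass_nonneg by (simp add: Cb_def)

lemma tnorm_le: "u \<in> V \<Longrightarrow> tnorm Om eps sg u \<le> Cb * norm (J u)"
proof -
  assume u: "u \<in> V"
  have "(tnorm Om eps sg u)\<^sup>2 \<le> (Cb * norm (J u))\<^sup>2"
    using tnorm_sq_le[OF Vc_L2D[OF u]] K_max_pos D_mass_nonneg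
    by (simp add: power_mult_distrib norm_J_sq[OF u] Cb_def)
  then show ?thesis by (rule power2_le_imp_le) (use Cb_nonneg in auto)
qed

lemma Poincare_ex: "\<exists>C>0. \<forall>u\<in>V. norm (J u) \<le> C * tnorm Om eps sg u"
proof -
  obtain C where C: "C > 0" "\<forall>u\<in>V. (\<integral>x. (cut u x)\<^sup>2 \<partial>lebesgue) \<le> C * (tnorm Om eps sg u)\<^sup>2"
    using Poincare_integral by blast
  have "norm (J u) \<le> sqrt C * tnorm Om eps sg u" if "u \<in> V" for u
  proof (rule power2_le_imp_le)
    show "(norm (J u))\<^sup>2 \<le> (sqrt C * tnorm Om eps sg u)\<^sup>2"
      using C that by (simp add: norm_J_sq power_mult_distrib)
  qed (use C in \<open>auto simp: tnorm_nonneg\<close>)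
  then show ?thesis using C(1) by (intro exI[of _ "sqrt C"]) auto
qed

definition Cp :: real where "Cp = (SOME C. C > 0 \<and> (\<forall>u\<in>V. norm (J u) \<le> C * tnorm Om eps sg u))"

lemma Cp_pos: "Cp > 0" and Poincare: "u \<in> V \<Longrightarrow> norm (J u) \<le> Cp * tnorm Om eps sg u"
  using someI_ex[OF Poincare_ex[unfolded Bex_def]] unfolding Cp_def[symmetric] by auto

lemma vc_inner_diff:
  assumes "u \<in> V" "v \<in> V" "w \<in> V"
  shows "vc_inner Om eps sg (\<lambda>x. u x - v x) w = vc_inner Om eps sg u w - vc_inner Om eps sg v w"
  using vc_inner_lincomb[of u v w 1 "-1"] assms by (simp add: Vc_L2D)

lemma tnorm_diff_eq_0:
  assumes "u \<in> V" "v \<in> V" "J u = J v"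
  shows "tnorm Om eps sg (\<lambda>x. u x - v x) = 0"
  using tnorm_le[OF Vc_diff[OF assms(1,2)]] tnorm_nonneg[of "\<lambda>x. u x - v x"] assms
  by (simp add: J_diff)

lemma vc_inner_cong_left:
  assumes "u \<in> V" "u' \<in> V" "v \<in> V" "J u = J u'"
  shows "vc_inner Om eps sg u v = vc_inner Om eps sg u' v"
  using abs_vc_inner_le[OF Vc_L2D[OF Vc_diff[OF assms(1,2)]] Vc_L2D[OF assms(3)]]
    tnorm_diff_eq_0[OF assms(1,2,4)] vc_inner_diff[OF assms(1-3)]
  by simp

lemma vc_inner_cong:
  assumes "u \<in> V" "u' \<in> V" "v \<in> V" "v' \<in> V" "J u = J u'" "J v = J v'"
  shows "vc_inner Om eps sg u v = vc_inner Om eps sg u' v'"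
  using vc_inner_cong_left[OF assms(1-3,5)] vc_inner_cong_left[OF assms(3,4,2,6)]
  by (simp add: vc_inner_commute)

definition bf :: "'a l2 \<Rightarrow> 'a l2 \<Rightarrow> real" where
  "bf f g = vc_inner Om eps sg (R f) (R g)"

lemma vc_inner_bf: "u \<in> V \<Longrightarrow> v \<in> V \<Longrightarrow> vc_inner Om eps sg u v = bf (J u) (J v)"
  unfolding bf_def by (rule vc_inner_cong) (auto simp: R_Vc J_R_J Vc_L2Om)

lemma bf_sym: "bf f g = bf g f" by (simp add: bf_def vc_inner_commute)

lemma bf_proj: "bf (proj f) g = bf f g"
  unfolding bf_def by (rule vc_inner_cong) (auto simp: R_Vc proj_def J_R_J L2Om_R)

lemma bf_lincomb: "bf (a *\<^sub>R f + b *\<^sub>R g) h = a * bf f h + b * bf g h"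
proof -
  have "bf (a *\<^sub>R f + b *\<^sub>R g) h = vc_inner Om eps sg (\<lambda>x. a * R f x + b * R g x) (R h)"
    unfolding bf_def
    by (rule vc_inner_cong) (auto simp: R_Vc Vc_lincomb J_lincomb proj_lincomb simp flip: proj_def)
  also have "\<dots> = a * bf f h + b * bf g h"
    unfolding bf_def by (intro vc_inner_lincomb Vc_L2D R_Vc)
  finally show ?thesis .
qed

lemma bf_self: "bf f f = (tnorm Om eps sg (R f))\<^sup>2"
  unfolding bf_def by (rule tnorm_sq[symmetric]) (intro Vc_L2D R_Vc)

lemma tnorm_R_le: "tnorm Om eps sg (R f) \<le> Cb * norm f"
  using tnorm_le[OF R_Vc, of f] mult_left_mono[OF norm_proj_le[of f] Cb_nonneg]
  unfolding proj_def by linarith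

lemma bounded_bilinear_bf: "bounded_bilinear bf"
proof
  show "bf (f + f') g = bf f g + bf f' g" for f f' g using bf_lincomb[of 1 f 1 f' g] by simp
  then show "bf f (g + g') = bf f g + bf f g'" for f g g' by (metis bf_sym)
  show sc: "bf (r *\<^sub>R f) g = r *\<^sub>R bf f g" for r f g using bf_lincomb[of r f 0 f g] by simp
  then show "bf f (r *\<^sub>R g) = r *\<^sub>R bf f g" for r f g by (metis bf_sym)
  have "norm (bf f g) \<le> norm f * norm g * (Cb * Cb)" for f g
  proof -
    have "\<bar>bf f g\<bar> \<le> tnorm Om eps sg (R f) * tnorm Om eps sg (R g)"
      unfolding bf_def by (intro abs_vc_inner_le Vc_L2D R_Vc)
    also have "\<dots> \<le> (Cb * norm f) * (Cb * norm g)"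
      using Cb_nonneg by (intro mult_mono tnorm_R_le) (auto simp: tnorm_nonneg)
    finally show ?thesis by (simp add: mult_ac)
  qed
  then show "\<exists>K. \<forall>f g. norm (bf f g) \<le> norm f * norm g * K" by blast
qed

text \<open>The form of the nonlocal operator only sees functions supported in the domain; adding the
  inner product of the remaining components makes it coercive on the whole space.\<close>

definition Bf :: "'a l2 \<Rightarrow> 'a l2 \<Rightarrow> real" where
  "Bf f g = bf f g + (f - proj f) \<bullet> (g - proj g)"

lemma bounded_bilinear_Bf: "bounded_bilinear Bf"
proof -
  have "bounded_linear (\<lambda>f. f - proj f)"
    by (intro bounded_linear_sub bounded_linear_ident bounded_linear_proj)
  then have "bounded_bilinear (\<lambda>f g. (f - proj f) \<bullet> (g - proj g))"
    by (intro bounded_bilinear.comp[OF bounded_bilinear_inner])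
  then show ?thesis
    unfolding Bf_def[abs_def] by (rule bounded_bilinear_plus[OF bounded_bilinear_bf])
qed

lemma Bf_sym: "Bf f g = Bf g f"
  by (simp add: Bf_def bf_sym[of f g] inner_commute)

definition \<kappa> :: real where "\<kappa> = min (1 / Cp\<^sup>2) 1"

lemma \<kappa>_pos: "\<kappa> > 0" using Cp_pos by (simp add: \<kappa>_def)

lemma Bf_coercive: "\<kappa> * (norm f)\<^sup>2 \<le> Bf f f"
proof -
  have "proj f \<bullet> (f - proj f) = 0"
    using proj_selfadjoint[of f "f - proj f"] proj_lincomb[of 1 f "-1" "proj f"] by (simp add: proj_proj)
  then have pyth: "(norm f)\<^sup>2 = (norm (proj f))\<^sup>2 + (norm (f - proj f))\<^sup>2"
    by (simp add: power2_norm_eq_inner inner_diff_left inner_diff_right inner_commute)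
  have "(norm (proj f))\<^sup>2 \<le> (Cp * tnorm Om eps sg (R f))\<^sup>2"
    unfolding proj_def by (intro power_mono Poincare R_Vc) simp
  then have "(norm (proj f))\<^sup>2 \<le> Cp\<^sup>2 * bf f f" by (simp add: bf_self power_mult_distrib)
  then have 1: "1 / Cp\<^sup>2 * (norm (proj f))\<^sup>2 \<le> bf f f" using Cp_pos by (simp add: field_simps)
  have "\<kappa> * (norm (proj f))\<^sup>2 \<le> 1 / Cp\<^sup>2 * (norm (proj f))\<^sup>2"
    by (intro mult_right_mono) (auto simp: \<kappa>_def)
  moreover have "\<kappa> * (norm (f - proj f))\<^sup>2 \<le> 1 * (norm (f - proj f))\<^sup>2"
    by (intro mult_right_mono) (auto simp: \<kappa>_def)
  ultimately show ?thesis
    unfolding Bf_def pyth power2_norm_eq_inner[of "f - proj f", symmetric] distrib_left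
    using 1 by linarith
qed

definition Binv :: "'a l2 \<Rightarrow> 'a l2" where "Binv z = (SOME r. \<forall>g. Bf r g = z \<bullet> g)"

lemma Bf_Binv: "Bf (Binv z) g = z \<bullet> g"
proof -
  have "\<exists>r. \<forall>g. Bf r g = z \<bullet> g"
    by (rule symmetric_Lax_Milgram[OF bounded_bilinear_Bf Bf_sym \<kappa>_pos Bf_coercive bounded_linear_inner_right])
  from someI_ex[OF this] show ?thesis unfolding Binv_def by blast
qed

lemma Bf_inject: "(\<And>g. Bf r g = Bf r' g) \<Longrightarrow> r = r'"
proof -
  assume *: "\<And>g. Bf r g = Bf r' g"
  interpret bounded_bilinear Bf by (rule bounded_bilinear_Bf)
  have "Bf (r - r') (r - r') = 0" unfolding diff_left * by simp
  then have "\<kappa> * (norm (r - r'))\<^sup>2 \<le> 0" using Bf_coercive[of "r - r'"] by simp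
  then show ?thesis using \<kappa>_pos by (simp add: mult_le_0_iff)
qed

lemma bounded_linear_Binv: "bounded_linear Binv"
proof (rule bounded_linear_intro[where K = "1 / \<kappa>"])
  interpret bounded_bilinear Bf by (rule bounded_bilinear_Bf)
  show "Binv (x + y) = Binv x + Binv y" for x y
    by (rule Bf_inject) (simp add: add_left Bf_Binv inner_add_left)
  show "Binv (r *\<^sub>R x) = r *\<^sub>R Binv x" for r x
    by (rule Bf_inject) (simp add: scaleR_left Bf_Binv)
  show "norm (Binv x) \<le> norm x * (1 / \<kappa>)" for x
  proof -
    have "\<kappa> * (norm (Binv x))\<^sup>2 \<le> x \<bullet> Binv x" using Bf_coercive[of "Binv x"] Bf_Binv by simp
    also have "\<dots> \<le> norm x * norm (Binv x)" by (rule norm_cauchy_schwarz)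
    finally have "(\<kappa> * norm (Binv x)) * norm (Binv x) \<le> norm x * norm (Binv x)"
      by (simp add: power2_eq_square mult.assoc)
    then have "\<kappa> * norm (Binv x) \<le> norm x \<or> Binv x = 0" by auto
    then show ?thesis using \<kappa>_pos by (auto simp: field_simps)
  qed
qed

lemma Binv_sym: "x \<bullet> Binv y = y \<bullet> Binv x"
  by (metis Bf_Binv Bf_sym)

lemma vc_inner_Binv: "v \<in> V \<Longrightarrow> vc_inner Om eps sg (R (Binv z)) v = z \<bullet> J v"
proof -
  assume v: "v \<in> V"
  have "vc_inner Om eps sg (R (Binv z)) v = bf (Binv z) (J v)"
    using vc_inner_bf[OF R_Vc v] bf_proj unfolding proj_def by simp
  also have "\<dots> = Bf (Binv z) (J v)"
    unfolding Bf_def proj_J[OF Vc_L2Om[OF v]] by simp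
  finally show ?thesis by (simp add: Bf_Binv)
qed

lemma tnorm_scale: "u \<in> V \<Longrightarrow> (tnorm Om eps sg (\<lambda>x. a * u x))\<^sup>2 = a\<^sup>2 * (tnorm Om eps sg u)\<^sup>2"
proof -
  assume u: "u \<in> V"
  have "vc_inner Om eps sg (\<lambda>x. a * u x) w = a * vc_inner Om eps sg u w" if "w \<in> V" for w
    using vc_inner_lincomb[of u u w a 0] u that by (simp add: Vc_L2D)
  note sc = this
  show ?thesis
    unfolding tnorm_sq[OF Vc_L2D[OF Vc_scale[OF u]]] tnorm_sq[OF Vc_L2D[OF u]] sc[OF Vc_scale[OF u]]
      vc_inner_commute[of u "\<lambda>x. a * u x"] sc[OF u]
    by (simp add: power2_eq_square)
qed

lemma dual_norm_eq:
  assumes l: "\<And>v. v \<in> V \<Longrightarrow> l v = z \<bullet> J v"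
  shows "dual_norm Om eps sg l = tnorm Om eps sg (R (Binv z))"
  unfolding dual_norm_def
proof (rule cSup_eq_maximum)
  let ?r = "R (Binv z)" and ?t = "tnorm Om eps sg"
  have lr: "l v = vc_inner Om eps sg ?r v" if "v \<in> V" for v
    using l[OF that] vc_inner_Binv[OF that] by simp
  show "?t ?r \<in> {\<bar>l v\<bar> |v. v \<in> V \<and> ?t v \<le> 1}"
  proof (cases "?t ?r = 0")
    case True
    have "l (\<lambda>x. 0) = 0" using l[OF Vc_zero] by (simp add: J_def l2_of_zero)
    moreover have "?t (\<lambda>x. 0) \<le> 1" using tnorm_scale[OF Vc_zero, of 0] by simp
    ultimately show ?thesis using True Vc_zero by (auto intro!: exI[of _ "\<lambda>x. 0"])
  next
    case False
    define v where "v = (\<lambda>x. (1 / ?t ?r) * ?r x)"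
    have v: "v \<in> V" unfolding v_def by (intro Vc_scale R_Vc)
    have "(?t v)\<^sup>2 = 1" unfolding v_def tnorm_scale[OF R_Vc] using False by (simp add: power_divide)
    then have "?t v = 1" using tnorm_nonneg[of v] by (simp add: power2_eq_1_iff)
    moreover have "l v = ?t ?r"
    proof -
      have "l v = (1 / ?t ?r) * (z \<bullet> J ?r)" unfolding l[OF v] unfolding v_def J_scale[OF R_Vc] by simp
      also have "z \<bullet> J ?r = (?t ?r)\<^sup>2"
        using vc_inner_Binv[OF R_Vc, of z "Binv z"] tnorm_sq[OF Vc_L2D[OF R_Vc]] by simp
      finally show ?thesis using False by (simp add: power2_eq_square)
    qed
    ultimately show ?thesis using v tnorm_nonneg[of ?r] by (auto intro!: exI[of _ v])
  qed
  fix a assume "a \<in> {\<bar>l v\<bar> |v. v \<in> V \<and> ?t v \<le> 1}"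
  then obtain v where v: "v \<in> V" "?t v \<le> 1" "a = \<bar>l v\<bar>" by blast
  have "a \<le> ?t ?r * ?t v"
    unfolding v(3) lr[OF v(1)] by (intro abs_vc_inner_le Vc_L2D R_Vc v)
  also have "\<dots> \<le> ?t ?r * 1" using v tnorm_nonneg by (intro mult_left_mono) auto
  finally show "a \<le> ?t ?r" by simp
qed

lemma dual_norm_sq:
  assumes "\<And>v. v \<in> V \<Longrightarrow> l v = z \<bullet> J v" "proj z = z"
  shows "(dual_norm Om eps sg l)\<^sup>2 = z \<bullet> Binv z"
proof -
  have dn: "dual_norm Om eps sg l = tnorm Om eps sg (R (Binv z))"
    by (rule dual_norm_eq) (rule assms(1))
  have "(dual_norm Om eps sg l)\<^sup>2 = z \<bullet> proj (Binv z)"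
    unfolding dn tnorm_sq[OF Vc_L2D[OF R_Vc]] vc_inner_Binv[OF R_Vc] proj_def ..
  then show ?thesis using proj_selfadjoint[of z "Binv z"] assms(2) by simp
qed

lemma norm_le_dual_norm:
  assumes "\<And>v. v \<in> V \<Longrightarrow> l v = z \<bullet> J v" "proj z = z"
  shows "norm z \<le> Cb * dual_norm Om eps sg l"
proof -
  have dn: "dual_norm Om eps sg l = tnorm Om eps sg (R (Binv z))"
    by (rule dual_norm_eq) (rule assms(1))
  have "(norm z)\<^sup>2 = vc_inner Om eps sg (R (Binv z)) (R z)"
    using assms(2) by (simp add: vc_inner_Binv R_Vc power2_norm_eq_inner flip: proj_def)
  also have "\<dots> \<le> tnorm Om eps sg (R (Binv z)) * tnorm Om eps sg (R z)"
    using abs_vc_inner_le[OF Vc_L2D[OF R_Vc] Vc_L2D[OF R_Vc]] abs_le_D1 by blast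
  also have "\<dots> \<le> dual_norm Om eps sg l * (Cb * norm z)"
    unfolding dn by (intro mult_left_mono tnorm_R_le tnorm_nonneg)
  finally have "norm z * norm z \<le> (Cb * dual_norm Om eps sg l) * norm z"
    by (simp add: power2_eq_square mult_ac)
  moreover have "0 \<le> Cb * dual_norm Om eps sg l"
    unfolding dn by (intro mult_nonneg_nonneg Cb_nonneg tnorm_nonneg)
  ultimately show ?thesis by (cases "z = 0") auto
qed

lemma Vc_dual_inner: "Vc_dual Om eps sg (\<lambda>v. z \<bullet> J v)"
  unfolding Vc_dual_def
proof (intro conjI ballI allI)
  show "z \<bullet> J (\<lambda>x. a * u x + b * v x) = a * (z \<bullet> J u) + b * (z \<bullet> J v)" if "u \<in> V" "v \<in> V" for u v a b
    using that by (simp add: J_lincomb inner_add_right)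
  have "\<bar>z \<bullet> J v\<bar> \<le> (norm z * Cp) * tnorm Om eps sg v" if "v \<in> V" for v
  proof -
    have "\<bar>z \<bullet> J v\<bar> \<le> norm z * norm (J v)" by (rule Cauchy_Schwarz_ineq2)
    also have "\<dots> \<le> norm z * (Cp * tnorm Om eps sg v)" by (intro mult_left_mono Poincare that) simp
    finally show ?thesis by (simp add: mult_ac)
  qed
  then show "\<exists>C. \<forall>v\<in>V. \<bar>z \<bullet> J v\<bar> \<le> C * tnorm Om eps sg v" by blast
qed

lemma Vc_dual_representation:
  assumes "Vc_dual Om eps sg l"
  shows "\<exists>z. proj z = z \<and> (\<forall>v\<in>V. l v = z \<bullet> J v)"
proof -
  obtain C where lin: "\<And>u v a b. u \<in> V \<Longrightarrow> v \<in> V \<Longrightarrow> l (\<lambda>x. a * u x + b * v x) = a * l u + b * l v"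
    and C: "\<And>v. v \<in> V \<Longrightarrow> \<bar>l v\<bar> \<le> C * tnorm Om eps sg v"
    using assms unfolding Vc_dual_def by blast
  have cong: "l u = l v" if "u \<in> V" "v \<in> V" "J u = J v" for u v
    using C[OF Vc_diff[OF that(1,2)]] tnorm_diff_eq_0[OF that] lin[OF that(1,2), of 1 "-1"] by simp
  have lR: "l (R (a *\<^sub>R f + b *\<^sub>R g)) = a * l (R f) + b * l (R g)" for a b f g
  proof -
    have "l (R (a *\<^sub>R f + b *\<^sub>R g)) = l (\<lambda>x. a * R f x + b * R g x)"
      by (rule cong) (auto simp: R_Vc Vc_lincomb J_lincomb proj_lincomb simp flip: proj_def)
    then show ?thesis by (simp add: lin R_Vc)
  qed
  have "bounded_linear (\<lambda>f. l (R f))"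
  proof (rule bounded_linear_intro[where K = "\<bar>C\<bar> * Cb"])
    show "l (R (x + y)) = l (R x) + l (R y)" for x y using lR[of 1 x 1 y] by simp
    show "l (R (r *\<^sub>R x)) = r *\<^sub>R l (R x)" for r x using lR[of r x 0 x] by simp
    show "norm (l (R x)) \<le> norm x * (\<bar>C\<bar> * Cb)" for x
    proof -
      have "\<bar>l (R x)\<bar> \<le> C * tnorm Om eps sg (R x)" by (rule C[OF R_Vc])
      also have "\<dots> \<le> \<bar>C\<bar> * tnorm Om eps sg (R x)" by (intro mult_right_mono tnorm_nonneg) simp
      also have "\<dots> \<le> \<bar>C\<bar> * (Cb * norm x)" by (intro mult_left_mono tnorm_R_le) simp
      finally show ?thesis by (simp add: mult_ac)
    qed
  qed
  then obtain z where z: "\<And>f. z \<bullet> f = l (R f)" using Riesz_representation by blast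
  have "l v = z \<bullet> J v" if "v \<in> V" for v
    unfolding z by (rule cong) (use that in \<open>auto simp: R_Vc J_R_J Vc_L2Om\<close>)
  moreover have "proj z \<bullet> f = z \<bullet> f" for f
    unfolding proj_selfadjoint z by (rule cong) (auto simp: R_Vc proj_def J_R_J L2Om_R)
  then have "proj z = z" using vector_eq_rdot by blast
  ultimately show ?thesis by blast
qed

end

section \<open>The productivity-production operator\<close>

lemma norm_l2_of_mono:
  assumes "sqint lebesgue f" "sqint lebesgue g" "AE x in lebesgue. \<bar>f x\<bar> \<le> \<bar>g x\<bar>"
  shows "norm (l2_of f) \<le> norm (l2_of g)"
proof (rule power2_le_imp_le)
  show "(norm (l2_of f))\<^sup>2 \<le> (norm (l2_of g))\<^sup>2"
    unfolding norm_l2_of_sq[OF assms(1)] norm_l2_of_sq[OF assms(2)]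
    using assms by (intro integral_mono_AE) (auto simp: sqint_def abs_le_square_iff)
qed simp

context nonlocal_domain
begin

lemma L2Om_bounded:
  assumes m: "(\<lambda>x. indicator Om x * w x) \<in> borel_measurable lebesgue"
    and b: "AE x in lebesgue. x \<in> Om \<longrightarrow> \<bar>w x\<bar> \<le> C"
  shows "L2Om w"
proof (rule sqint_bound[OF _ m])
  show "sqint lebesgue (\<lambda>x. C * indicator Om x)"
    using lmeasurable_domain(2)
    by (intro sqint_scale)
      (auto simp: sqint_def power2_eq_square indicator_inter_arith[symmetric] fmeasurable_def)
  show "AE x in lebesgue. \<bar>indicator Om x * w x\<bar> \<le> \<bar>C * indicator Om x\<bar>"
    using b by eventually_elim (auto simp: indicator_def)
qed

lemma norm_J_le_affine:
  assumes w: "L2Om w" and u: "L2Om u" and a: "a \<ge> 0" and b: "b \<ge> 0"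
    and le: "AE x in lebesgue. x \<in> Om \<longrightarrow> \<bar>w x\<bar> \<le> a + b * \<bar>u x\<bar>"
  shows "norm (J w) \<le> a * sqrt D_mass + b * norm (J u)"
proof -
  have o: "L2Om (\<lambda>x. 1)"
    by (rule L2Om_bounded[where C = 1]) (auto intro!: borel_measurable_indicator)
  have au: "sqint lebesgue (\<lambda>x. \<bar>indicator Om x * u x\<bar>)"
    using u by (auto simp: sqint_def)
  have "norm (J w) \<le> norm (l2_of (\<lambda>x. a * (indicator Om x * 1) + b * \<bar>indicator Om x * u x\<bar>))"
    unfolding J_def
  proof (rule norm_l2_of_mono[OF w])
    show "sqint lebesgue (\<lambda>x. a * (indicator Om x * 1) + b * \<bar>indicator Om x * u x\<bar>)"
      by (rule sqint_lincomb[OF o au])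
    show "AE x in lebesgue. \<bar>indicator Om x * w x\<bar> \<le> \<bar>a * (indicator Om x * 1) + b * \<bar>indicator Om x * u x\<bar>\<bar>"
      using le by eventually_elim (use a b in \<open>auto simp: indicator_def\<close>)
  qed
  also have "\<dots> = norm (a *\<^sub>R J (\<lambda>x. 1) + b *\<^sub>R l2_of (\<lambda>x. \<bar>indicator Om x * u x\<bar>))"
    unfolding J_def by (subst l2_of_lincomb[OF o au]) simp
  also have "\<dots> \<le> a * norm (J (\<lambda>x. 1)) + b * norm (l2_of (\<lambda>x. \<bar>indicator Om x * u x\<bar>))"
    using norm_triangle_ineq[of "a *\<^sub>R J (\<lambda>x. 1)" "b *\<^sub>R l2_of (\<lambda>x. \<bar>indicator Om x * u x\<bar>)"] a b by simp
  also have "\<dots> \<le> a * sqrt D_mass + b * norm (J u)"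
  proof (intro add_mono mult_left_mono a b)
    have "(norm (J (\<lambda>x. 1)))\<^sup>2 = measure lebesgue Om"
      unfolding norm_J_sq_L2Om[OF o] by simp
    also have "\<dots> \<le> D_mass"
      unfolding D_mass_def using lmeasurable_domain by (intro measure_mono_fmeasurable) auto
    finally show "norm (J (\<lambda>x. 1)) \<le> sqrt D_mass" by (simp add: real_le_rsqrt)
    show "norm (l2_of (\<lambda>x. \<bar>indicator Om x * u x\<bar>)) \<le> norm (J u)"
      unfolding J_def by (rule norm_l2_of_mono[OF au u]) simp
  qed
  finally show ?thesis .
qed

lemma integral_abs_cut_le:
  assumes "u \<in> V"
  shows "integrable lebesgue (cut u)" "(\<integral>x. \<bar>cut u x\<bar> \<partial>lebesgue) \<le> sqrt D_mass * norm (J u)"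
proof -
  have i: "sqint lebesgue (indicator \<D> :: 'a \<Rightarrow> real)"
    using lmeasurable_domain(1)
    by (auto simp: sqint_def power2_eq_square indicator_inter_arith[symmetric] fmeasurable_def
        intro!: borel_measurable_indicator)
  have a: "sqint lebesgue (\<lambda>x. \<bar>cut u x\<bar>)" using Vc_L2D[OF assms] by (auto simp: sqint_def)
  have e: "indicator \<D> x * cut u x = cut u x" "indicator \<D> x * \<bar>cut u x\<bar> = \<bar>cut u x\<bar>" for x
    by (auto simp: cut_def indicator_def)
  show "integrable lebesgue (cut u)"
    using sqint_integrable_mult[OF i Vc_L2D[OF assms]] by (simp add: e)
  have "(\<integral>x. \<bar>cut u x\<bar> \<partial>lebesgue)\<^sup>2 \<le> D_mass * (norm (J u))\<^sup>2"
    using sqint_Cauchy_Schwarz[OF i a] unfolding norm_J_sq[OF assms]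
    by (simp add: e D_mass_def power2_eq_square indicator_inter_arith[symmetric])
  also have "\<dots> = (sqrt D_mass * norm (J u))\<^sup>2"
    using D_mass_nonneg by (simp add: power_mult_distrib)
  finally show "(\<integral>x. \<bar>cut u x\<bar> \<partial>lebesgue) \<le> sqrt D_mass * norm (J u)"
    by (rule power2_le_imp_le) (use D_mass_nonneg in auto)
qed

end

lemma exp_diff_le:
  fixes a b M :: real
  assumes "a \<le> M" "b \<le> M"
  shows "\<bar>exp a - exp b\<bar> \<le> exp M * \<bar>a - b\<bar>"
proof -
  have *: "exp a - exp b \<le> exp M * (a - b)" if "b \<le> a" "a \<le> M" for a b :: real
  proof -
    have "exp a * (1 + (b - a)) \<le> exp a * exp (b - a)"
      by (intro mult_left_mono exp_ge_add_one_self) simp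
    also have "\<dots> = exp b" by (simp flip: exp_add)
    finally have "exp a - exp b \<le> exp a * (a - b)" by (simp add: algebra_simps)
    also have "\<dots> \<le> exp M * (a - b)" using that by (intro mult_right_mono) auto
    finally show ?thesis .
  qed
  show ?thesis
    using *[of b a] *[of a b] assms by (cases "b \<le> a") auto
qed

locale nonlocal_growth = nonlocal_domain Om eps sg
  for Om :: "'a::euclidean_space set" and eps sg :: real +
  fixes mu xi T Mp Lp Lphi CA :: real and p phi :: "real \<Rightarrow> real" and A0 :: "'a \<Rightarrow> real"
  assumes mu_lt: "mu < eps" and xi_pos: "xi > 0" and T_pos: "T > 0"
    and p_nonneg: "\<And>s. 0 \<le> p s" and p_le: "\<And>s. p s \<le> Mp" and p_lip: "Lp-lipschitz_on UNIV p"
    and phi_nonneg: "\<And>s. 0 \<le> phi s" and phi_lip: "Lphi-lipschitz_on UNIV phi"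
    and A0_nonneg: "\<And>x. 0 \<le> A0 x" and A0_meas: "A0 \<in> borel_measurable (lebesgue_on Om)"
    and A0_le: "AE x in lebesgue_on Om. A0 x \<le> CA" and CA_nonneg: "CA \<ge> 0"
begin

lemma Mp_nonneg: "Mp \<ge> 0" using p_nonneg[of 0] p_le[of 0] by simp
lemma Lp_nonneg: "Lp \<ge> 0" and Lphi_nonneg: "Lphi \<ge> 0"
  using p_lip phi_lip lipschitz_on_nonneg by blast+
lemma p_diff: "\<bar>p a - p b\<bar> \<le> Lp * \<bar>a - b\<bar>"
  using lipschitz_onD[OF p_lip, of a b] by (simp add: dist_real_def)
lemma phi_diff: "\<bar>phi a - phi b\<bar> \<le> Lphi * \<bar>a - b\<bar>"
  using lipschitz_onD[OF phi_lip, of a b] by (simp add: dist_real_def)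

lemma phi_measurable: "phi \<in> borel_measurable borel"
  by (intro borel_measurable_continuous_onI lipschitz_on_continuous_on[OF phi_lip])
lemma p_measurable: "p \<in> borel_measurable borel"
  by (intro borel_measurable_continuous_onI lipschitz_on_continuous_on[OF p_lip])

definition PhiU :: "real \<Rightarrow> ('a \<Rightarrow> real) \<Rightarrow> 'a \<Rightarrow> real" where
  "PhiU nu u x = (LINT y:\<D>|lebesgue. phi (u y) * Gam sg nu x y)"

lemma PhiU_cut: "PhiU nu u x = (\<integral>y. indicator \<D> y * phi (cut u y) * Gam sg nu x y \<partial>lebesgue)"
  unfolding PhiU_def set_lebesgue_integral_def
  by (intro Bochner_Integration.integral_cong) (auto simp: cut_def indicator_def)

lemma PhiU_measurable:
  assumes "u \<in> V"
  shows "PhiU nu u \<in> borel_measurable lebesgue"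
proof -
  have [measurable]: "cut u \<in> borel_measurable lebesgue" using Vc_L2D[OF assms] by (simp add: sqint_def)
  note [measurable] = phi_measurable
  have [measurable]: "(\<lambda>x. indicator \<D> x :: real) \<in> borel_measurable lebesgue"
    by (rule borel_measurable_indicator) simp
  have [measurable]: "(\<lambda>z. Gam sg nu (fst z) (snd z)) \<in> borel_measurable (lebesgue \<Otimes>\<^sub>M (lebesgue :: 'a measure))"
    by (intro Gam_measurable fst_snd_measurable_lebesgue_pair)
  have "(\<lambda>x. \<integral>y. indicator \<D> y * phi (cut u y) * Gam sg nu x y \<partial>lebesgue) \<in> borel_measurable lebesgue"
    by (rule sigma_finite_measure.borel_measurable_lebesgue_integral[OF sigma_finite_lebesgue])
      (unfold case_prod_beta, measurable)
  then show ?thesis unfolding PhiU_cut[abs_def] .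
qed

lemma PhiU_integrable:
  assumes "u \<in> V"
  shows "integrable lebesgue (\<lambda>y. indicator \<D> y * phi (cut u y) * Gam sg nu x y)"
proof (rule Bochner_Integration.integrable_bound)
  show "integrable lebesgue (\<lambda>y. (phi 0 * indicator \<D> y + Lphi * \<bar>cut u y\<bar>) * K_max)"
    using integral_abs_cut_le(1)[OF assms] lmeasurable_domain(1)
    by (auto simp: fmeasurable_def)
  have [measurable]: "cut u \<in> borel_measurable lebesgue" using Vc_L2D[OF assms] by (simp add: sqint_def)
  note [measurable] = phi_measurable
  have [measurable]: "(\<lambda>x. indicator \<D> x :: real) \<in> borel_measurable lebesgue"
    by (rule borel_measurable_indicator) simp
  have [measurable]: "(\<lambda>y. Gam sg nu x y) \<in> borel_measurable lebesgue"
    by (intro Gam_measurable measurable_completion) auto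
  show "(\<lambda>y. indicator \<D> y * phi (cut u y) * Gam sg nu x y) \<in> borel_measurable lebesgue"
    by measurable
  show "AE y in lebesgue. norm (indicator \<D> y * phi (cut u y) * Gam sg nu x y)
      \<le> norm ((phi 0 * indicator \<D> y + Lphi * \<bar>cut u y\<bar>) * K_max)"
  proof (intro AE_I2)
    fix y
    have "phi (cut u y) \<le> phi 0 + Lphi * \<bar>cut u y\<bar>" using phi_diff[of "cut u y" 0] by simp
    then have "indicator \<D> y * phi (cut u y) \<le> phi 0 * indicator \<D> y + Lphi * \<bar>cut u y\<bar>"
      using Lphi_nonneg by (auto simp: indicator_def)
    then have "indicator \<D> y * phi (cut u y) * Gam sg nu x y \<le> (phi 0 * indicator \<D> y + Lphi * \<bar>cut u y\<bar>) * K_max"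
      using Gam_le[of sg nu x y] Gam_nonneg[of sg nu x y] phi_nonneg Lphi_nonneg
      by (intro mult_mono) (auto simp: K_max_def)
    moreover have "0 \<le> indicator \<D> y * phi (cut u y) * Gam sg nu x y"
      by (intro mult_nonneg_nonneg Gam_nonneg phi_nonneg) simp
    ultimately show "norm (indicator \<D> y * phi (cut u y) * Gam sg nu x y)
      \<le> norm ((phi 0 * indicator \<D> y + Lphi * \<bar>cut u y\<bar>) * K_max)" by simp
  qed
qed

lemma PhiU_nonneg: "0 \<le> PhiU nu u x"
  unfolding PhiU_cut by (intro Bochner_Integration.integral_nonneg mult_nonneg_nonneg Gam_nonneg phi_nonneg) simp

lemma PhiU_le: "u \<in> V \<Longrightarrow> PhiU mu u x \<le> PhiU eps u x"
  unfolding PhiU_cut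
  by (intro integral_mono PhiU_integrable mult_left_mono Gam_mono_radius mult_nonneg_nonneg phi_nonneg)
    (use mu_lt in auto)

definition C1 :: real where "C1 = K_max * Lphi * sqrt D_mass"

lemma C1_nonneg: "C1 \<ge> 0" using K_max_pos Lphi_nonneg D_mass_nonneg by (simp add: C1_def)

lemma PhiU_diff:
  assumes u: "u \<in> V" and v: "v \<in> V"
  shows "\<bar>PhiU nu u x - PhiU nu v x\<bar> \<le> C1 * norm (J u - J v)"
proof -
  let ?f = "\<lambda>u y. indicator \<D> y * phi (cut u y) * Gam sg nu x y"
  let ?w = "\<lambda>x. u x - v x"
  have w: "?w \<in> V" using u v by (rule Vc_diff)
  have cw: "cut ?w y = cut u y - cut v y" for y by (simp add: cut_def algebra_simps)
  have "\<bar>PhiU nu u x - PhiU nu v x\<bar> = \<bar>\<integral>y. ?f u y - ?f v y \<partial>lebesgue\<bar>"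
    unfolding PhiU_cut using PhiU_integrable[OF u] PhiU_integrable[OF v] by simp
  also have "\<dots> \<le> (\<integral>y. \<bar>?f u y - ?f v y\<bar> \<partial>lebesgue)"
    by (rule integral_abs_bound)
  also have "\<dots> \<le> (\<integral>y. (K_max * Lphi) * \<bar>cut ?w y\<bar> \<partial>lebesgue)"
  proof (intro integral_mono)
    show "integrable lebesgue (\<lambda>y. \<bar>?f u y - ?f v y\<bar>)"
      using PhiU_integrable[OF u] PhiU_integrable[OF v] by (intro integrable_abs Bochner_Integration.integrable_diff)
    show "integrable lebesgue (\<lambda>y. (K_max * Lphi) * \<bar>cut ?w y\<bar>)"
      using integral_abs_cut_le(1)[OF w] by auto
    fix y
    have "\<bar>?f u y - ?f v y\<bar> = indicator \<D> y * (\<bar>phi (cut u y) - phi (cut v y)\<bar> * Gam sg nu x y)"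
      using Gam_nonneg[of sg nu x y] by (simp add: abs_mult left_diff_distrib[symmetric] right_diff_distrib[symmetric])
    also have "\<dots> \<le> 1 * ((Lphi * \<bar>cut u y - cut v y\<bar>) * K_max)"
      using Gam_le[of sg nu x y] Gam_nonneg[of sg nu x y] Lphi_nonneg
      by (intro mult_mono phi_diff) (auto simp: K_max_def indicator_def)
    finally show "\<bar>?f u y - ?f v y\<bar> \<le> (K_max * Lphi) * \<bar>cut ?w y\<bar>" unfolding cw by (simp add: mult_ac)
  qed
  also have "\<dots> = (K_max * Lphi) * (\<integral>y. \<bar>cut ?w y\<bar> \<partial>lebesgue)" by simp
  also have "\<dots> \<le> (K_max * Lphi) * (sqrt D_mass * norm (J ?w))"
    using K_max_pos Lphi_nonneg by (intro mult_left_mono integral_abs_cut_le w) auto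
  finally show ?thesis by (simp add: C1_def J_diff[OF u v] mult_ac)
qed

definition ratio :: "('a \<Rightarrow> real) \<Rightarrow> 'a \<Rightarrow> real" where
  "ratio u x = PhiU mu u x / (PhiU eps u x + xi)"

lemma ratio_nonneg: "0 \<le> ratio u x"
  unfolding ratio_def using PhiU_nonneg xi_pos by (intro divide_nonneg_nonneg add_nonneg_nonneg) auto

lemma ratio_le_1: "u \<in> V \<Longrightarrow> ratio u x \<le> 1"
  unfolding ratio_def using PhiU_le[of u x] PhiU_nonneg[of eps u x] xi_pos by simp

lemma ratio_diff:
  assumes u: "u \<in> V" and v: "v \<in> V"
  shows "\<bar>ratio u x - ratio v x\<bar> \<le> (2 * C1 / xi) * norm (J u - J v)"
proof -
  define a where "a = PhiU mu u x"
  define b where "b = PhiU eps u x + xi"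
  define c where "c = PhiU mu v x"
  define d where "d = PhiU eps v x + xi"
  let ?n = "C1 * norm (J u - J v)"
  have bd: "b \<ge> xi" "d \<ge> xi" using PhiU_nonneg by (auto simp: b_def d_def)
  have c: "0 \<le> c" "c \<le> d" using PhiU_nonneg PhiU_le[OF v, of x] xi_pos by (auto simp: c_def d_def)
  have ac: "\<bar>a - c\<bar> \<le> ?n" and db: "\<bar>d - b\<bar> \<le> ?n"
    using PhiU_diff[OF u v] PhiU_diff[OF v u] by (auto simp: a_def b_def c_def d_def norm_minus_commute)
  have pos: "b > 0" "d > 0" using bd xi_pos by auto
  have "a / b - c / d = (a - c) / b + (c / d) * ((d - b) / b)"
    using pos by (simp add: field_simps)
  then have "\<bar>a / b - c / d\<bar> \<le> \<bar>(a - c) / b\<bar> + \<bar>(c / d) * ((d - b) / b)\<bar>"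
    by (metis abs_triangle_ineq)
  also have "\<bar>(c / d) * ((d - b) / b)\<bar> \<le> 1 * \<bar>(d - b) / b\<bar>"
    unfolding abs_mult using c pos by (intro mult_right_mono) auto
  also have "\<bar>(a - c) / b\<bar> \<le> ?n / xi"
    unfolding abs_divide using ac bd xi_pos by (intro frac_le) auto
  also have "\<bar>(d - b) / b\<bar> \<le> ?n / xi"
    unfolding abs_divide using db bd xi_pos by (intro frac_le) auto
  finally show ?thesis unfolding ratio_def a_def b_def c_def d_def by (simp add: field_simps)
qed

definition PopU :: "('a \<Rightarrow> real) \<Rightarrow> 'a \<Rightarrow> real \<Rightarrow> real" where
  "PopU u x s = A0 x * exp (ratio u x * s) * p (u x)"

lemma Pop_eq: "Pop Om eps sg mu xi A0 p phi k x t = PopU (\<lambda>x. k x t) x t"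
  by (simp add: Pop_def PopU_def ratio_def PhiU_def Phi_def)

lemma exponent_bounds:
  assumes "u \<in> V" "s \<in> {0..T}"
  shows "0 \<le> ratio u x * s" "ratio u x * s \<le> T"
  using assms ratio_nonneg[of u x] ratio_le_1[OF assms(1), of x] mult_mono[of "ratio u x" 1 s T] by auto

lemma PopU_bounds:
  assumes "u \<in> V" "s \<in> {0..T}"
  shows "0 \<le> PopU u x s" "PopU u x s \<le> A0 x * (exp T * Mp)"
proof -
  show "0 \<le> PopU u x s" unfolding PopU_def by (intro mult_nonneg_nonneg A0_nonneg p_nonneg) simp
  show "PopU u x s \<le> A0 x * (exp T * Mp)"
    unfolding PopU_def mult.assoc using exponent_bounds[OF assms, of x]
    by (intro mult_left_mono mult_mono A0_nonneg p_le p_nonneg) auto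
qed

lemma AE_A0: "AE x in lebesgue. x \<in> Om \<longrightarrow> A0 x \<le> CA"
  using A0_le by (subst (asm) AE_restrict_space_iff) auto

lemma L2Om_PopU:
  assumes u: "u \<in> V" and s: "s \<in> {0..T}"
  shows "L2Om (\<lambda>x. PopU u x s)"
proof (rule L2Om_bounded)
  have [measurable]: "(\<lambda>x. indicator Om x * u x) \<in> borel_measurable lebesgue"
    using Vc_L2Om[OF u] by (simp add: sqint_def)
  note [measurable] = p_measurable PhiU_measurable[OF u]
  have [measurable]: "(\<lambda>x. indicator Om x * A0 x) \<in> borel_measurable lebesgue"
    using A0_meas by (subst (asm) borel_measurable_restrict_space_iff) auto
  have "(\<lambda>x. indicator Om x * PopU u x s) =
    (\<lambda>x. (indicator Om x * A0 x) * exp (PhiU mu u x / (PhiU eps u x + xi) * s) * p (indicator Om x * u x))"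
    by (auto simp: PopU_def ratio_def indicator_def)
  then show "(\<lambda>x. indicator Om x * PopU u x s) \<in> borel_measurable lebesgue" by simp
  show "AE x in lebesgue. x \<in> Om \<longrightarrow> \<bar>PopU u x s\<bar> \<le> CA * (exp T * Mp)"
    using AE_A0
  proof eventually_elim
    case (elim x)
    then show ?case
      using PopU_bounds[OF u s, of x] mult_right_mono[of "A0 x" CA "exp T * Mp"] Mp_nonneg
      by (auto simp del: mult_le_cancel_left_pos intro: order_trans)
  qed
qed

lemma PopU_diff:
  assumes u: "u \<in> V" and v: "v \<in> V" and s: "s \<in> {0..T}"
  shows "\<bar>PopU u x s - PopU v x s\<bar> \<le> A0 x * (exp T * T * Mp * (2 * C1 / xi) * norm (J u - J v) + exp T * Lp * \<bar>u x - v x\<bar>)"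
proof -
  let ?e = "\<lambda>u. exp (ratio u x * s)"
  have "\<bar>?e u - ?e v\<bar> \<le> exp T * \<bar>ratio u x * s - ratio v x * s\<bar>"
    by (intro exp_diff_le exponent_bounds u v s)
  also have "\<bar>ratio u x * s - ratio v x * s\<bar> = \<bar>ratio u x - ratio v x\<bar> * s"
    using s by (simp add: left_diff_distrib[symmetric] abs_mult)
  also have "\<dots> \<le> ((2 * C1 / xi) * norm (J u - J v)) * T"
    using s C1_nonneg xi_pos by (intro mult_mono ratio_diff u v) auto
  finally have 1: "\<bar>?e u - ?e v\<bar> \<le> exp T * (((2 * C1 / xi) * norm (J u - J v)) * T)" by simp
  have "?e u * p (u x) - ?e v * p (v x) = (?e u - ?e v) * p (u x) + ?e v * (p (u x) - p (v x))"
    by (simp add: algebra_simps)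
  then have "\<bar>?e u * p (u x) - ?e v * p (v x)\<bar> \<le> \<bar>?e u - ?e v\<bar> * p (u x) + ?e v * \<bar>p (u x) - p (v x)\<bar>"
    using abs_triangle_ineq[of "(?e u - ?e v) * p (u x)" "?e v * (p (u x) - p (v x))"] p_nonneg[of "u x"]
    by (simp add: abs_mult)
  also have "\<dots> \<le> (exp T * (((2 * C1 / xi) * norm (J u - J v)) * T)) * Mp + exp T * (Lp * \<bar>u x - v x\<bar>)"
    using 1 p_nonneg p_le exponent_bounds[OF v s, of x] p_diff
    by (intro add_mono mult_mono) (auto intro: order_trans[OF abs_ge_zero])
  finally have 2: "\<bar>?e u * p (u x) - ?e v * p (v x)\<bar> \<le> exp T * T * Mp * (2 * C1 / xi) * norm (J u - J v) + exp T * Lp * \<bar>u x - v x\<bar>"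
    by (simp add: mult_ac)
  have "\<bar>PopU u x s - PopU v x s\<bar> = A0 x * \<bar>?e u * p (u x) - ?e v * p (v x)\<bar>"
    unfolding PopU_def mult.assoc right_diff_distrib[symmetric] abs_mult using A0_nonneg[of x] by simp
  also have "\<dots> \<le> A0 x * (exp T * T * Mp * (2 * C1 / xi) * norm (J u - J v) + exp T * Lp * \<bar>u x - v x\<bar>)"
    by (intro mult_left_mono 2 A0_nonneg)
  finally show ?thesis .
qed

lemma PopU_time_diff:
  assumes u: "u \<in> V" and s: "s \<in> {0..T}" and r: "r \<in> {0..T}"
  shows "\<bar>PopU u x s - PopU u x r\<bar> \<le> A0 x * (exp T * Mp * \<bar>s - r\<bar>)"
proof -
  let ?e = "\<lambda>s. exp (ratio u x * s)"
  have "\<bar>?e s - ?e r\<bar> \<le> exp T * \<bar>ratio u x * s - ratio u x * r\<bar>"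
    by (intro exp_diff_le exponent_bounds u s r)
  also have "\<bar>ratio u x * s - ratio u x * r\<bar> = ratio u x * \<bar>s - r\<bar>"
    using ratio_nonneg[of u x] by (simp add: right_diff_distrib[symmetric] abs_mult)
  also have "\<dots> \<le> 1 * \<bar>s - r\<bar>" by (intro mult_right_mono ratio_le_1 u) simp
  finally have "\<bar>?e s - ?e r\<bar> \<le> exp T * \<bar>s - r\<bar>" by simp
  then have "\<bar>?e s - ?e r\<bar> * p (u x) \<le> (exp T * \<bar>s - r\<bar>) * Mp"
    by (intro mult_mono p_le p_nonneg) auto
  then have "A0 x * (\<bar>?e s - ?e r\<bar> * p (u x)) \<le> A0 x * ((exp T * \<bar>s - r\<bar>) * Mp)"
    by (intro mult_left_mono A0_nonneg)
  moreover have "\<bar>PopU u x s - PopU u x r\<bar> = A0 x * (\<bar>?e s - ?e r\<bar> * p (u x))"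
    unfolding PopU_def mult.assoc right_diff_distrib[symmetric] left_diff_distrib[symmetric] abs_mult
    using A0_nonneg[of x] p_nonneg[of "u x"] by simp
  ultimately show ?thesis by (simp add: mult_ac)
qed

definition Nop :: "real \<Rightarrow> 'a l2 \<Rightarrow> 'a l2" where "Nop s f = J (\<lambda>x. PopU (R f) x s)"

lemma proj_Nop: "s \<in> {0..T} \<Longrightarrow> proj (Nop s f) = Nop s f"
  unfolding Nop_def by (intro proj_J L2Om_PopU R_Vc)

definition LN :: real where
  "LN = CA * (exp T * T * Mp * (2 * C1 / xi)) * sqrt D_mass + CA * (exp T * Lp)"

lemma LN_nonneg: "LN \<ge> 0"
  unfolding LN_def using CA_nonneg T_pos Mp_nonneg C1_nonneg xi_pos D_mass_nonneg Lp_nonneg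
  by (intro add_nonneg_nonneg mult_nonneg_nonneg divide_nonneg_nonneg) auto

lemma J_PopU_diff:
  assumes u: "u \<in> V" and v: "v \<in> V" and s: "s \<in> {0..T}"
  shows "norm (J (\<lambda>x. PopU u x s) - J (\<lambda>x. PopU v x s)) \<le> LN * norm (J u - J v)"
proof -
  let ?n = "norm (J u - J v)"
  let ?k = "exp T * T * Mp * (2 * C1 / xi)"
  have k: "0 \<le> ?k" using T_pos Mp_nonneg C1_nonneg xi_pos by simp
  have "norm (J (\<lambda>x. PopU u x s - PopU v x s)) \<le> CA * (?k * ?n) * sqrt D_mass + CA * (exp T * Lp) * norm (J (\<lambda>x. u x - v x))"
  proof (rule norm_J_le_affine)
    show "L2Om (\<lambda>x. PopU u x s - PopU v x s)"
      using sqint_diff[OF L2Om_PopU[OF u s] L2Om_PopU[OF v s]] by (simp add: algebra_simps)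
    show "L2Om (\<lambda>x. u x - v x)" by (intro Vc_L2Om Vc_diff u v)
    show "AE x in lebesgue. x \<in> Om \<longrightarrow> \<bar>PopU u x s - PopU v x s\<bar> \<le> CA * (?k * ?n) + CA * (exp T * Lp) * \<bar>u x - v x\<bar>"
      using AE_A0
    proof eventually_elim
      case (elim x)
      show ?case
      proof
        assume "x \<in> Om"
        have "\<bar>PopU u x s - PopU v x s\<bar> \<le> A0 x * (?k * ?n + exp T * Lp * \<bar>u x - v x\<bar>)"
          by (rule PopU_diff[OF u v s])
        also have "\<dots> \<le> CA * (?k * ?n + exp T * Lp * \<bar>u x - v x\<bar>)"
          using elim \<open>x \<in> Om\<close> Lp_nonneg T_pos Mp_nonneg C1_nonneg xi_pos
          by (intro mult_right_mono add_nonneg_nonneg mult_nonneg_nonneg divide_nonneg_nonneg) auto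
        finally show "\<bar>PopU u x s - PopU v x s\<bar> \<le> CA * (?k * ?n) + CA * (exp T * Lp) * \<bar>u x - v x\<bar>"
          by (simp add: distrib_left mult.assoc)
      qed
    qed
  qed (use CA_nonneg T_pos Mp_nonneg C1_nonneg xi_pos Lp_nonneg in auto)
  then show ?thesis
    unfolding J_diff[OF u v] J_diff_L2Om[OF L2Om_PopU[OF u s] L2Om_PopU[OF v s]] LN_def
    by (simp add: algebra_simps)
qed

lemma norm_J_R_diff: "norm (J (R f) - J (R g)) \<le> norm (f - g)"
proof -
  have "J (R f) - J (R g) = proj (f - g)"
    unfolding proj_def[symmetric] using proj_lincomb[of 1 f "-1" g] by simp
  then show ?thesis using norm_proj_le by simp
qed

lemma Nop_lipschitz: "s \<in> {0..T} \<Longrightarrow> norm (Nop s f - Nop s g) \<le> LN * norm (f - g)"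
  using J_PopU_diff[OF R_Vc R_Vc, of s f g] mult_left_mono[OF norm_J_R_diff LN_nonneg, of f g]
  unfolding Nop_def by linarith

lemma J_PopU: "u \<in> V \<Longrightarrow> s \<in> {0..T} \<Longrightarrow> J (\<lambda>x. PopU u x s) = Nop s (J u)"
  using J_PopU_diff[OF _ R_Vc, of u s "J u"] unfolding Nop_def by (simp add: J_R_J Vc_L2Om)

lemma inner_PopU:
  assumes "u \<in> V" "v \<in> V" "s \<in> {0..T}"
  shows "(LINT x:Om|lebesgue. PopU u x s * v x) = Nop s (J u) \<bullet> J v"
  using inner_J[OF L2Om_PopU[OF assms(1,3)] Vc_L2Om[OF assms(2)]] J_PopU[OF assms(1,3)] by simp

lemma Nop_time:
  assumes s: "s \<in> {0..T}" and r: "r \<in> {0..T}"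
  shows "norm (Nop s f - Nop r f) \<le> CA * (exp T * Mp) * sqrt D_mass * \<bar>s - r\<bar>"
proof -
  let ?u = "R f"
  have "norm (J (\<lambda>x. PopU ?u x s - PopU ?u x r)) \<le> CA * (exp T * Mp * \<bar>s - r\<bar>) * sqrt D_mass + 0 * norm (J ?u)"
  proof (rule norm_J_le_affine)
    show "L2Om (\<lambda>x. PopU ?u x s - PopU ?u x r)"
      using sqint_diff[OF L2Om_PopU[OF R_Vc s] L2Om_PopU[OF R_Vc r]] by (simp add: algebra_simps)
    show "AE x in lebesgue. x \<in> Om \<longrightarrow> \<bar>PopU ?u x s - PopU ?u x r\<bar> \<le> CA * (exp T * Mp * \<bar>s - r\<bar>) + 0 * \<bar>?u x\<bar>"
      using AE_A0
    proof eventually_elim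
      case (elim x)
      show ?case
      proof
        assume "x \<in> Om"
        have "\<bar>PopU ?u x s - PopU ?u x r\<bar> \<le> A0 x * (exp T * Mp * \<bar>s - r\<bar>)"
          by (rule PopU_time_diff[OF R_Vc s r])
        also have "\<dots> \<le> CA * (exp T * Mp * \<bar>s - r\<bar>)"
          using elim \<open>x \<in> Om\<close> Mp_nonneg by (intro mult_right_mono) auto
        finally show "\<bar>PopU ?u x s - PopU ?u x r\<bar> \<le> CA * (exp T * Mp * \<bar>s - r\<bar>) + 0 * \<bar>?u x\<bar>" by simp
      qed
    qed
  qed (use CA_nonneg Mp_nonneg L2Om_R in auto)
  then show ?thesis
    unfolding Nop_def J_diff_L2Om[OF L2Om_PopU[OF R_Vc s] L2Om_PopU[OF R_Vc r]]
    by (simp add: mult_ac)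
qed

lemma continuous_on_Nop:
  assumes k: "continuous_on {0..T} k"
  shows "continuous_on {0..T} (\<lambda>t. Nop t (k t))"
  unfolding continuous_on_def
proof
  fix t assume t: "t \<in> {0..T}"
  let ?C = "CA * (exp T * Mp) * sqrt D_mass"
  have kt: "(k \<longlongrightarrow> k t) (at t within {0..T})" using k t by (simp add: continuous_on_def)
  have "((\<lambda>s. Nop s (k s) - Nop t (k t)) \<longlongrightarrow> 0) (at t within {0..T})"
  proof (rule Lim_null_comparison)
    show "\<forall>\<^sub>F s in at t within {0..T}. norm (Nop s (k s) - Nop t (k t)) \<le> LN * norm (k s - k t) + ?C * \<bar>s - t\<bar>"
      unfolding eventually_at_filter
    proof (intro eventuallyI impI)
      fix s assume s: "s \<in> {0..T}"
      have "norm (Nop s (k s) - Nop t (k t)) \<le> norm (Nop s (k s) - Nop s (k t)) + norm (Nop s (k t) - Nop t (k t))"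
        using norm_triangle_ineq[of "Nop s (k s) - Nop s (k t)" "Nop s (k t) - Nop t (k t)"] by simp
      then show "norm (Nop s (k s) - Nop t (k t)) \<le> LN * norm (k s - k t) + ?C * \<bar>s - t\<bar>"
        using Nop_lipschitz[OF s, of "k s" "k t"] Nop_time[OF s t, of "k t"] by linarith
    qed
    have "((\<lambda>s. LN * norm (k s - k t) + ?C * \<bar>s - t\<bar>) \<longlongrightarrow> LN * norm (k t - k t) + ?C * \<bar>t - t\<bar>) (at t within {0..T})"
      by (intro tendsto_intros kt)
    then show "((\<lambda>s. LN * norm (k s - k t) + ?C * \<bar>s - t\<bar>) \<longlongrightarrow> 0) (at t within {0..T})" by simp
  qed
  then show "((\<lambda>t. Nop t (k t)) \<longlongrightarrow> Nop t (k t)) (at t within {0..T})" by (simp add: LIM_zero_iff)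
qed

end

section \<open>The integral equation and the source term\<close>

lemma Picard_integral_equation:
  fixes F :: "real \<Rightarrow> 'h::banach \<Rightarrow> 'h"
  assumes T: "T \<ge> 0" and L: "L \<ge> 0"
    and lip: "\<And>s x y. s \<in> {0..T} \<Longrightarrow> norm (F s x - F s y) \<le> L * norm (x - y)"
    and cont: "\<And>k. continuous_on {0..T} k \<Longrightarrow> continuous_on {0..T} (\<lambda>s. F s (k s))"
    and c0: "continuous_on {0..T} c0"
  shows "\<exists>k. continuous_on {0..T} k \<and> (\<forall>t\<in>{0..T}. k t = c0 t + integral {0..t} (\<lambda>s. F s (k s)))"
proof -
  define l where "l = 2 * L + 1"
  have l: "l > 0" "L / l \<le> 1 / 2" using L by (auto simp: l_def field_simps)
  define cl where "cl t = max 0 (min T t)" for t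
  have cl: "cl t \<in> {0..T}" for t using T by (auto simp: cl_def)
  have cl_id: "cl t = t" if "t \<in> {0..T}" for t using that by (auto simp: cl_def)
  have cont_cl: "continuous_on UNIV cl" unfolding cl_def by (intro continuous_intros)
  define G where "G u s = F s (exp (l * s) *\<^sub>R apply_bcontfun u s)" for u s
  have cG: "continuous_on {0..T} (G u)" for u
    unfolding G_def by (intro cont continuous_intros continuous_on_apply_bcontfun)
  define g where "g u t = exp (- (l * t)) *\<^sub>R (c0 t + integral {0..t} (G u))" for u t
  have cg: "continuous_on {0..T} (g u)" for u
    unfolding g_def
    by (intro continuous_intros c0 indefinite_integral_continuous_1 integrable_continuous_real cG)
  have bc: "(\<lambda>t. g u (cl t)) \<in> bcontfun" for u
  proof -
    have "continuous_on UNIV (\<lambda>t. g u (cl t))"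
      by (rule continuous_on_compose2[OF cg cont_cl]) (use cl in auto)
    moreover have "bounded (g u ` {0..T})"
      by (intro compact_imp_bounded compact_continuous_image cg) simp
    then have "bounded (range (\<lambda>t. g u (cl t)))"
      by (rule bounded_subset) (use cl in auto)
    ultimately show ?thesis by (simp add: bcontfun_def)
  qed
  define \<Psi> where "\<Psi> u = Bcontfun (\<lambda>t. g u (cl t))" for u
  have \<Psi>: "apply_bcontfun (\<Psi> u) t = g u (cl t)" for u t
    unfolding \<Psi>_def by (simp add: Bcontfun_inverse[OF bc])
  have contr: "dist (\<Psi> u) (\<Psi> v) \<le> 1/2 * dist u v" for u v
  proof (rule dist_bound)
    fix t0
    define t where "t = cl t0"
    have t: "t \<in> {0..T}" unfolding t_def by (rule cl)
    have i: "G u integrable_on {0..t}" for u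
      by (intro integrable_continuous_real continuous_on_subset[OF cG]) (use t in auto)
    have I: "((\<lambda>s. (L * dist u v) * exp (l * s)) has_integral
        ((L * dist u v) * exp (l * t) / l - (L * dist u v) * exp (l * 0) / l)) {0..t}"
      by (rule fundamental_theorem_of_calculus)
        (use t l in \<open>auto intro!: derivative_eq_intros simp flip: has_real_derivative_iff_has_vector_derivative\<close>)
    have "norm (integral {0..t} (\<lambda>s. G u s - G v s)) \<le> integral {0..t} (\<lambda>s. (L * dist u v) * exp (l * s))"
    proof (rule integral_norm_bound_integral)
      show "(\<lambda>s. G u s - G v s) integrable_on {0..t}" by (intro integrable_diff i)
      show "(\<lambda>s. (L * dist u v) * exp (l * s)) integrable_on {0..t}" using I by blast
      fix s assume s: "s \<in> {0..t}"
      then have "norm (G u s - G v s) \<le> L * norm (exp (l * s) *\<^sub>R apply_bcontfun u s - exp (l * s) *\<^sub>R apply_bcontfun v s)"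
        unfolding G_def using t by (intro lip) auto
      also have "\<dots> = L * exp (l * s) * dist (apply_bcontfun u s) (apply_bcontfun v s)"
        by (simp add: dist_norm flip: scaleR_diff_right)
      also have "\<dots> \<le> L * exp (l * s) * dist u v"
        using L by (intro mult_left_mono dist_bounded) auto
      finally show "norm (G u s - G v s) \<le> (L * dist u v) * exp (l * s)" by (simp add: mult_ac)
    qed
    also have "\<dots> = (L * dist u v) * exp (l * t) / l - (L * dist u v) * exp (l * 0) / l"
      using I by (rule integral_unique)
    also have "\<dots> \<le> (L * dist u v) * exp (l * t) / l" using L l by simp
    also have "\<dots> = (L / l) * (dist u v * exp (l * t))" by simp
    also have "\<dots> \<le> (1/2) * (dist u v * exp (l * t))" using l by (intro mult_right_mono) auto
    finally have b: "norm (integral {0..t} (\<lambda>s. G u s - G v s)) \<le> (1/2) * (dist u v * exp (l * t))" .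
    have "g u t - g v t = exp (- (l * t)) *\<^sub>R integral {0..t} (\<lambda>s. G u s - G v s)"
      unfolding g_def integral_diff[OF i i] by (simp add: algebra_simps)
    then have "norm (g u t - g v t) = exp (- (l * t)) * norm (integral {0..t} (\<lambda>s. G u s - G v s))" by simp
    also have "\<dots> \<le> exp (- (l * t)) * ((1/2) * (dist u v * exp (l * t)))"
      by (intro mult_left_mono b) simp
    also have "\<dots> = 1/2 * dist u v" by (simp add: exp_minus)
    finally show "dist (apply_bcontfun (\<Psi> u) t0) (apply_bcontfun (\<Psi> v) t0) \<le> 1/2 * dist u v"
      unfolding \<Psi> t_def[symmetric] by (simp add: dist_norm)
  qed
  have "\<exists>!u. \<Psi> u = u"
    by (rule banach_fix_type[of "1/2"]) (use contr in auto)
  then obtain u where u: "\<Psi> u = u" by blast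
  define k where "k t = exp (l * t) *\<^sub>R apply_bcontfun u t" for t
  have "continuous_on {0..T} k"
    unfolding k_def by (intro continuous_intros continuous_on_apply_bcontfun)
  moreover have "k t = c0 t + integral {0..t} (\<lambda>s. F s (k s))" if t: "t \<in> {0..T}" for t
  proof -
    have "apply_bcontfun u t = g u t" using \<Psi>[of u t] u cl_id[OF t] by simp
    then have "k t = c0 t + integral {0..t} (G u)"
      unfolding k_def g_def by (simp flip: exp_add)
    then show ?thesis unfolding G_def k_def .
  qed
  ultimately show ?thesis by blast
qed

lemma borel_measurable_lebesgue_on_AE:
  fixes f g :: "'b::euclidean_space \<Rightarrow> real"
  assumes S: "S \<in> sets lebesgue" and f: "f \<in> borel_measurable (lebesgue_on S)"
    and ae: "AE x in lebesgue_on S. f x = g x"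
  shows "g \<in> borel_measurable (lebesgue_on S)"
proof -
  have "(\<lambda>x. indicator S x *\<^sub>R f x) \<in> borel_measurable lebesgue"
    using f S by (subst (asm) borel_measurable_restrict_space_iff) auto
  moreover have "AE x in lebesgue. x \<in> S \<longrightarrow> f x = g x"
    using ae S by (subst (asm) AE_restrict_space_iff) auto
  then have "AE x in lebesgue. indicator S x *\<^sub>R f x = indicator S x *\<^sub>R g x"
    by eventually_elim (auto simp: indicator_def)
  ultimately have "(\<lambda>x. indicator S x *\<^sub>R g x) \<in> borel_measurable lebesgue"
    by (rule borel_measurable_AE)
  then show ?thesis using S by (subst borel_measurable_restrict_space_iff) auto
qed

lemma set_lebesgue_integral_restrict:
  fixes f :: "'b::euclidean_space \<Rightarrow> real"
  assumes "S \<in> sets lebesgue"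
  shows "(LINT t:S|lebesgue. f t) = (\<integral>t. f t \<partial>lebesgue_on S)"
    "set_integrable lebesgue S f \<longleftrightarrow> integrable (lebesgue_on S) f"
  using assms
  by (simp_all add: set_lebesgue_integral_def integral_restrict_space set_integrable_def integrable_restrict_space)

lemma continuous_lebesgue_on_integrable:
  fixes f :: "real \<Rightarrow> real"
  assumes "continuous_on {a..b} f"
  shows "integrable (lebesgue_on {a..b}) f"
  using set_lebesgue_integral_continuous(1)[OF assms] by (simp add: set_lebesgue_integral_restrict(2))

context nonlocal_domain
begin

definition Aop :: "'a l2 \<Rightarrow> 'a l2" where "Aop f = (SOME a. \<forall>g. a \<bullet> g = bf f g)"

lemma inner_Aop: "Aop f \<bullet> g = bf f g"
proof -
  have "\<exists>a. \<forall>g. a \<bullet> g = bf f g"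
    by (rule Riesz_representation[OF bounded_bilinear.bounded_linear_right[OF bounded_bilinear_bf]])
  from someI_ex[OF this] show ?thesis unfolding Aop_def by blast
qed

lemma bounded_linear_Aop: "bounded_linear Aop"
proof -
  interpret bounded_bilinear bf by (rule bounded_bilinear_bf)
  obtain K where K0: "K \<ge> 0" and K: "\<And>f g. norm (bf f g) \<le> norm f * norm g * K"
    using nonneg_bounded by blast
  show ?thesis
  proof (rule bounded_linear_intro[where K = K])
    have "Aop (x + y) \<bullet> g = (Aop x + Aop y) \<bullet> g" for x y g
      by (simp add: inner_Aop add_left inner_add_left)
    then show "Aop (x + y) = Aop x + Aop y" for x y using vector_eq_rdot by blast
    have "Aop (r *\<^sub>R x) \<bullet> g = (r *\<^sub>R Aop x) \<bullet> g" for r x g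
      by (simp add: inner_Aop scaleR_left)
    then show "Aop (r *\<^sub>R x) = r *\<^sub>R Aop x" for r x using vector_eq_rdot by blast
    fix x
    have "norm (Aop x) * norm (Aop x) = bf x (Aop x)"
      using inner_Aop[of x "Aop x"] by (simp add: power2_norm_eq_inner flip: power2_eq_square)
    also have "\<dots> \<le> (norm x * K) * norm (Aop x)" using K[of x "Aop x"] by (simp add: mult_ac)
    finally have "norm (Aop x) \<le> norm x * K \<or> Aop x = 0"
      using mult_right_le_imp_le[of "norm (Aop x)" "norm (Aop x)" "norm x * K"] by auto
    moreover have "0 \<le> norm x * K" using K0 by simp
    ultimately show "norm (Aop x) \<le> norm x * K" by auto
  qed
qed

lemma proj_Aop: "proj (Aop f) = Aop f"
proof -
  have "proj (Aop f) \<bullet> g = Aop f \<bullet> g" for g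
    unfolding proj_selfadjoint inner_Aop by (metis bf_proj bf_sym)
  then show ?thesis using vector_eq_rdot by blast
qed

lemma abil_eq:
  assumes "u \<in> V" "v \<in> V"
  shows "abil Om eps sg delta u v = bf (J u) (J v) + delta * (J u \<bullet> J v)"
  unfolding abil_def using assms by (simp add: vc_inner_bf inner_J[symmetric] Vc_L2Om)

lemma C_Vc_continuous:
  assumes "C_Vc Om eps sg T k"
  shows "continuous_on {0..T} (\<lambda>t. J (\<lambda>x. k x t))"
  unfolding continuous_on_iff
proof (intro ballI allI impI)
  fix t e :: real assume t: "t \<in> {0..T}" and e: "e > 0"
  have "e / Cp > 0" using e Cp_pos by simp
  then obtain d where d: "d > 0" "\<And>s. s \<in> {0..T} \<Longrightarrow> \<bar>s - t\<bar> < d \<Longrightarrow> tnorm Om eps sg (\<lambda>x. k x s - k x t) < e / Cp"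
    using assms t unfolding C_Vc_def by meson
  have V: "(\<lambda>x. k x s) \<in> V" if "s \<in> {0..T}" for s using assms that by (simp add: C_Vc_def)
  show "\<exists>d>0. \<forall>s\<in>{0..T}. dist s t < d \<longrightarrow> dist (J (\<lambda>x. k x s)) (J (\<lambda>x. k x t)) < e"
  proof (intro exI[of _ d] conjI ballI impI d(1))
    fix s assume s: "s \<in> {0..T}" "dist s t < d"
    have "norm (J (\<lambda>x. k x s - k x t)) \<le> Cp * tnorm Om eps sg (\<lambda>x. k x s - k x t)"
      by (intro Poincare Vc_diff V s t)
    also have "\<dots> < e"
      using d(2)[OF s(1)] s(2) Cp_pos by (simp add: dist_real_def field_simps)
    finally show "dist (J (\<lambda>x. k x s)) (J (\<lambda>x. k x t)) < e"
      by (simp add: J_diff[OF V[OF s(1)] V[OF t]] dist_norm)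
  qed
qed

lemma continuous_C_Vc:
  assumes V: "\<And>t. t \<in> {0..T} \<Longrightarrow> (\<lambda>x. k x t) \<in> V" and c: "continuous_on {0..T} (\<lambda>t. J (\<lambda>x. k x t))"
  shows "C_Vc Om eps sg T k"
  unfolding C_Vc_def
proof (intro conjI ballI allI impI V)
  fix t e :: real assume t: "t \<in> {0..T}" and e: "e > 0"
  have Cb1: "Cb + 1 > 0" using Cb_nonneg by simp
  then have "e / (Cb + 1) > 0" using e by simp
  then obtain d where d: "d > 0" "\<And>s. s \<in> {0..T} \<Longrightarrow> dist s t < d \<Longrightarrow> dist (J (\<lambda>x. k x s)) (J (\<lambda>x. k x t)) < e / (Cb + 1)"
    using c t unfolding continuous_on_iff by meson
  show "\<exists>d>0. \<forall>s\<in>{0..T}. \<bar>s - t\<bar> < d \<longrightarrow> tnorm Om eps sg (\<lambda>x. k x s - k x t) < e"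
  proof (intro exI[of _ d] conjI ballI impI d(1))
    fix s assume s: "s \<in> {0..T}" "\<bar>s - t\<bar> < d"
    have n: "norm (J (\<lambda>x. k x s) - J (\<lambda>x. k x t)) < e / (Cb + 1)"
      using d(2)[OF s(1)] s(2) by (simp add: dist_real_def dist_norm)
    have "tnorm Om eps sg (\<lambda>x. k x s - k x t) \<le> Cb * norm (J (\<lambda>x. k x s - k x t))"
      by (intro tnorm_le Vc_diff V s t)
    also have "\<dots> \<le> (Cb + 1) * norm (J (\<lambda>x. k x s) - J (\<lambda>x. k x t))"
      unfolding J_diff[OF V[OF s(1)] V[OF t]] by (intro mult_right_mono) auto
    also have "\<dots> < e" using n Cb1 by (simp add: field_simps)
    finally show "tnorm Om eps sg (\<lambda>x. k x s - k x t) < e" .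
  qed
qed

definition dual_vec :: "(('a \<Rightarrow> real) \<Rightarrow> real) \<Rightarrow> 'a l2" where
  "dual_vec l = (if Vc_dual Om eps sg l then SOME z. proj z = z \<and> (\<forall>v\<in>V. l v = z \<bullet> J v) else 0)"

lemma dual_vec:
  assumes "Vc_dual Om eps sg l"
  shows "v \<in> V \<Longrightarrow> l v = dual_vec l \<bullet> J v"
  using someI_ex[OF Vc_dual_representation[OF assms]] assms unfolding dual_vec_def by simp

lemma proj_dual_vec: "proj (dual_vec l) = dual_vec l"
proof (cases "Vc_dual Om eps sg l")
  case True
  then show ?thesis
    using someI_ex[OF Vc_dual_representation[OF True]] unfolding dual_vec_def if_P[OF True] by blast
next
  case False
  then show ?thesis using linear_0[OF bounded_linear.linear[OF bounded_linear_proj]] by (simp add: dual_vec_def)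
qed

lemma norm_dual_vec: "norm (dual_vec l) \<le> Cb * \<bar>dual_norm Om eps sg l\<bar>"
proof (cases "Vc_dual Om eps sg l")
  case True
  have "norm (dual_vec l) \<le> Cb * dual_norm Om eps sg l"
    by (rule norm_le_dual_norm) (auto simp: dual_vec[OF True] proj_dual_vec)
  also have "\<dots> \<le> Cb * \<bar>dual_norm Om eps sg l\<bar>" using Cb_nonneg by (intro mult_left_mono) auto
  finally show ?thesis .
next
  case False
  then show ?thesis using Cb_nonneg by (simp add: dual_vec_def)
qed

end

locale nonlocal_source = nonlocal_domain Om eps sg
  for Om :: "'a::euclidean_space set" and eps sg :: real +
  fixes T :: real and c :: "real \<Rightarrow> ('a \<Rightarrow> real) \<Rightarrow> real"
  assumes T_pos': "T > 0" and c_dual: "L2_dual Om eps sg T c"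
begin

abbreviation (input) "MT \<equiv> lebesgue_on {0..T}"

definition q :: "real \<Rightarrow> 'a l2" where "q t = dual_vec (c t)"

lemma c_eq_q: "AE t in MT. \<forall>v\<in>V. c t v = q t \<bullet> J v"
proof -
  have "AE t in MT. Vc_dual Om eps sg (c t)" using c_dual by (simp add: L2_dual_def)
  then show ?thesis unfolding q_def by eventually_elim (simp add: dual_vec)
qed

lemma proj_q: "proj (q t) = q t" by (simp add: q_def proj_dual_vec)

lemma q_measurable: "(\<lambda>t. q t \<bullet> f) \<in> borel_measurable MT"
proof (rule borel_measurable_lebesgue_on_AE)
  show "(\<lambda>t. c t (R f)) \<in> borel_measurable MT" using c_dual R_Vc by (simp add: L2_dual_def)
  show "AE t in MT. c t (R f) = q t \<bullet> f"
    using c_eq_q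
  proof eventually_elim
    case (elim t)
    then have "c t (R f) = q t \<bullet> proj f" using R_Vc by (simp add: proj_def)
    then show ?case using proj_selfadjoint[of "q t" f] proj_q by simp
  qed
qed simp

definition qb :: "real \<Rightarrow> real" where "qb t = Cb * \<bar>dual_norm Om eps sg (c t)\<bar>"

lemma norm_q_le: "norm (q t) \<le> qb t" by (simp add: q_def qb_def norm_dual_vec)

lemma qb_nonneg: "0 \<le> qb t" using Cb_nonneg by (simp add: qb_def)

lemma qb_sq_integrable: "integrable MT (\<lambda>t. (qb t)\<^sup>2)"
  using c_dual by (simp add: qb_def power_mult_distrib L2_dual_def)

lemma qb_measurable: "qb \<in> borel_measurable MT"
proof -
  have "(\<lambda>t. sqrt ((qb t)\<^sup>2)) \<in> borel_measurable MT" using qb_sq_integrable by measurable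
  then show ?thesis using qb_nonneg by simp
qed

lemma finite_measure_MT: "finite_measure MT"
  by (rule finite_measure_lebesgue_on) auto

lemma qb_integrable: "integrable MT qb"
proof (rule Bochner_Integration.integrable_bound)
  show "integrable MT (\<lambda>t. 1 + (qb t)\<^sup>2)"
    using qb_sq_integrable finite_measure.integrable_const[OF finite_measure_MT] by simp
  show "AE t in MT. norm (qb t) \<le> norm (1 + (qb t)\<^sup>2)"
  proof (intro AE_I2)
    fix t
    have "2 * qb t \<le> 1 + (qb t)\<^sup>2" using zero_le_power2[of "qb t - 1"] by (simp add: power2_eq_square algebra_simps)
    then show "norm (qb t) \<le> norm (1 + (qb t)\<^sup>2)" using qb_nonneg[of t] by simp
  qed
qed (rule qb_measurable)

lemma inner_q_continuous_integrable:
  assumes y: "continuous_on {0..T} y"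
  shows "integrable MT (\<lambda>t. q t \<bullet> y t)"
proof -
  have "bounded (y ` {0..T})" by (intro compact_imp_bounded compact_continuous_image y) simp
  then obtain B where B: "\<And>t. t \<in> {0..T} \<Longrightarrow> norm (y t) \<le> B" unfolding bounded_iff by blast
  show ?thesis
  proof (rule Bochner_Integration.integrable_bound)
    show "integrable MT (\<lambda>t. qb t * B)" using qb_integrable by simp
    show "(\<lambda>t. q t \<bullet> y t) \<in> borel_measurable MT"
      by (rule measurable_inner_continuous[OF _ q_measurable y]) (use T_pos' in simp)
    show "AE t in MT. norm (q t \<bullet> y t) \<le> norm (qb t * B)"
    proof (intro AE_I2)
      fix t assume "t \<in> space MT"
      then have t: "t \<in> {0..T}" by simp
      have "\<bar>q t \<bullet> y t\<bar> \<le> norm (q t) * norm (y t)" by (rule Cauchy_Schwarz_ineq2)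
      also have "\<dots> \<le> qb t * B" by (intro mult_mono norm_q_le B t qb_nonneg) simp
      finally show "norm (q t \<bullet> y t) \<le> norm (qb t * B)" by simp
    qed
  qed
qed

lemma q_int:
  assumes t: "t \<in> {0..T}"
  shows "set_integrable lebesgue {0..t} (\<lambda>s. q s \<bullet> f)" "(LINT s:{0..t}|lebesgue. q s \<bullet> f) = integral {0..t} (\<lambda>s. q s \<bullet> f)"
    "(\<lambda>s. q s \<bullet> f) integrable_on {0..t}"
proof -
  have "set_integrable lebesgue {0..T} (\<lambda>s. q s \<bullet> f)"
    using inner_q_continuous_integrable[of "\<lambda>_. f"] by (simp add: set_lebesgue_integral_restrict(2))
  then show 1: "set_integrable lebesgue {0..t} (\<lambda>s. q s \<bullet> f)"
    by (rule set_integrable_subset) (use t in auto)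
  show "(LINT s:{0..t}|lebesgue. q s \<bullet> f) = integral {0..t} (\<lambda>s. q s \<bullet> f)"
    "(\<lambda>s. q s \<bullet> f) integrable_on {0..t}"
    using set_lebesgue_integral_eq_integral[OF 1] by auto
qed

lemma qb_int: "t \<in> {0..T} \<Longrightarrow> qb integrable_on {0..t}"
proof -
  assume t: "t \<in> {0..T}"
  have "set_integrable lebesgue {0..T} qb" using qb_integrable by (simp add: set_lebesgue_integral_restrict(2))
  then have "set_integrable lebesgue {0..t} qb" by (rule set_integrable_subset) (use t in auto)
  then show ?thesis by (rule set_lebesgue_integral_eq_integral)
qed

lemma integral_q_le:
  assumes "0 \<le> s" "s \<le> t" "t \<le> T"
  shows "\<bar>integral {s..t} (\<lambda>r. q r \<bullet> f)\<bar> \<le> integral {s..t} qb * norm f"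
proof -
  have i: "(\<lambda>r. q r \<bullet> f) integrable_on {s..t}" "qb integrable_on {s..t}"
    using integrable_on_subinterval[OF q_int(3)[of t f], of s t] integrable_on_subinterval[OF qb_int[of t], of s t] assms
    by auto
  have "norm (integral {s..t} (\<lambda>r. q r \<bullet> f)) \<le> integral {s..t} (\<lambda>r. qb r * norm f)"
  proof (rule integral_norm_bound_integral[OF i(1)])
    show "(\<lambda>r. qb r * norm f) integrable_on {s..t}" using i(2) by (rule integrable_on_mult_left)
    fix r
    have "\<bar>q r \<bullet> f\<bar> \<le> norm (q r) * norm f" by (rule Cauchy_Schwarz_ineq2)
    also have "\<dots> \<le> qb r * norm f" by (intro mult_right_mono norm_q_le) simp
    finally show "norm (q r \<bullet> f) \<le> qb r * norm f" by simp
  qed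
  then show ?thesis by simp
qed

text \<open>The Pettis integral of the representatives of the source; it exists by the Riesz theorem, so
  no strong measurability in time is needed.\<close>

definition Q :: "real \<Rightarrow> 'a l2" where "Q t = (SOME z. \<forall>f. z \<bullet> f = integral {0..t} (\<lambda>s. q s \<bullet> f))"

lemma inner_Q:
  assumes t: "t \<in> {0..T}"
  shows "Q t \<bullet> f = integral {0..t} (\<lambda>s. q s \<bullet> f)"
proof -
  have "bounded_linear (\<lambda>f. integral {0..t} (\<lambda>s. q s \<bullet> f))"
  proof (rule bounded_linear_intro[where K = "integral {0..t} qb"])
    show "integral {0..t} (\<lambda>s. q s \<bullet> (x + y)) = integral {0..t} (\<lambda>s. q s \<bullet> x) + integral {0..t} (\<lambda>s. q s \<bullet> y)" for x y
      unfolding inner_add_right by (intro integral_add q_int t)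
    show "integral {0..t} (\<lambda>s. q s \<bullet> (r *\<^sub>R x)) = r *\<^sub>R integral {0..t} (\<lambda>s. q s \<bullet> x)" for r x
      by simp
    show "norm (integral {0..t} (\<lambda>s. q s \<bullet> x)) \<le> norm x * integral {0..t} qb" for x
      using integral_q_le[of 0 t x] t by (simp add: mult.commute)
  qed
  from someI_ex[OF Riesz_representation[OF this]] show ?thesis unfolding Q_def by blast
qed

lemma Q_0: "Q 0 = 0"
proof -
  have "Q 0 \<bullet> f = 0 \<bullet> f" for f using inner_Q[of 0 f] T_pos' by simp
  then show ?thesis using vector_eq_rdot by blast
qed

lemma proj_Q: "t \<in> {0..T} \<Longrightarrow> proj (Q t) = Q t"
proof -
  assume t: "t \<in> {0..T}"
  have "proj (Q t) \<bullet> f = Q t \<bullet> f" for f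
    unfolding proj_selfadjoint[of "Q t"] inner_Q[OF t] using proj_selfadjoint[of "q _" f] by (simp add: proj_q)
  then show ?thesis using vector_eq_rdot by blast
qed

lemma continuous_on_Q: "continuous_on {0..T} Q"
proof -
  define M where "M t = integral {0..t} qb" for t
  have cM: "continuous_on {0..T} M"
    unfolding M_def by (intro indefinite_integral_continuous_1 qb_int) (use T_pos' in simp)
  have le: "norm (Q t - Q s) \<le> M t - M s" if st: "0 \<le> s" "s \<le> t" "t \<le> T" for s t
  proof -
    have e: "Q t \<bullet> f - Q s \<bullet> f = integral {s..t} (\<lambda>r. q r \<bullet> f)" for f
      using Henstock_Kurzweil_Integration.integral_combine[OF st(1,2) q_int(3)[of t f]] st inner_Q[of t f] inner_Q[of s f] by simp
    have m: "M t - M s = integral {s..t} qb"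
      using Henstock_Kurzweil_Integration.integral_combine[OF st(1,2) qb_int[of t]] st by (simp add: M_def)
    have nn: "0 \<le> M t - M s"
      unfolding m by (intro Henstock_Kurzweil_Integration.integral_nonneg qb_nonneg)
        (use integrable_on_subinterval[OF qb_int[of t], of s t] st in auto)
    have "(norm (Q t - Q s))\<^sup>2 = Q t \<bullet> (Q t - Q s) - Q s \<bullet> (Q t - Q s)"
      unfolding power2_norm_eq_inner by (simp add: inner_diff_left)
    also have "\<dots> \<le> (M t - M s) * norm (Q t - Q s)"
      unfolding e m using integral_q_le[OF st] abs_le_D1 by blast
    finally have "norm (Q t - Q s) * norm (Q t - Q s) \<le> (M t - M s) * norm (Q t - Q s)"
      by (simp add: power2_eq_square)
    then show ?thesis using nn by (cases "Q t = Q s") auto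
  qed
  have le': "norm (Q s - Q t) \<le> \<bar>M s - M t\<bar>" if "s \<in> {0..T}" "t \<in> {0..T}" for s t
    using le[of s t] le[of t s] that by (cases "s \<le> t") (auto simp: norm_minus_commute)
  show ?thesis
    unfolding continuous_on_def
  proof
    fix t assume t: "t \<in> {0..T}"
    have "((\<lambda>s. Q s - Q t) \<longlongrightarrow> 0) (at t within {0..T})"
    proof (rule Lim_null_comparison)
      show "\<forall>\<^sub>F s in at t within {0..T}. norm (Q s - Q t) \<le> \<bar>M s - M t\<bar>"
        unfolding eventually_at_filter using le' t by (intro eventuallyI) auto
      have "(M \<longlongrightarrow> M t) (at t within {0..T})" using cM t by (simp add: continuous_on_def)
      then have "((\<lambda>s. \<bar>M s - M t\<bar>) \<longlongrightarrow> \<bar>M t - M t\<bar>) (at t within {0..T})" by (intro tendsto_intros)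
      then show "((\<lambda>s. \<bar>M s - M t\<bar>) \<longlongrightarrow> 0) (at t within {0..T})" by simp
    qed
    then show "(Q \<longlongrightarrow> Q t) (at t within {0..T})" by (simp add: LIM_zero_iff)
  qed
qed

end

section \<open>Existence and uniqueness\<close>

locale nonlocal_problem =
  nonlocal_growth Om eps sg mu xi T Mp Lp Lphi CA p phi A0 + nonlocal_source Om eps sg T c
  for Om :: "'a::euclidean_space set" and eps sg mu xi T Mp Lp Lphi CA :: real
    and p phi :: "real \<Rightarrow> real" and A0 :: "'a \<Rightarrow> real" and c :: "real \<Rightarrow> ('a \<Rightarrow> real) \<Rightarrow> real" +
  fixes delta :: real and k0 :: "'a \<Rightarrow> real"
  assumes k0_Vc: "(\<lambda>x. if x \<in> Om then k0 x else 0) \<in> Vc Om eps sg"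
begin

definition F :: "real \<Rightarrow> 'a l2 \<Rightarrow> 'a l2" where
  "F s f = Nop s f - Aop f - delta *\<^sub>R proj f"

lemma F_lipschitz_ex: "\<exists>L\<ge>0. \<forall>s\<in>{0..T}. \<forall>f g. norm (F s f - F s g) \<le> L * norm (f - g)"
proof -
  interpret A: bounded_linear Aop by (rule bounded_linear_Aop)
  interpret P: bounded_linear proj by (rule bounded_linear_proj)
  obtain K where K: "K \<ge> 0" "\<And>f. norm (Aop f) \<le> norm f * K" using A.nonneg_bounded by blast
  have "norm (F s f - F s g) \<le> (LN + K + \<bar>delta\<bar>) * norm (f - g)" if s: "s \<in> {0..T}" for s f g
  proof -
    have e: "F s f - F s g = (Nop s f - Nop s g) - Aop (f - g) - delta *\<^sub>R proj (f - g)"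
      by (simp add: F_def A.diff P.diff algebra_simps)
    have "norm (F s f - F s g) \<le> norm (Nop s f - Nop s g) + norm (Aop (f - g)) + norm (delta *\<^sub>R proj (f - g))"
      unfolding e using norm_triangle_ineq4[of "(Nop s f - Nop s g) - Aop (f - g)" "delta *\<^sub>R proj (f - g)"]
        norm_triangle_ineq4[of "Nop s f - Nop s g" "Aop (f - g)"] by linarith
    also have "\<dots> \<le> LN * norm (f - g) + norm (f - g) * K + \<bar>delta\<bar> * norm (f - g)"
      using Nop_lipschitz[OF s, of f g] K(2)[of "f - g"] mult_left_mono[OF norm_proj_le[of "f - g"], of "\<bar>delta\<bar>"]
      by simp
    finally show ?thesis by (simp add: algebra_simps)
  qed
  then show ?thesis using LN_nonneg K(1) by (intro exI[of _ "LN + K + \<bar>delta\<bar>"]) auto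
qed

lemma continuous_on_F:
  assumes "continuous_on {0..T} k"
  shows "continuous_on {0..T} (\<lambda>t. F t (k t))"
  unfolding F_def
  by (intro continuous_intros continuous_on_Nop bounded_linear.continuous_on[OF bounded_linear_Aop]
      bounded_linear.continuous_on[OF bounded_linear_proj] assms)

lemma proj_F: "s \<in> {0..T} \<Longrightarrow> proj (F s f) = F s f"
proof -
  interpret P: bounded_linear proj by (rule bounded_linear_proj)
  show "s \<in> {0..T} \<Longrightarrow> proj (F s f) = F s f"
    by (simp add: F_def P.diff P.scaleR proj_Nop proj_Aop proj_proj)
qed

lemma inner_F: "F s f \<bullet> y = Nop s f \<bullet> y - bf f y - delta * (proj f \<bullet> y)"
  by (simp add: F_def inner_diff_left inner_Aop)

abbreviation (input) "kz \<equiv> \<lambda>x. if x \<in> Om then k0 x else 0"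

abbreviation "solves k \<equiv> weak_solution Om eps sg mu xi delta T A0 p phi c k0 k"

lemma T_ge_0: "T \<ge> 0" using T_pos by simp

lemma existence: "\<exists>k. solves k"
proof -
  obtain L where L: "L \<ge> 0" "\<And>s f g. s \<in> {0..T} \<Longrightarrow> norm (F s f - F s g) \<le> L * norm (f - g)"
    using F_lipschitz_ex by blast
  have "continuous_on {0..T} (\<lambda>t. J kz - Q t)" by (intro continuous_intros continuous_on_Q)
  from Picard_integral_equation[OF T_ge_0 L continuous_on_F this]
  obtain k where k: "continuous_on {0..T} k"
    and keq: "\<And>t. t \<in> {0..T} \<Longrightarrow> k t = (J kz - Q t) + integral {0..t} (\<lambda>s. F s (k s))"
    by blast
  have cF: "continuous_on {0..T} (\<lambda>s. F s (k s))" by (rule continuous_on_F[OF k])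
  have Fint: "(\<lambda>s. F s (k s)) integrable_on {0..t}" if "t \<in> {0..T}" for t
    by (intro integrable_continuous_real continuous_on_subset[OF cF]) (use that in auto)
  have proj_k: "proj (k t) = k t" if t: "t \<in> {0..T}" for t
  proof -
    interpret P: bounded_linear proj by (rule bounded_linear_proj)
    have "proj (integral {0..t} (\<lambda>s. F s (k s))) = integral {0..t} (\<lambda>s. proj (F s (k s)))"
      using integral_linear[OF Fint[OF t] bounded_linear_proj] by (simp add: o_def)
    also have "\<dots> = integral {0..t} (\<lambda>s. F s (k s))"
      by (intro integral_cong proj_F) (use t in auto)
    finally show ?thesis
      unfolding keq[OF t] by (simp add: P.add P.diff proj_J[OF Vc_L2Om[OF k0_Vc]] proj_Q[OF t])
  qed
  have JR: "J (R (k t)) = k t" if "t \<in> {0..T}" for t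
    using proj_k[OF that] by (simp add: proj_def)
  define z where "z t = F t (k t) - q t" for t
  have proj_z: "proj (z t) = z t" if "t \<in> {0..T}" for t
    using linear_diff[OF bounded_linear.linear[OF bounded_linear_proj]] proj_F[OF that] proj_q by (simp add: z_def)
  have zint: "integrable MT (\<lambda>t. z t \<bullet> y t)" if y: "continuous_on {0..T} y" for y
    unfolding z_def inner_diff_left
    by (intro Bochner_Integration.integrable_diff inner_q_continuous_integrable y
        continuous_lebesgue_on_integrable continuous_intros cF)
  have k_inner: "k t \<bullet> f = J kz \<bullet> f + (LINT s:{0..t}|lebesgue. z s \<bullet> f)" if t: "t \<in> {0..T}" for t f
  proof -
    have c: "continuous_on {0..t} (\<lambda>s. F s (k s) \<bullet> f)"
      by (intro continuous_intros continuous_on_subset[OF cF]) (use t in auto)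
    have 1: "integral {0..t} (\<lambda>s. F s (k s)) \<bullet> f = integral {0..t} (\<lambda>s. F s (k s) \<bullet> f)"
      using integral_linear[OF Fint[OF t] bounded_linear_inner_left[of f]] by (simp add: o_def)
    have "(LINT s:{0..t}|lebesgue. z s \<bullet> f)
        = (LINT s:{0..t}|lebesgue. F s (k s) \<bullet> f) - (LINT s:{0..t}|lebesgue. q s \<bullet> f)"
      unfolding z_def inner_diff_left
      by (intro set_integral_diff set_lebesgue_integral_continuous(1) c q_int t)
    also have "\<dots> = integral {0..t} (\<lambda>s. F s (k s)) \<bullet> f - Q t \<bullet> f"
      unfolding set_lebesgue_integral_continuous(2)[OF c] q_int(2)[OF t] inner_Q[OF t] 1 ..
    finally show ?thesis
      by (subst keq[OF t]) (simp add: inner_add_left inner_diff_left)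
  qed
  define w where "w t v = z t \<bullet> J v" for t v
  define ks where "ks x t = R (k t) x" for x t
  have ksR: "(\<lambda>x. ks x t) = R (k t)" for t by (simp add: ks_def)
  have CV: "C_Vc Om eps sg T ks"
  proof (rule continuous_C_Vc)
    show "(\<lambda>x. ks x t) \<in> V" for t unfolding ksR by (rule R_Vc)
    show "continuous_on {0..T} (\<lambda>t. J (\<lambda>x. ks x t))"
      unfolding ksR using k by (rule continuous_on_eq) (simp add: JR)
  qed
  have L2V: "L2_Vc Om eps sg T ks"
    unfolding L2_Vc_def ksR
  proof (intro conjI ballI)
    show "AE t in MT. R (k t) \<in> V" by (simp add: R_Vc)
    have bfc: "continuous_on {0..T} (\<lambda>t. bf (k t) y)" for y
      by (rule bounded_bilinear.continuous_on[OF bounded_bilinear_bf k]) simp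
    fix v assume v: "v \<in> V"
    have "vc_inner Om eps sg (R (k t)) v = bf (k t) (J v)" for t
      using vc_inner_bf[OF R_Vc v] bf_proj unfolding proj_def by simp
    then show "(\<lambda>t. vc_inner Om eps sg (R (k t)) v) \<in> borel_measurable MT"
      using continuous_lebesgue_on_integrable[OF bfc[of "J v"]] by auto
  next
    have "continuous_on {0..T} (\<lambda>t. bf (k t) (k t))"
      by (rule bounded_bilinear.continuous_on[OF bounded_bilinear_bf k k])
    then show "integrable MT (\<lambda>t. (tnorm Om eps sg (R (k t)))\<^sup>2)"
      unfolding bf_self[symmetric] by (rule continuous_lebesgue_on_integrable)
  qed
  have wdual: "L2_dual Om eps sg T w"
    unfolding L2_dual_def
  proof (intro conjI ballI)
    show "AE t in MT. Vc_dual Om eps sg (w t)"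
      unfolding w_def by (simp add: Vc_dual_inner)
    show "(\<lambda>t. w t v) \<in> borel_measurable MT" for v
      unfolding w_def using zint[of "\<lambda>_. J v"] by auto
    obtain K where K: "K \<ge> 0" "\<And>f. norm (Binv f) \<le> norm f * K"
      using bounded_linear.nonneg_bounded[OF bounded_linear_Binv] by blast
    interpret BI: bounded_linear Binv by (rule bounded_linear_Binv)
    have dn: "(dual_norm Om eps sg (w t))\<^sup>2 = z t \<bullet> Binv (z t)" if "t \<in> {0..T}" for t
      by (rule dual_norm_sq) (auto simp: w_def proj_z[OF that])
    have cB: "continuous_on {0..T} (\<lambda>t. Binv (F t (k t)))"
      by (rule BI.continuous_on[OF cF])
    let ?h = "\<lambda>t. F t (k t) \<bullet> Binv (F t (k t)) - 2 * (q t \<bullet> Binv (F t (k t))) + (dual_norm Om eps sg (c t))\<^sup>2"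
    have hm: "?h \<in> borel_measurable MT"
    proof (intro borel_measurable_add borel_measurable_diff borel_measurable_times borel_measurable_const)
      show "(\<lambda>t. F t (k t) \<bullet> Binv (F t (k t))) \<in> borel_measurable MT"
        by (intro borel_measurable_integrable continuous_lebesgue_on_integrable continuous_intros cF cB)
      show "(\<lambda>t. q t \<bullet> Binv (F t (k t))) \<in> borel_measurable MT"
        by (intro borel_measurable_integrable inner_q_continuous_integrable cB)
      show "(\<lambda>t. (dual_norm Om eps sg (c t))\<^sup>2) \<in> borel_measurable MT"
        using c_dual by (auto simp: L2_dual_def)
    qed
    have zB: "AE t in MT. ?h t = (dual_norm Om eps sg (w t))\<^sup>2"
      using c_eq_q AE_space
    proof eventually_elim
      case (elim t)
      then have t: "t \<in> {0..T}" by simp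
      have "(dual_norm Om eps sg (c t))\<^sup>2 = q t \<bullet> Binv (q t)"
        by (rule dual_norm_sq) (use elim(1) proj_q in auto)
      then show ?case
        unfolding dn[OF t] z_def
        by (simp add: BI.diff inner_diff_left inner_diff_right Binv_sym[of "F t (k t)" "q t"])
    qed
    have "bounded ((\<lambda>t. F t (k t)) ` {0..T})"
      by (intro compact_imp_bounded compact_continuous_image cF) simp
    then obtain B where B: "\<And>t. t \<in> {0..T} \<Longrightarrow> norm (F t (k t)) \<le> B" unfolding bounded_iff by blast
    show "integrable MT (\<lambda>t. (dual_norm Om eps sg (w t))\<^sup>2)"
    proof (rule Bochner_Integration.integrable_bound)
      show "integrable MT (\<lambda>t. K * (2 * B\<^sup>2 + 2 * (qb t)\<^sup>2))"
        using qb_sq_integrable finite_measure.integrable_const[OF finite_measure_MT]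
        by (intro integrable_mult_right Bochner_Integration.integrable_add) auto
      show "(\<lambda>t. (dual_norm Om eps sg (w t))\<^sup>2) \<in> borel_measurable MT"
        by (rule borel_measurable_lebesgue_on_AE[OF _ hm zB]) simp
      show "AE t in MT. norm ((dual_norm Om eps sg (w t))\<^sup>2) \<le> norm (K * (2 * B\<^sup>2 + 2 * (qb t)\<^sup>2))"
      proof (intro AE_I2)
        fix t assume "t \<in> space MT"
        then have t: "t \<in> {0..T}" by simp
        have "norm (z t) \<le> B + qb t"
          unfolding z_def using norm_triangle_ineq4[of "F t (k t)" "q t"] B[OF t] norm_q_le[of t] by linarith
        then have "(norm (z t))\<^sup>2 \<le> (B + qb t)\<^sup>2" by (intro power_mono) auto
        also have "\<dots> \<le> 2 * B\<^sup>2 + 2 * (qb t)\<^sup>2"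
          using zero_le_power2[of "B - qb t"] by (simp add: power2_eq_square algebra_simps)
        finally have n: "(norm (z t))\<^sup>2 \<le> 2 * B\<^sup>2 + 2 * (qb t)\<^sup>2" .
        have "z t \<bullet> Binv (z t) \<le> norm (z t) * norm (Binv (z t))" by (rule norm_cauchy_schwarz)
        also have "\<dots> \<le> norm (z t) * (norm (z t) * K)" by (intro mult_left_mono K) simp
        also have "\<dots> = K * (norm (z t))\<^sup>2" by (simp add: power2_eq_square)
        also have "\<dots> \<le> K * (2 * B\<^sup>2 + 2 * (qb t)\<^sup>2)" by (intro mult_left_mono n K)
        finally show "norm ((dual_norm Om eps sg (w t))\<^sup>2) \<le> norm (K * (2 * B\<^sup>2 + 2 * (qb t)\<^sup>2))"
          unfolding dn[OF t, symmetric] by simp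
      qed
    qed
  qed
  have wt: "weak_time_deriv Om eps sg T ks w"
    unfolding weak_time_deriv_def
  proof (intro conjI wdual ballI allI impI)
    fix v psi assume v: "v \<in> V" and psi: "test_fun T psi"
    show "(LINT t:{0..T}|lebesgue. (LINT x:Om \<union> OmegaI Om eps|lebesgue. ks x t * v x) * deriv psi t)
        = - (LINT t:{0..T}|lebesgue. w t v * psi t)"
    proof (rule weak_derivative_of_indefinite_integral[OF _ psi _ T_pos])
      show "set_integrable lebesgue {0..T} (\<lambda>t. w t v)"
        unfolding w_def using zint[of "\<lambda>_. J v"] by (simp add: set_lebesgue_integral_restrict(2))
      fix t assume t: "t \<in> {0..T}"
      have "(LINT x:Om \<union> OmegaI Om eps|lebesgue. ks x t * v x) = k t \<bullet> J v"
        unfolding ks_def using inner_J_domain[OF R_Vc v] JR[OF t] by simp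
      then show "(LINT x:Om \<union> OmegaI Om eps|lebesgue. ks x t * v x) = J kz \<bullet> J v + (LINT s:{0..t}|lebesgue. w s v)"
        unfolding w_def using k_inner[OF t] by simp
    qed
  qed
  have weak: "(LINT t:{0..T}|lebesgue. w t (\<lambda>x. vphi x t))
      + (LINT t:{0..T}|lebesgue. abil Om eps sg delta (\<lambda>x. ks x t) (\<lambda>x. vphi x t))
      = (LINT t:{0..T}|lebesgue. (LINT x:Om|lebesgue. Pop Om eps sg mu xi A0 p phi ks x t * vphi x t)
          - c t (\<lambda>x. vphi x t))"
    if vphi: "C_Vc Om eps sg T vphi" for vphi
  proof -
    define y where "y t = J (\<lambda>x. vphi x t)" for t
    have y: "continuous_on {0..T} y" unfolding y_def by (rule C_Vc_continuous[OF vphi])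
    have yV: "(\<lambda>x. vphi x t) \<in> V" if "t \<in> {0..T}" for t using vphi that by (simp add: C_Vc_def)
    let ?a = "\<lambda>t. bf (k t) (y t) + delta * (k t \<bullet> y t)"
    have a: "integrable MT ?a"
      by (intro continuous_lebesgue_on_integrable continuous_intros k y
          bounded_bilinear.continuous_on[OF bounded_bilinear_bf])
    have zy: "integrable MT (\<lambda>t. z t \<bullet> y t)" by (rule zint[OF y])
    have S: "{0..T} \<in> sets lebesgue" by simp
    note restr = set_lebesgue_integral_restrict(1)[OF S]
    have 1: "(LINT t:{0..T}|lebesgue. w t (\<lambda>x. vphi x t)) = (\<integral>t. z t \<bullet> y t \<partial>MT)"
      by (simp add: set_lebesgue_integral_restrict(1) w_def y_def)
    have 2: "(LINT t:{0..T}|lebesgue. abil Om eps sg delta (\<lambda>x. ks x t) (\<lambda>x. vphi x t)) = (\<integral>t. ?a t \<partial>MT)"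
      unfolding restr ksR
      by (intro Bochner_Integration.integral_cong refl) (simp add: abil_eq R_Vc yV JR y_def)
    let ?r = "\<lambda>t. (LINT x:Om|lebesgue. Pop Om eps sg mu xi A0 p phi ks x t * vphi x t) - c t (\<lambda>x. vphi x t)"
    have ae: "AE t in MT. z t \<bullet> y t + ?a t = ?r t"
      using c_eq_q AE_space
    proof eventually_elim
      case (elim t)
      then have t: "t \<in> {0..T}" by simp
      have "c t (\<lambda>x. vphi x t) = q t \<bullet> y t" using elim(1) yV[OF t] by (simp add: y_def)
      moreover have "(LINT x:Om|lebesgue. Pop Om eps sg mu xi A0 p phi ks x t * vphi x t) = Nop t (k t) \<bullet> y t"
        unfolding Pop_eq ksR using inner_PopU[OF R_Vc yV[OF t] t, of "k t"] JR[OF t] by (simp add: y_def)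
      ultimately show ?case
        using proj_k[OF t] by (simp add: z_def inner_diff_left inner_F)
    qed
    have rm: "?r \<in> borel_measurable MT"
      by (rule borel_measurable_lebesgue_on_AE[OF _ _ ae]) (use zy a in auto)
    have "(\<integral>t. z t \<bullet> y t \<partial>MT) + (\<integral>t. ?a t \<partial>MT) = (\<integral>t. z t \<bullet> y t + ?a t \<partial>MT)"
      using zy a by (simp add: Bochner_Integration.integral_add)
    also have "\<dots> = (\<integral>t. ?r t \<partial>MT)"
      by (rule integral_cong_AE[OF _ rm ae]) (use zy a in auto)
    finally show ?thesis unfolding 1 2 by (simp add: set_lebesgue_integral_restrict(1))
  qed
  have init: "AE x in lebesgue_on Om. ks x 0 = k0 x"
  proof -
    have "k 0 = J kz" using keq[of 0] T_ge_0 by (simp add: Q_0)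
    then have "AE x in lebesgue. ks x 0 = indicator Om x * kz x"
      unfolding ks_def using AE_R_J[OF Vc_L2Om[OF k0_Vc]] by simp
    then have "AE x in lebesgue. x \<in> Om \<longrightarrow> ks x 0 = k0 x"
      by eventually_elim auto
    then show ?thesis by (subst AE_restrict_space_iff) auto
  qed
  have bdry: "AE x in lebesgue_on (OmegaI Om eps). ks x t = 0" for t
    by (rule AE_I2) (auto simp: ks_def R_def OmegaI_def)
  have "solves ks"
    unfolding weak_solution_def H1_Vc_def using CV L2V wt weak init bdry by blast
  then show ?thesis by blast
qed


lemma weak_solution_test:
  assumes sol: "solves k" and v: "v \<in> V" and psi: "test_fun T psi"
  defines "y \<equiv> \<lambda>t. J (\<lambda>x. k x t)"
  shows "(LINT t:{0..T}|lebesgue. (y t \<bullet> J v) * deriv psi t)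
    = (\<integral>t. psi t * (q t \<bullet> J v) \<partial>MT) - (\<integral>t. psi t * (F t (y t) \<bullet> J v) \<partial>MT)"
proof -
  obtain w where kC: "C_Vc Om eps sg T k" and w: "weak_time_deriv Om eps sg T k w"
    and eq: "\<And>vphi. C_Vc Om eps sg T vphi \<Longrightarrow>
           (LINT t:{0..T}|lebesgue. w t (\<lambda>x. vphi x t))
           + (LINT t:{0..T}|lebesgue. abil Om eps sg delta (\<lambda>x. k x t) (\<lambda>x. vphi x t))
           = (LINT t:{0..T}|lebesgue.
                (LINT x:Om|lebesgue. Pop Om eps sg mu xi A0 p phi k x t * vphi x t)
                - c t (\<lambda>x. vphi x t))"
    using sol unfolding weak_solution_def by blast
  have S: "{0..T} \<in> sets lebesgue" by simp
  note restr = set_lebesgue_integral_restrict(1)[OF S]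
  have y: "continuous_on {0..T} y" unfolding y_def by (rule C_Vc_continuous[OF kC])
  have kV: "(\<lambda>x. k x t) \<in> V" if "t \<in> {0..T}" for t using kC that by (simp add: C_Vc_def)
  have cpsi: "continuous_on {0..T} psi"
    by (rule DERIV_continuous_on[of _ _ "deriv psi"])
      (rule has_field_derivative_at_within[OF test_fun_deriv(1)[OF psi]])
  have psiV: "(\<lambda>x. psi t * v x) \<in> V" for t by (rule Vc_scale[OF v])
  have CV: "C_Vc Om eps sg T (\<lambda>x t. psi t * v x)"
    by (rule continuous_C_Vc) (auto simp: J_scale[OF v] psiV intro!: continuous_intros cpsi)
  have wL: "L2_dual Om eps sg T w" using w by (simp add: weak_time_deriv_def)
  have wm: "(\<lambda>t. w t v) \<in> borel_measurable MT" using wL v by (simp add: L2_dual_def)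
  have psim: "psi \<in> borel_measurable MT"
    using continuous_lebesgue_on_integrable[OF cpsi] by auto
  have w1: "(\<integral>t. w t (\<lambda>x. psi t * v x) \<partial>MT) = (\<integral>t. w t v * psi t \<partial>MT)"
  proof -
    have "AE t in MT. Vc_dual Om eps sg (w t)" using wL by (simp add: L2_dual_def)
    then have ae: "AE t in MT. w t v * psi t = w t (\<lambda>x. psi t * v x)"
    proof eventually_elim
      case (elim t)
      then have "w t (\<lambda>x. psi t * v x + 0 * v x) = psi t * w t v + 0 * w t v"
        using v unfolding Vc_dual_def by blast
      then show ?case by simp
    qed
    have m: "(\<lambda>t. w t v * psi t) \<in> borel_measurable MT" using wm psim by simp
    show ?thesis
      by (rule integral_cong_AE[OF borel_measurable_lebesgue_on_AE[OF S m ae] m])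
        (use ae in eventually_elim, simp)
  qed
  have w2: "(LINT t:{0..T}|lebesgue. (y t \<bullet> J v) * deriv psi t) = - (\<integral>t. w t v * psi t \<partial>MT)"
  proof -
    have "(LINT t:{0..T}|lebesgue. (LINT x:Om \<union> OmegaI Om eps|lebesgue. k x t * v x) * deriv psi t)
        = - (LINT t:{0..T}|lebesgue. w t v * psi t)"
      using w v psi unfolding weak_time_deriv_def by blast
    moreover have "(LINT t:{0..T}|lebesgue. (LINT x:Om \<union> OmegaI Om eps|lebesgue. k x t * v x) * deriv psi t)
        = (LINT t:{0..T}|lebesgue. (y t \<bullet> J v) * deriv psi t)"
      unfolding restr
      by (intro Bochner_Integration.integral_cong refl) (simp add: inner_J_domain[OF kV v] y_def)
    ultimately show ?thesis by (simp add: restr)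
  qed
  let ?a = "\<lambda>t. psi t * (bf (y t) (J v) + delta * (y t \<bullet> J v))"
  let ?n = "\<lambda>t. psi t * (Nop t (y t) \<bullet> J v)"
  let ?q = "\<lambda>t. psi t * (q t \<bullet> J v)"
  have bfc: "continuous_on {0..T} (\<lambda>t. bf (y t) (J v))"
    by (rule bounded_bilinear.continuous_on[OF bounded_bilinear_bf y]) simp
  have ai: "integrable MT ?a"
    by (intro continuous_lebesgue_on_integrable continuous_intros cpsi y bfc)
  have ni: "integrable MT ?n"
    by (intro continuous_lebesgue_on_integrable continuous_intros cpsi continuous_on_Nop y)
  have qi: "integrable MT ?q"
  proof -
    have "integrable MT (\<lambda>t. q t \<bullet> (psi t *\<^sub>R J v))"
      by (intro inner_q_continuous_integrable continuous_intros cpsi)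
    then show ?thesis by simp
  qed
  have a: "(\<integral>t. abil Om eps sg delta (\<lambda>x. k x t) (\<lambda>x. psi t * v x) \<partial>MT) = (\<integral>t. ?a t \<partial>MT)"
  proof (intro Bochner_Integration.integral_cong refl)
    fix t assume "t \<in> space MT"
    then have t: "t \<in> {0..T}" by simp
    have "bf (y t) (psi t *\<^sub>R J v) = psi t * bf (y t) (J v)"
      using bounded_bilinear.scaleR_right[OF bounded_bilinear_bf, of "y t" "psi t" "J v"] by simp
    then show "abil Om eps sg delta (\<lambda>x. k x t) (\<lambda>x. psi t * v x) = ?a t"
      by (simp add: abil_eq[OF kV[OF t] psiV] J_scale[OF v] y_def algebra_simps)
  qed
  let ?r = "\<lambda>t. (LINT x:Om|lebesgue. Pop Om eps sg mu xi A0 p phi k x t * (psi t * v x)) - c t (\<lambda>x. psi t * v x)"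
  have ae: "AE t in MT. ?n t - ?q t = ?r t"
    using c_eq_q AE_space
  proof eventually_elim
    case (elim t)
    then have t: "t \<in> {0..T}" by simp
    have "c t (\<lambda>x. psi t * v x) = ?q t" using elim(1) psiV by (simp add: J_scale[OF v])
    moreover have "(LINT x:Om|lebesgue. Pop Om eps sg mu xi A0 p phi k x t * (psi t * v x)) = ?n t"
      unfolding Pop_eq using inner_PopU[OF kV[OF t] psiV t] by (simp add: J_scale[OF v] y_def)
    ultimately show ?case by simp
  qed
  have dm: "(\<lambda>t. ?n t - ?q t) \<in> borel_measurable MT" using ni qi by auto
  have r: "(\<integral>t. ?r t \<partial>MT) = (\<integral>t. ?n t - ?q t \<partial>MT)"
    by (rule integral_cong_AE[OF borel_measurable_lebesgue_on_AE[OF S dm ae] dm])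
      (use ae in eventually_elim, simp)
  have "(\<integral>t. w t (\<lambda>x. psi t * v x) \<partial>MT) + (\<integral>t. abil Om eps sg delta (\<lambda>x. k x t) (\<lambda>x. psi t * v x) \<partial>MT)
      = (\<integral>t. ?r t \<partial>MT)"
    using eq[OF CV] unfolding restr .
  then have main: "(\<integral>t. w t v * psi t \<partial>MT) + (\<integral>t. ?a t \<partial>MT) = (\<integral>t. ?n t \<partial>MT) - (\<integral>t. ?q t \<partial>MT)"
    unfolding w1 a r using ni qi by (simp add: Bochner_Integration.integral_diff)
  have "(\<integral>t. psi t * (F t (y t) \<bullet> J v) \<partial>MT) = (\<integral>t. ?n t - ?a t \<partial>MT)"
    by (intro Bochner_Integration.integral_cong refl)
      (simp add: inner_F proj_J kV Vc_L2Om y_def algebra_simps)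
  also have "\<dots> = (\<integral>t. ?n t \<partial>MT) - (\<integral>t. ?a t \<partial>MT)"
    using ni ai by (rule Bochner_Integration.integral_diff)
  finally show ?thesis unfolding w2 using main by simp
qed

lemma uniqueness:
  assumes k1: "solves k1" and k2: "solves k2" and t: "t \<in> {0..T}"
  shows "AE x in lebesgue_on (Om \<union> OmegaI Om eps). k1 x t = k2 x t"
proof -
  have C: "C_Vc Om eps sg T k1" "C_Vc Om eps sg T k2"
    using k1 k2 by (auto simp: weak_solution_def)
  define y1 where "y1 t = J (\<lambda>x. k1 x t)" for t
  define y2 where "y2 t = J (\<lambda>x. k2 x t)" for t
  have c1: "continuous_on {0..T} y1" and c2: "continuous_on {0..T} y2"
    unfolding y1_def y2_def by (intro C_Vc_continuous C)+
  have V: "(\<lambda>x. k1 x t) \<in> V" "(\<lambda>x. k2 x t) \<in> V" if "t \<in> {0..T}" for t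
    using C that by (auto simp: C_Vc_def)
  define e where "e t = y1 t - y2 t" for t
  have ce: "continuous_on {0..T} e" unfolding e_def by (intro continuous_intros c1 c2)
  define D where "D t = F t (y1 t) - F t (y2 t)" for t
  have cD: "continuous_on {0..T} D" unfolding D_def by (intro continuous_intros continuous_on_F c1 c2)
  obtain L where L: "L \<ge> 0" "\<And>s f g. s \<in> {0..T} \<Longrightarrow> norm (F s f - F s g) \<le> L * norm (f - g)"
    using F_lipschitz_ex by blast
  have e0: "e 0 = 0"
  proof -
    have "J (\<lambda>x. k x 0) = J kz" if "solves k" for k
    proof -
      have kV: "(\<lambda>x. k x 0) \<in> V" using that T_ge_0 by (simp add: weak_solution_def C_Vc_def)
      have "AE x in lebesgue_on Om. k x 0 = k0 x" using that by (simp add: weak_solution_def)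
      then have "AE x in lebesgue. x \<in> Om \<longrightarrow> k x 0 = k0 x" by (subst (asm) AE_restrict_space_iff) auto
      then have "AE x in lebesgue. x \<in> Om \<longrightarrow> k x 0 = kz x" by eventually_elim simp
      then show ?thesis by (subst J_cong) (auto intro: Vc_L2Om kV k0_Vc)
    qed
    then show ?thesis using k1 k2 by (simp add: e_def y1_def y2_def)
  qed
  have dS: "{0..T} \<in> sets lebesgue" by simp
  note restr = set_lebesgue_integral_restrict(1)[OF dS]
  have ev: "e t \<bullet> J v = integral {0..t} (\<lambda>s. D s \<bullet> J v)" if v: "v \<in> V" and t: "t \<in> {0..T}" for v t
  proof -
    define g where "g s = D s \<bullet> J v" for s
    have cg: "continuous_on {0..T} g" unfolding g_def by (intro continuous_intros cD)
    define G where "G t = (LINT s:{0..t}|lebesgue. g s)" for t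
    have G: "G t = integral {0..t} g" if "t \<in> {0..T}" for t
      unfolding G_def by (intro set_lebesgue_integral_continuous continuous_on_subset[OF cg]) (use that in auto)
    have "continuous_on {0..T} (\<lambda>t. integral {0..t} g)"
      by (intro indefinite_integral_continuous_1 integrable_continuous_real cg)
    then have cG: "continuous_on {0..T} G" by (rule continuous_on_eq) (simp add: G)
    have cH: "continuous_on {0..T} (\<lambda>t. e t \<bullet> J v - G t)" by (intro continuous_intros ce cG)
    have "e t \<bullet> J v - G t = e 0 \<bullet> J v - G 0"
    proof (rule du_Bois_Reymond[OF T_pos cH _ t])
      fix psi assume psi: "test_fun T psi"
      have cd: "continuous_on {0..T} (deriv psi)" by (rule test_fun_deriv(2)[OF psi])
      have cpsi: "continuous_on {0..T} psi"
        by (rule DERIV_continuous_on[of _ _ "deriv psi"])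
          (rule has_field_derivative_at_within[OF test_fun_deriv(1)[OF psi]])
      have iy: "integrable MT (\<lambda>t. (y t \<bullet> J v) * deriv psi t)" if "continuous_on {0..T} y" for y
        by (intro continuous_lebesgue_on_integrable continuous_intros that cd)
      have iF: "integrable MT (\<lambda>t. psi t * (F t (y t) \<bullet> J v))" if "continuous_on {0..T} y" for y
        by (intro continuous_lebesgue_on_integrable continuous_intros that cpsi continuous_on_F)
      have iG: "integrable MT (\<lambda>t. G t * deriv psi t)"
        by (intro continuous_lebesgue_on_integrable continuous_intros cG cd)
      have 1: "(\<integral>t. (y1 t \<bullet> J v) * deriv psi t \<partial>MT) - (\<integral>t. (y2 t \<bullet> J v) * deriv psi t \<partial>MT)
          = (\<integral>t. psi t * (F t (y2 t) \<bullet> J v) \<partial>MT) - (\<integral>t. psi t * (F t (y1 t) \<bullet> J v) \<partial>MT)"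
        using weak_solution_test[OF k1 v psi] weak_solution_test[OF k2 v psi]
        unfolding restr y1_def[symmetric] y2_def[symmetric] by simp
      have 2: "(\<integral>t. G t * deriv psi t \<partial>MT) = - (\<integral>t. g t * psi t \<partial>MT)"
        using weak_derivative_of_indefinite_integral[OF set_lebesgue_integral_continuous(1)[OF cg] psi, of G 0] T_pos
        unfolding restr by (simp add: G_def)
      have 3: "(\<integral>t. g t * psi t \<partial>MT)
          = (\<integral>t. psi t * (F t (y1 t) \<bullet> J v) - psi t * (F t (y2 t) \<bullet> J v) \<partial>MT)"
        by (intro Bochner_Integration.integral_cong refl)
          (simp add: g_def D_def inner_diff_left algebra_simps)
      have "(LINT t:{0..T}|lebesgue. (e t \<bullet> J v - G t) * deriv psi t)
          = (\<integral>t. ((y1 t \<bullet> J v) * deriv psi t - (y2 t \<bullet> J v) * deriv psi t) - G t * deriv psi t \<partial>MT)"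
        unfolding restr
        by (intro Bochner_Integration.integral_cong refl) (simp add: e_def inner_diff_left algebra_simps)
      also have "\<dots> = (\<integral>t. (y1 t \<bullet> J v) * deriv psi t \<partial>MT) - (\<integral>t. (y2 t \<bullet> J v) * deriv psi t \<partial>MT)
          - (\<integral>t. G t * deriv psi t \<partial>MT)"
        using iy[OF c1] iy[OF c2] iG by (simp add: Bochner_Integration.integral_diff)
      also have "\<dots> = 0"
        unfolding 1 2 3 using iF[OF c1] iF[OF c2] by (simp add: Bochner_Integration.integral_diff)
      finally show "(LINT t:{0..T}|lebesgue. (e t \<bullet> J v - G t) * deriv psi t) = 0" .
    qed
    moreover have "G 0 = 0" using G[of 0] T_ge_0 by simp
    ultimately show ?thesis using G[OF t] e0 by (simp add: g_def[abs_def])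
  qed
  have pe: "J (R (e t)) = e t" if "t \<in> {0..T}" for t
    using proj_J[OF Vc_L2Om[OF V(1)[OF that]]] proj_J[OF Vc_L2Om[OF V(2)[OF that]]]
      linear_diff[OF bounded_linear.linear[OF bounded_linear_proj]]
    by (simp add: e_def y1_def y2_def flip: proj_def)
  have gron: "norm (e t) \<le> L * integral {0..t} (\<lambda>s. norm (e s))" if t: "t \<in> {0..T}" for t
  proof -
    have ne: "(\<lambda>s. norm (e s)) integrable_on {0..t}"
      by (intro integrable_continuous_real continuous_intros continuous_on_subset[OF ce]) (use t in auto)
    have "norm (e t) * norm (e t) = e t \<bullet> J (R (e t))"
      unfolding pe[OF t] by (simp add: power2_norm_eq_inner flip: power2_eq_square)
    also have "\<dots> = integral {0..t} (\<lambda>s. D s \<bullet> e t)"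
      using ev[OF R_Vc t, of "e t"] unfolding pe[OF t] .
    also have "\<dots> \<le> integral {0..t} (\<lambda>s. (L * norm (e t)) * norm (e s))"
    proof (rule integral_le)
      show "(\<lambda>s. D s \<bullet> e t) integrable_on {0..t}"
        by (intro integrable_continuous_real continuous_intros continuous_on_subset[OF cD]) (use t in auto)
      show "(\<lambda>s. (L * norm (e t)) * norm (e s)) integrable_on {0..t}"
        by (rule integrable_on_mult_right[OF ne])
      fix s assume s: "s \<in> {0..t}"
      have "D s \<bullet> e t \<le> norm (D s) * norm (e t)" by (rule norm_cauchy_schwarz)
      also have "\<dots> \<le> (L * norm (e s)) * norm (e t)"
        unfolding D_def e_def using s t by (intro mult_right_mono L) auto
      finally show "D s \<bullet> e t \<le> (L * norm (e t)) * norm (e s)" by (simp add: mult_ac)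
    qed
    also have "\<dots> = (L * integral {0..t} (\<lambda>s. norm (e s))) * norm (e t)" by simp
    finally have "norm (e t) * norm (e t) \<le> (L * integral {0..t} (\<lambda>s. norm (e s))) * norm (e t)" .
    moreover have "0 \<le> L * integral {0..t} (\<lambda>s. norm (e s))"
      by (intro mult_nonneg_nonneg L Henstock_Kurzweil_Integration.integral_nonneg ne) simp
    ultimately show ?thesis by (cases "e t = 0") auto
  qed
  have "norm (e t) = 0"
    by (rule Gronwall_zero[OF _ _ L(1) gron t]) (auto intro!: continuous_intros ce)
  then have "J (\<lambda>x. k1 x t) = J (\<lambda>x. k2 x t)" by (simp add: e_def y1_def y2_def)
  then have "AE x in lebesgue. x \<in> Om \<longrightarrow> k1 x t = k2 x t"
    using J_cong[OF Vc_L2Om[OF V(1)[OF t]] Vc_L2Om[OF V(2)[OF t]]] by blast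
  moreover have "AE x in lebesgue. x \<in> OmegaI Om eps \<longrightarrow> k1 x t = 0" "AE x in lebesgue. x \<in> OmegaI Om eps \<longrightarrow> k2 x t = 0"
    using V[OF t] by (auto simp: Vc_iff)
  ultimately have "AE x in lebesgue. x \<in> Om \<union> OmegaI Om eps \<longrightarrow> k1 x t = k2 x t"
    by eventually_elim auto
  then show ?thesis by (subst AE_restrict_space_iff) auto
qed

end

theorem theorem1:
  fixes Om :: "'a::euclidean_space set"
    and T eps sg mu xi delta Mp :: real
    and p phi :: "real \<Rightarrow> real"
    and A0 :: "'a \<Rightarrow> real"
    and c :: "real \<Rightarrow> ('a \<Rightarrow> real) \<Rightarrow> real"
    and k0 :: "'a \<Rightarrow> real"
  assumes "open Om" and "bounded Om" and "connected Om"
    and "lipschitz_domain Om" and "piecewise_smooth_boundary Om" and "cone_condition Om"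
    and "T > 0" and "eps > 0" and "sg > 0" and "0 < mu" and "mu < eps"
    and "xi > 0" and "delta > 0"
    and "Mp > 0" and "\<forall>s. 0 \<le> p s \<and> p s \<le> Mp" and "p 0 = 0" and "\<exists>L. L-lipschitz_on UNIV p"
    and "\<forall>s. 0 \<le> phi s" and "\<exists>L. L-lipschitz_on UNIV phi"
    and "\<forall>x. 0 \<le> A0 x" and "A0 \<in> borel_measurable (lebesgue_on Om)"
    and "\<exists>C. AE x in lebesgue_on Om. \<bar>A0 x\<bar> \<le> C"
    and "L2_dual Om eps sg T c"
    and "(\<lambda>x. if x \<in> Om then k0 x else 0) \<in> Vc Om eps sg"
  shows "(\<exists>k. weak_solution Om eps sg mu xi delta T A0 p phi c k0 k) \<and>
         (\<forall>k1 k2. weak_solution Om eps sg mu xi delta T A0 p phi c k0 k1 \<and>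
                  weak_solution Om eps sg mu xi delta T A0 p phi c k0 k2 \<longrightarrow>
            (\<forall>t\<in>{0..T}. AE x in lebesgue_on (Om \<union> OmegaI Om eps). k1 x t = k2 x t))"
proof -
  obtain Lp where Lp: "Lp-lipschitz_on UNIV p" using assms by blast
  obtain Lphi where Lphi: "Lphi-lipschitz_on UNIV phi" using assms by blast
  obtain C where C: "AE x in lebesgue_on Om. \<bar>A0 x\<bar> \<le> C" using assms by blast
  have "AE x in lebesgue_on Om. A0 x \<le> \<bar>C\<bar>" using C by eventually_elim simp
  then interpret nonlocal_problem Om eps sg mu xi T Mp Lp Lphi "\<bar>C\<bar>" p phi A0 c delta k0
    using assms Lp Lphi by unfold_locales auto
  show ?thesis using existence uniqueness by blast
qed

end
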